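(* Let $T$ be an $L^2(\mathbb{R}^d)$-bounded Calderón–Zygmund operator on $\mathbb{R}^d$. Then there is a finite constant $C_T$, depending on $T$ but not on $w$ or $f$, such that for every weight $w \in A_2$ and every $f \in L^2(w)$, $$\lVert T f \rVert_{L^2(w)} \le C_T\, [w]_{A_2}\, \lVert f \rVert_{L^2(w)} .$$
   Context: A weight $w$ on $\mathbb{R}^d$ is a locally integrable function with $w>0$ almost everywhere, identified with the measure $w(dx)=w(x)\,dx$. For a weight $w$ put $\sigma = w^{-1}$ (defined a.e.), $w(Q)=\int_Q w\,dx$, $\sigma(Q)=\int_Q \sigma\,dx$, let $|Q|$ denote Lebesgue measure, and $$[w]_{A_2} := \sup_Q \frac{w(Q)}{|Q|}\,\frac{\sigma(Q)}{|Q|},$$ the supremum being over all cubes $Q\subset\mathbb{R}^d$. One writes $w\in A_2$ if $[w]_{A_2}<\infty$. The norm is $\lVert f\rVert_{L^2(w)} = \bigl[\int_{\mathbb{R}^d} |f|^2\, w(dx)\bigr]^{1/2}$. An $L^2$-bounded Calderón–Zygmund operator is understood in the usual sense: a bounded linear operator $T$ on $L^2(\mathbb{R}^d)$ for which there is a kernel $K(x,y)$, defined for $x\neq y$, with $Tf(x)=\int K(x,y) f(y)\,dy$ for bounded compactly supported $f$ and a.e. $x\notin\operatorname{supp} f$, and such that for some $C<\infty$ and $\delta\in(0,1]$ one has $|K(x,y)|\le C|x-y|^{-d}$ for $x \ne y$ and $|K(x,y)-K(x',y)|+|K(y,x)-K(y,x')|\le C\,|x-x'|^{\delta}|x-y|^{-d-\delta}$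 whenever $|x-y|>2|x-x'|$ (smoothness in both variables). As usual, the inequality is an a priori estimate for $f\in L^2(\mathbb{R}^d)\cap L^2(w)$, a dense subspace of $L^2(w)$, and $T$ on $L^2(w)$ means the resulting bounded extension. *)

theory Defs
  imports "HOL-Analysis.Analysis"
begin

text \<open>Functions are complex valued. Elements of \<open>L\<^sup>2\<close> are represented by measurable functions, so
  identities between them are stated almost everywhere.\<close>

definition L2 :: "'a measure \<Rightarrow> ('a \<Rightarrow> complex) set" where
  "L2 M = {f \<in> borel_measurable M. integrable M (\<lambda>x. (cmod (f x))\<^sup>2)}"

definition L2_norm :: "'a measure \<Rightarrow> ('a \<Rightarrow> complex) \<Rightarrow> real" where
  "L2_norm M f = sqrt (LINT x|M. (cmod (f x))\<^sup>2)"

text \<open>Linearity and boundedness together imply that \<open>T\<close> respects equality almost everywhere.\<close>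

definition bounded_operator_L2 :: "'a measure \<Rightarrow> (('a \<Rightarrow> complex) \<Rightarrow> 'a \<Rightarrow> complex) \<Rightarrow> bool" where
  "bounded_operator_L2 M T \<longleftrightarrow>
     (\<forall>f\<in>L2 M. T f \<in> L2 M) \<and>
     (\<forall>f\<in>L2 M. \<forall>g\<in>L2 M. AE x in M. T (\<lambda>y. f y + g y) x = T f x + T g x) \<and>
     (\<forall>c. \<forall>f\<in>L2 M. AE x in M. T (\<lambda>y. c * f y) x = c * T f x) \<and>
     (\<exists>B. \<forall>f\<in>L2 M. L2_norm M (T f) \<le> B * L2_norm M f)"

definition calderon_zygmund_kernel :: "(real^'d \<Rightarrow> real^'d \<Rightarrow> complex) \<Rightarrow> bool" where
  "calderon_zygmund_kernel K \<longleftrightarrow>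
     (\<exists>C \<delta>. 0 < \<delta> \<and> \<delta> \<le> 1 \<and>
       (\<forall>x y. x \<noteq> y \<longrightarrow> cmod (K x y) \<le> C / norm (x - y) ^ CARD('d)) \<and>
       (\<forall>x x' y. norm (x - y) > 2 * norm (x - x') \<longrightarrow>
          cmod (K x y - K x' y) + cmod (K y x - K y x')
            \<le> C * norm (x - x') powr \<delta> / norm (x - y) powr (real CARD('d) + \<delta>)))"

text \<open>The kernel is only relevant off the diagonal: in the integral below \<open>x\<close> lies at positive
  distance from the support of \<open>f\<close>, so the integrand vanishes near \<open>y = x\<close> and is integrable.\<close>

definition calderon_zygmund_operator ::
    "((real^'d \<Rightarrow> complex) \<Rightarrow> real^'d \<Rightarrow> complex) \<Rightarrow> bool" where
  "calderon_zygmund_operator T \<longleftrightarrow>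
     bounded_operator_L2 lebesgue T \<and>
     (\<exists>K. calderon_zygmund_kernel K \<and>
       (\<forall>f \<in> borel_measurable lebesgue.
          bounded (range f) \<longrightarrow> compact (closure {y. f y \<noteq> 0}) \<longrightarrow>
          (AE x in lebesgue. x \<notin> closure {y. f y \<noteq> 0} \<longrightarrow>
             T f x = (LINT y|lebesgue. K x y * f y))))"

definition weight :: "(real^'d \<Rightarrow> real) \<Rightarrow> bool" where
  "weight w \<longleftrightarrow> w \<in> borel_measurable lebesgue \<and>
     (\<forall>A. compact A \<longrightarrow> w absolutely_integrable_on A) \<and> (AE x in lebesgue. w x > 0)"

definition weight_measure :: "(real^'d \<Rightarrow> real) \<Rightarrow> (real^'d) measure" where
  "weight_measure w = density lebesgue (\<lambda>x. ennreal (w x))"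

definition cubes :: "(real^'d) set set" where
  "cubes = {cbox a (\<chi> i. a $ i + l) | a l. l > 0}"

text \<open>The dual weight \<open>\<sigma> = 1/w\<close> need not be locally integrable, hence the extended real values.\<close>

definition A2_constant :: "(real^'d \<Rightarrow> real) \<Rightarrow> ennreal" where
  "A2_constant w =
     (SUP Q\<in>cubes. emeasure (weight_measure w) Q / emeasure lebesgue Q *
        (emeasure (weight_measure (\<lambda>x. inverse (w x))) Q / emeasure lebesgue Q))"

definition A2_weight :: "(real^'d \<Rightarrow> real) \<Rightarrow> bool" where
  "A2_weight w \<longleftrightarrow> weight w \<and> A2_constant w < \<infinity>"

text \<open>\<open>S\<close> is a bounded operator on \<open>L\<^sup>2(w)\<close> that agrees with \<open>T\<close> on \<open>L\<^sup>2 \<inter> L\<^sup>2(w)\<close>. As this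
  subspace is dense in \<open>L\<^sup>2(w)\<close>, there is at most one such \<open>S\<close> up to equality almost everywhere.\<close>

definition bounded_extension_L2 ::
    "(real^'d \<Rightarrow> real) \<Rightarrow> ((real^'d \<Rightarrow> complex) \<Rightarrow> real^'d \<Rightarrow> complex) \<Rightarrow>
      ((real^'d \<Rightarrow> complex) \<Rightarrow> real^'d \<Rightarrow> complex) \<Rightarrow> bool" where
  "bounded_extension_L2 w T S \<longleftrightarrow>
     bounded_operator_L2 (weight_measure w) S \<and>
     (\<forall>f \<in> L2 lebesgue \<inter> L2 (weight_measure w). AE x in lebesgue. S f x = T f x)"

end

theory Submission
  imports Defs
begin

text \<open>
  The proof passes through sparse domination. For a cube \<open>Q\<close> let \<open>Q*\<close> be its concentric dilate by a fixed odd
  factor. For bounded \<open>f\<close> of bounded support one constructs a countable family of dyadic subcubes \<open>P\<close> of a large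
  cube with pairwise disjoint subsets \<open>E\<^sub>P \<subseteq> P\<close>, \<open>|P| \<le> 2|E\<^sub>P|\<close>, such that almost everywhere on the large cube
  \<open>|T f|\<close> is at most a constant times the sum of the averages of \<open>|f|\<close> over those \<open>P*\<close> for which \<open>x \<in> P\<close>
  (\<open>sparse_domination\<close>). This reduces the theorem to a weighted estimate for sums of averages.

  The family comes from a stopping-time recursion. Inside \<open>Q\<close> one stops at the maximal cubes \<open>P\<close> where either
  \<open>|f|\<close> has a large average over \<open>P*\<close> or the set where \<open>|T(f 1\<^bsub>Q*\<^esub>)|\<close> is large has noticeable density. Two facts
  make this work. By the weak-type estimate \<open>local_weak_type\<close> and its analogue for averages, \<open>weak_type_dils\<close>,
  the stopping cubes fill at most half of \<open>Q\<close>. On a stopping cube \<open>P\<close> the far part \<open>T(f 1\<^bsub>Q* - P*\<^esub>)\<close> is essentially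
  constant: its oscillation is controlled through the smoothness of the kernel by the averages of \<open>|f|\<close> over the
  dilated ancestors of \<open>P\<close>, none of which was stopped (\<open>oscillation\<close>), and at some point of \<open>P\<close> it is small.
  Hence \<open>|T(f 1\<^bsub>Q*\<^esub>)| \<le> |T(f 1\<^bsub>P*\<^esub>)| + const \<cdot> avg\<^bsub>Q*\<^esub> |f|\<close> on \<open>P\<close>, and one iterates
  (\<open>stopping_step\<close>). The weak-type estimate itself is the classical consequence of the \<open>L\<^sup>2\<close> bound and
  \<open>calderon_zygmund_decomposition\<close>.

  For the weighted bound write \<open>\<sigma> = 1/w\<close> and let \<open>G\<close> be a finite sparse sum. Then \<open>\<integral>G\<^sup>2 w\<close> is a sum over \<open>P\<close> of
  \<open>w(P)\<sigma>(P*)/|P*|\<close> times a \<open>\<sigma>\<close>-average of \<open>|f|w\<close> over \<open>P*\<close> times a \<open>w\<close>-average of \<open>G\<close> over \<open>P\<close>. The first factor is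
  at most a constant times \<open>[w] |E\<^sub>P|\<close>, which is where the constant enters to the first power; since \<open>\<sigma>w = 1\<close>, the
  Lebesgue measure of \<open>E\<^sub>P\<close> is controlled by \<open>\<sigma>(E\<^sub>P)\<close> and \<open>w(E\<^sub>P)\<close> (\<open>weighted_am_gm\<close>); and the remaining sums are
  bounded by Doob's maximal inequality for nested families, whose constant does not depend on the measure
  (\<open>laminar_maximal\<close>). This gives \<open>sparse_sum_bound\<close>. The dilates \<open>P*\<close> are handled by distributing them over
  finitely many dyadic grids (\<open>dil_is_cell\<close>).

  Finally, truncations of \<open>f \<in> L\<^sup>2(w)\<close> are bounded with bounded support, and the estimate passes to the bounded
  extension by approximation.
\<close>

section \<open>Dyadic grids and their dilated cubes\<close>

abbreviation vol :: "'a::euclidean_space set \<Rightarrow> real" where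
  "vol S \<equiv> measure lebesgue S"

definition hcube :: "real^'d \<Rightarrow> real \<Rightarrow> (real^'d) set" where
  "hcube c r = {x. \<forall>i. c$i \<le> x$i \<and> x$i < c$i + r}"

text \<open>A grid is given by a corner \<open>a\<close> and a mesh \<open>L\<close>; its generation \<open>k\<close> consists of the half-open cubes of side
  \<open>L / 2^k\<close>. Describing a cube by the integer vector of floors turns the nesting of dyadic cubes into the identity
  \<open>\<lfloor>z\<rfloor> = \<lfloor>2^n z\<rfloor> div 2^n\<close>, so that \<open>anc n m\<close> below is the index of the \<open>n\<close>-th ancestor of cube \<open>m\<close>.\<close>

definition idx :: "real^'d \<Rightarrow> real \<Rightarrow> nat \<Rightarrow> real^'d \<Rightarrow> int^'d" where
  "idx a L k x = (\<chi> i. \<lfloor>2^k * (x$i - a$i) / L\<rfloor>)"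

definition anc :: "nat \<Rightarrow> int^'d \<Rightarrow> int^'d" where
  "anc n m = (\<chi> i. m$i div 2^n)"

definition cell :: "real^'d \<Rightarrow> real \<Rightarrow> nat \<Rightarrow> int^'d \<Rightarrow> (real^'d) set" where
  "cell a L k m = {x. idx a L k x = m}"

text \<open>The dilate of a cube consists of the cubes of the same generation at index distance at most \<open>D = 2d + 1\<close>, so it is
  the concentric cube with side multiplied by \<open>2D + 1 = 4d + 3\<close>. The factor is odd, as \<open>dil_is_cell\<close> requires, and
  \<open>D\<close> is large enough for the separation of a cube from the outside of its dilate to exceed twice its diameter, as the
  smoothness condition on the kernel requires.\<close>

definition dil :: "real^'d \<Rightarrow> real \<Rightarrow> nat \<Rightarrow> int^'d \<Rightarrow> (real^'d) set" where
  "dil a L k m = {x. \<forall>i. \<bar>idx a L k x $ i - m $ i\<bar> \<le> 2 * int CARD('d) + 1}"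

text \<open>Families of cubes are sets of pairs of a generation and an index.\<close>

abbreviation pcell :: "real^'d \<Rightarrow> real \<Rightarrow> nat \<times> (int^'d) \<Rightarrow> (real^'d) set" where
  "pcell a L P \<equiv> cell a L (fst P) (snd P)"

abbreviation pdil :: "real^'d \<Rightarrow> real \<Rightarrow> nat \<times> (int^'d) \<Rightarrow> (real^'d) set" where
  "pdil a L P \<equiv> dil a L (fst P) (snd P)"

lemma hcube_between:
  "box c (\<chi> i. c$i + r) \<subseteq> hcube c r" "hcube c r \<subseteq> cbox c (\<chi> i. c$i + r)"
  by (auto simp: hcube_def mem_box_cart less_imp_le)

lemma hcube_sets [measurable]: "hcube c r \<in> sets borel"
proof -
  have "hcube c r = {x \<in> space borel. \<forall>i\<in>UNIV. c$i \<le> x$i \<and> x$i < c$i + r}"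
    by (auto simp: hcube_def)
  also have "\<dots> \<in> sets borel" by measurable
  finally show ?thesis .
qed

lemma emeasure_cubes:
  fixes c :: "real^'d"
  assumes "r > 0"
  shows "emeasure lebesgue (cbox c (\<chi> i. c$i + r)) = ennreal (r ^ CARD('d))"
    and "emeasure lebesgue (hcube c r) = ennreal (r ^ CARD('d))"
proof -
  have ne: "box c (\<chi> i. c$i + r) \<noteq> {}" "cbox c (\<chi> i. c$i + r) \<noteq> {}"
    using assms by (auto simp: interval_ne_empty_cart less_imp_le)
  have 1: "measure lborel (cbox c (\<chi> i. c$i + r)) = r ^ CARD('d)"
    using ne(2) by (simp add: content_cbox_cart)
  have e1: "emeasure lebesgue (cbox c (\<chi> i. c$i + r)) = ennreal (r ^ CARD('d))"
    using 1 by (simp add: emeasure_eq_ennreal_measure emeasure_lborel_cbox_eq)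
  have "emeasure lborel (box c (\<chi> i. c$i + r)) = emeasure lborel (cbox c (\<chi> i. c$i + r))"
    by (simp only: emeasure_lborel_cbox_eq emeasure_lborel_box_eq)
  then have e2: "emeasure lebesgue (box c (\<chi> i. c$i + r)) = ennreal (r ^ CARD('d))"
    using e1 by simp
  show "emeasure lebesgue (cbox c (\<chi> i. c$i + r)) = ennreal (r ^ CARD('d))" by (fact e1)
  have "emeasure lebesgue (box c (\<chi> i. c$i + r)) \<le> emeasure lebesgue (hcube c r)"
    "emeasure lebesgue (hcube c r) \<le> emeasure lebesgue (cbox c (\<chi> i. c$i + r))"
    by (auto intro!: emeasure_mono hcube_between)
  then show "emeasure lebesgue (hcube c r) = ennreal (r ^ CARD('d))"
    using e1 e2 by (metis antisym)
qed

lemma idx_div: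
  assumes "L > 0"
  shows "idx a L k x $ i = idx a L (k+n) x $ i div 2^n"
proof -
  have "\<lfloor>2^k * (x$i - a$i) / L\<rfloor> = \<lfloor>(2^(k+n) * (x$i - a$i) / L) / real_of_int (2^n)\<rfloor>"
    by (rule arg_cong[of _ _ floor]) (simp add: power_add)
  also have "\<dots> = \<lfloor>2^(k+n) * (x$i - a$i) / L\<rfloor> div 2^n"
    by (subst floor_divide_real_eq_div) auto
  finally show ?thesis by (simp add: idx_def)
qed

lemma anc_idx: "L > 0 \<Longrightarrow> anc n (idx a L (k+n) x) = idx a L k x"
  using idx_div[of L a k x _ n] by (simp add: anc_def vec_eq_iff)

lemma anc_0 [simp]: "anc 0 m = m"
  by (simp add: anc_def vec_eq_iff)

lemma anc_anc: "anc j (anc n m) = anc (n + j) m"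
  by (simp add: anc_def vec_eq_iff power_add zdiv_zmult2_eq)

lemma cell_idx [simp]: "x \<in> cell a L k (idx a L k x)"
  by (simp add: cell_def)

lemma cell_disjoint: "x \<in> cell a L k m \<Longrightarrow> x \<in> cell a L k m' \<Longrightarrow> m = m'"
  by (simp add: cell_def)

lemma cell_subset_anc: "L > 0 \<Longrightarrow> cell a L (k+n) m \<subseteq> cell a L k (anc n m)"
  by (auto simp: cell_def anc_idx)

lemma cell_subset_dil: "cell a L k m \<subseteq> dil a L k m"
  by (auto simp: cell_def dil_def)

lemma floor_scaled:
  fixes L :: real assumes "L > 0"
  shows "\<lfloor>2^k * z / L\<rfloor> = n \<longleftrightarrow> L/2^k * n \<le> z \<and> z < L/2^k * n + L/2^k"
  unfolding floor_eq_iff using assms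
  by (auto simp: field_simps)

lemma cell_eq_hcube:
  assumes "L > 0"
  shows "cell a L k m = hcube (\<chi> i. a$i + L/2^k * m$i) (L/2^k)"
proof (intro set_eqI)
  fix x
  have "(\<lfloor>2^k * (x$i - a$i) / L\<rfloor> = m$i) = (a$i + L/2^k * m$i \<le> x$i \<and> x$i < a$i + L/2^k * m$i + L/2^k)" for i
    unfolding floor_scaled[OF assms] by auto
  then show "x \<in> cell a L k m \<longleftrightarrow> x \<in> hcube (\<chi> i. a$i + L/2^k * m$i) (L/2^k)"
    unfolding cell_def hcube_def idx_def vec_eq_iff by simp
qed

lemma floor_within:
  fixes z :: real and p D :: int
  shows "\<bar>\<lfloor>z\<rfloor> - p\<bar> \<le> D \<longleftrightarrow> of_int (p - D) \<le> z \<and> z < of_int (p + D) + 1"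
  unfolding abs_le_iff by linarith

lemma dil_eq_hcube:
  fixes m :: "int^'d"
  assumes "L > 0"
  shows "dil a L k m = hcube (\<chi> i. a$i + L/2^k * (m$i - (2 * int CARD('d) + 1)))
           ((4 * real CARD('d) + 3) * L/2^k)"
proof (intro set_eqI)
  fix x
  have "(\<bar>\<lfloor>2^k * (x$i - a$i) / L\<rfloor> - m$i\<bar> \<le> 2 * int CARD('d) + 1) =
     (a$i + L/2^k * (m$i - (2 * int CARD('d) + 1)) \<le> x$i \<and>
     x$i < a$i + L/2^k * (m$i - (2 * int CARD('d) + 1)) + (4 * real CARD('d) + 3) * L/2^k)" for i
  proof -
    define h where "h = L/2^k"
    have h: "h > 0" "2^k * (x$i - a$i) / L = (x$i - a$i) / h" "(4 * real CARD('d) + 3) * L/2^k = (4 * real CARD('d) + 3) * h"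
      using assms by (auto simp: h_def)
    show ?thesis
      unfolding floor_within h h_def[symmetric] pos_le_divide_eq[OF h(1)] pos_divide_less_eq[OF h(1)]
      by (simp add: algebra_simps)
  qed
  then show "x \<in> dil a L k m \<longleftrightarrow> x \<in> hcube (\<chi> i. a$i + L/2^k * (m$i - (2 * int CARD('d) + 1)))
           ((4 * real CARD('d) + 3) * L/2^k)"
    unfolding dil_def hcube_def idx_def by simp
qed

lemma cell_sets: "L > 0 \<Longrightarrow> cell a L k m \<in> sets borel"
  and dil_sets: "L > 0 \<Longrightarrow> dil a L k m \<in> sets borel"
  by (simp_all add: cell_eq_hcube dil_eq_hcube)

lemma cell_sets_lebesgue [simp]: "L > 0 \<Longrightarrow> cell a L k m \<in> sets lebesgue"
  and dil_sets_lebesgue [simp]: "L > 0 \<Longrightarrow> dil a L k m \<in> sets lebesgue"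
  by (simp_all add: cell_sets dil_sets)

lemma emeasure_cell:
  fixes m :: "int^'d"
  assumes "L > 0"
  shows "emeasure lebesgue (cell a L k m) = ennreal ((L/2^k)^CARD('d))"
  unfolding cell_eq_hcube[OF assms] by (rule emeasure_cubes) (use assms in simp)

lemma emeasure_dil:
  fixes m :: "int^'d"
  assumes "L > 0"
  shows "emeasure lebesgue (dil a L k m) = ennreal (((4 * real CARD('d) + 3) * L/2^k)^CARD('d))"
proof -
  have "(4 * real CARD('d) + 3) * L/2^k > 0" using assms by (simp add: add_nonneg_pos)
  then show ?thesis using assms by (simp only: dil_eq_hcube emeasure_cubes)
qed

lemma measure_cell:
  fixes m :: "int^'d"
  assumes "L > 0"
  shows "vol (cell a L k m) = (L/2^k)^CARD('d)"
  using assms by (simp only: measure_def emeasure_cell) simp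

lemma measure_dil:
  fixes m :: "int^'d"
  assumes "L > 0"
  shows "vol (dil a L k m) = (4 * real CARD('d) + 3)^CARD('d) * (L/2^k)^CARD('d)"
proof -
  have "vol (dil a L k m) = ((4 * real CARD('d) + 3) * L/2^k)^CARD('d)"
    using assms by (simp only: measure_def emeasure_dil) simp
  also have "\<dots> = (4 * real CARD('d) + 3)^CARD('d) * (L/2^k)^CARD('d)"
    by (simp add: power_mult_distrib[symmetric])
  finally show ?thesis .
qed

lemma cell_lmeasurable [simp]: "L > 0 \<Longrightarrow> cell a L k m \<in> lmeasurable"
  and dil_lmeasurable [simp]: "L > 0 \<Longrightarrow> dil a L k m \<in> lmeasurable"
  by (intro fmeasurableI; simp only: emeasure_cell emeasure_dil cell_sets_lebesgue dil_sets_lebesgue; simp)+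

lemma measure_cell_pos: "L > 0 \<Longrightarrow> 0 < vol (cell a L k m)"
  and measure_dil_pos: "L > 0 \<Longrightarrow> 0 < vol (dil a L k m)"
  by (auto simp: measure_cell measure_dil intro!: mult_pos_pos zero_less_power add_nonneg_pos)

lemma measure_dil_cell:
  fixes m :: "int^'d"
  shows "L > 0 \<Longrightarrow> vol (dil a L k m) = (4 * real CARD('d) + 3)^CARD('d) * vol (cell a L k m)"
  by (simp add: measure_cell measure_dil)

lemma measure_cell_anc:
  fixes m :: "int^'d"
  shows "L > 0 \<Longrightarrow> vol (cell a L k m') = (2^CARD('d))^n * vol (cell a L (k+n) m)"
  by (simp add: measure_cell power_add power_divide power_mult power_mult_distrib field_simps power_commutes
      flip: power_mult)

text \<open>Index distances shrink when passing to ancestors, so dilates of nested cubes are nested.\<close>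

lemma dil_subset_anc:
  fixes m :: "int^'d"
  assumes "L > 0"
  shows "dil a L (k+n) m \<subseteq> dil a L k (anc n m)"
proof
  fix x assume x: "x \<in> dil a L (k+n) m"
  let ?D = "2 * int CARD('d) + 1"
  have "\<bar>idx a L k x $ i - anc n m $ i\<bar> \<le> ?D" for i
  proof -
    define p q where "p = idx a L (k+n) x $ i" and "q = m $ i"
    have 1: "\<bar>p - q\<bar> \<le> ?D" using x by (simp add: dil_def p_def q_def)
    define D where "D = ?D"
    have D: "D \<le> D * 2^n" by (simp add: D_def)
    have "p \<le> q + D * 2^n" "q \<le> p + D * 2^n" using 1 D unfolding D_def by linarith+
    from this[THEN zdiv_mono1, of "2^n"]
    have "p div 2^n \<le> (q + D * 2^n) div 2^n" "q div 2^n \<le> (p + D * 2^n) div 2^n"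
      by simp_all
    then have "\<bar>p div 2^n - q div 2^n\<bar> \<le> ?D" by (simp add: D_def[symmetric])
    then show ?thesis using idx_div[OF assms, of a k x i n] by (simp add: anc_def p_def q_def)
  qed
  then show "x \<in> dil a L k (anc n m)" by (simp add: dil_def)
qed

lemma cell_diam:
  fixes m :: "int^'d"
  assumes "L > 0" "x \<in> cell a L k m" "x' \<in> cell a L k m"
  shows "norm (x - x') \<le> CARD('d) * (L/2^k)"
proof -
  have "norm (x - x') \<le> (\<Sum>i\<in>UNIV. \<bar>(x - x') $ i\<bar>)" by (rule norm_le_l1_cart)
  also have "\<dots> \<le> (\<Sum>i\<in>(UNIV::'d set). L/2^k)"
  proof (rule sum_mono)
    fix i :: 'd
    have "a$i + L/2^k * m$i \<le> y$i \<and> y$i < a$i + L/2^k * m$i + L/2^k" if "y \<in> cell a L k m" for y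
      using that assms(1) by (simp add: cell_eq_hcube hcube_def)
    from this[OF assms(2)] this[OF assms(3)] show "\<bar>(x - x') $ i\<bar> \<le> L/2^k"
      unfolding vector_minus_component by linarith
  qed
  finally show ?thesis by simp
qed

lemma dil_separation:
  fixes m :: "int^'d"
  assumes "L > 0" "x \<in> cell a L k m" "y \<notin> dil a L k m"
  shows "(2 * real CARD('d) + 1) * (L/2^k) \<le> norm (x - y)"
proof -
  obtain i where "\<bar>idx a L k y $ i - m $ i\<bar> > 2 * int CARD('d) + 1"
    using assms(3) by (auto simp: dil_def not_le)
  moreover have "m $ i = idx a L k x $ i" using assms(2) by (simp add: cell_def)
  ultimately have "\<bar>\<lfloor>2^k * (y$i - a$i) / L\<rfloor> - \<lfloor>2^k * (x$i - a$i) / L\<rfloor>\<bar> \<ge> 2 * int CARD('d) + 2"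
    by (simp add: idx_def)
  then have "\<bar>2^k * (y$i - a$i) / L - 2^k * (x$i - a$i) / L\<bar> \<ge> 2 * real CARD('d) + 1"
    by linarith
  moreover have "2^k * (y$i - a$i) / L - 2^k * (x$i - a$i) / L = - (2^k/L * (x$i - y$i))"
    by (simp add: algebra_simps diff_divide_distrib)
  ultimately have "\<bar>2^k/L * (x$i - y$i)\<bar> \<ge> 2 * real CARD('d) + 1"
    by (simp only: abs_minus_cancel)
  then have "2^k/L * \<bar>x$i - y$i\<bar> \<ge> 2 * real CARD('d) + 1"
    using assms(1) by (simp add: abs_mult)
  then have "(2 * real CARD('d) + 1) * (L/2^k) \<le> \<bar>(x - y)$i\<bar>"
    using assms(1) by (simp add: field_simps)
  also have "\<dots> \<le> norm (x - y)" by (rule component_le_norm_cart)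
  finally show ?thesis .
qed

text \<open>The annulus between two nested dilates splits into the layers between consecutive ancestors.\<close>

lemma dil_level:
  assumes "L > 0" "y \<in> dil a L k (anc n m)" "y \<notin> dil a L (k+n) m"
  obtains j where "j < n" "y \<in> dil a L (k+j) (anc (n-j) m)" "y \<notin> dil a L (k+Suc j) (anc (n-Suc j) m)"
proof -
  let ?P = "\<lambda>j. y \<notin> dil a L (k+j) (anc (n-j) m)"
  have "?P n" using assms(3) by simp
  define j0 where "j0 = (LEAST j. ?P j)"
  have j0: "?P j0" "j0 \<le> n" unfolding j0_def using \<open>?P n\<close> by (metis (mono_tags, lifting) LeastI) (meson Least_le \<open>?P n\<close>)
  have "j0 \<noteq> 0" using j0 assms(2) by (metis add.right_neutral diff_zero)
  then obtain j where j: "j0 = Suc j" using not0_implies_Suc by blast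
  have "\<not> ?P j" using not_less_Least[of j ?P] j j0_def by auto
  with j0 j show ?thesis by (intro that[of j]) auto
qed

text \<open>The dilates of all cubes of a grid are cubes of finitely many other grids, with mesh \<open>\<alpha>L\<close> for \<open>\<alpha> = 4d + 3\<close> and corner
  shifted by \<open>L t\<close>. A dilate starts at index \<open>m - D\<close>, and it is a cube of the shifted grid as soon as
  \<open>m - D = 2^k t\<close> modulo \<open>\<alpha>\<close> in each coordinate. Such a \<open>t\<close> exists because \<open>\<alpha>\<close> is odd.\<close>

lemma dil_is_cell:
  fixes m :: "int^'d"
  assumes "L > 0"
  obtains t s :: "int^'d" where "\<forall>i. 0 \<le> t$i \<and> t$i < 4 * int CARD('d) + 3"
    "dil a L k m = cell (\<chi> i. a$i + L * t$i) ((4 * real CARD('d) + 3) * L) k s"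
proof -
  let ?D = "2 * int CARD('d) + 1" and ?al = "4 * int CARD('d) + 3"
  \<comment> \<open>Modulo \<open>\<alpha> = 2D + 1\<close> the inverse of 2 is \<open>D + 1\<close>.\<close>
  define t where "t = (\<chi> i. ((m$i - ?D) * (?D + 1)^k) mod ?al)"
  have D: "2 * (?D + 1) = 1 + ?al" by simp
  have "?al dvd (m$i - ?D) - 2^k * t$i" for i
  proof -
    have "(2^k * t$i) mod ?al = (2^k * ((m$i - ?D) * (?D + 1)^k)) mod ?al"
      unfolding t_def by (simp only: vec_lambda_beta mod_mult_right_eq)
    also have "2^k * ((m$i - ?D) * (?D + 1)^k) = (m$i - ?D) * (2 * (?D + 1))^k"
      by (simp only: power_mult_distrib mult_ac)
    also have "\<dots> mod ?al = ((m$i - ?D) * ((1 + ?al)^k mod ?al)) mod ?al"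
      unfolding D by (simp only: mod_mult_right_eq)
    also have "(1 + ?al)^k mod ?al = ((1 + ?al) mod ?al)^k mod ?al" by (simp only: power_mod)
    also have "(1 + ?al) mod ?al = 1" by (subst mod_add_self2) simp
    finally have "(2^k * t$i) mod ?al = (m$i - ?D) mod ?al" by simp
    then show ?thesis by (metis mod_eq_dvd_iff)
  qed
  then have "\<forall>i. \<exists>s. m$i - ?D = 2^k * t$i + ?al * s" by (metis add.commute diff_eq_eq dvdE)
  then obtain s' where s': "\<And>i. m$i - ?D = 2^k * t$i + ?al * s' i" by metis
  define s where "s = (\<chi> i. s' i)"
  have ms: "m$i - ?D = 2^k * t$i + ?al * s$i" for i using s' by (simp add: s_def)
  have pos: "(4 * real CARD('d) + 3) * L > 0" using assms by (simp add: add_nonneg_pos)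
  show ?thesis
  proof (rule that[of t s])
    show "\<forall>i. 0 \<le> t $ i \<and> t $ i < ?al" by (simp add: t_def)
    have "L/2^k * real_of_int (m$i - ?D) = L * t$i + (4 * real CARD('d) + 3) * L/2^k * s$i" for i
      unfolding ms by (simp add: field_simps)
    then have c: "(\<chi> i. a$i + L/2^k * real_of_int (m$i - ?D)) =
      (\<chi> i. (\<chi> i. a$i + L * t$i) $ i + (4 * real CARD('d) + 3) * L/2^k * s$i)"
      by (simp add: vec_eq_iff)
    show "dil a L k m = cell (\<chi> i. a$i + L * t$i) ((4 * real CARD('d) + 3) * L) k s"
      unfolding dil_eq_hcube[OF assms] cell_eq_hcube[OF pos] c[symmetric] by simp
  qed
qed

section \<open>Stopping cubes and maximal functions\<close>

text \<open>The maximal cubes, among those of generation at least \<open>k\<close>, that satisfy the predicate.\<close>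

definition stopping_cubes :: "nat \<Rightarrow> (nat \<Rightarrow> int^'d \<Rightarrow> bool) \<Rightarrow> (nat \<times> (int^'d)) set" where
  "stopping_cubes k bad = {(k + n, m) | n m. bad (k + n) m \<and> (\<forall>j<n. \<not> bad (k + j) (anc (n - j) m))}"

lemma stopping_cubesE:
  assumes "P \<in> stopping_cubes k bad"
  obtains n m where "P = (k + n, m)" "bad (k + n) m" "\<And>j. j < n \<Longrightarrow> \<not> bad (k + j) (anc (n - j) m)"
  using assms by (auto simp: stopping_cubes_def)

lemma stopping_cubes_disjoint:
  assumes "L > 0" "P \<in> stopping_cubes k bad" "P' \<in> stopping_cubes k bad"
    and "x \<in> pcell a L P" "x \<in> cell a L (fst P') (snd P')"
  shows "P = P'"
proof -
  obtain n m where P: "P = (k + n, m)" "bad (k + n) m" "\<And>j. j < n \<Longrightarrow> \<not> bad (k + j) (anc (n - j) m)"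
    using assms(2) by (rule stopping_cubesE) blast
  obtain n' m' where P': "P' = (k + n', m')" "bad (k + n') m'" "\<And>j. j < n' \<Longrightarrow> \<not> bad (k + j) (anc (n' - j) m')"
    using assms(3) by (rule stopping_cubesE) blast
  have m: "m = idx a L (k+n) x" "m' = idx a L (k+n') x"
    using assms(4,5) P(1) P'(1) by (auto simp: cell_def)
  have "\<not> n < n'"
  proof
    assume *: "n < n'"
    then have "anc (n' - n) m' = m"
      using anc_idx[OF assms(1), of "n' - n" a "k + n" x] m by simp
    then show False using P(2) P'(3)[OF *] by simp
  qed
  moreover have "\<not> n' < n"
  proof
    assume *: "n' < n"
    then have "anc (n - n') m = m'"
      using anc_idx[OF assms(1), of "n - n'" a "k + n'" x] m by simp
    then show False using P'(2) P(3)[OF *] by simp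
  qed
  ultimately show ?thesis using P P' m by simp
qed

lemma stopping_cubes_covers:
  assumes "L > 0" "bad k' m" "k \<le> k'" "x \<in> cell a L k' m"
  obtains P where "P \<in> stopping_cubes k bad" "x \<in> pcell a L P"
proof -
  let ?Q = "\<lambda>n. bad (k + n) (idx a L (k + n) x)"
  have "?Q (k' - k)" using assms by (simp add: cell_def)
  then have *: "?Q (LEAST n. ?Q n)" by (rule LeastI)
  define n where "n = (LEAST n. ?Q n)"
  have n: "?Q n" using * by (simp add: n_def)
  have "\<not> bad (k + j) (anc (n - j) (idx a L (k + n) x))" if "j < n" for j
    using not_less_Least[of j ?Q] that anc_idx[OF assms(1), of "n - j" a "k + j" x]
    by (simp add: n_def[symmetric])
  then have "(k + n, idx a L (k + n) x) \<in> stopping_cubes k bad" using n by (auto simp: stopping_cubes_def)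
  then show ?thesis using that by fastforce
qed

lemma emeasure_UN_le:
  fixes X :: "'i \<Rightarrow> 'a set"
  assumes "countable I" "\<And>i. i \<in> I \<Longrightarrow> X i \<in> sets M" "sets N = sets M" "disjoint_family_on X I"
    and le: "\<And>i. i \<in> I \<Longrightarrow> c * emeasure M (X i) \<le> emeasure N (X i)"
  shows "c * emeasure M (\<Union>i\<in>I. X i) \<le> emeasure N (\<Union>i\<in>I. X i)"
proof -
  have "c * emeasure M (\<Union>i\<in>I. X i) = (\<integral>\<^sup>+i. c * emeasure M (X i) \<partial>count_space I)"
    using assms by (simp add: emeasure_UN_countable nn_integral_cmult)
  also have "\<dots> \<le> (\<integral>\<^sup>+i. emeasure N (X i) \<partial>count_space I)"
    using le by (intro nn_integral_mono) auto
  also have "\<dots> = emeasure N (\<Union>i\<in>I. X i)"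
    using assms by (simp add: emeasure_UN_countable)
  finally show ?thesis .
qed

lemma stopping_cubes_disjoint_family:
  "L > 0 \<Longrightarrow> disjoint_family_on (\<lambda>P. pcell a L P) (stopping_cubes k bad)"
  using stopping_cubes_disjoint by (fastforce simp: disjoint_family_on_def)

text \<open>The weak-type inequality for the dyadic maximal function of a finite measure: the union of the cubes on which the
  density exceeds \<open>c\<close> is the disjoint union of the maximal ones, where the inequality can be summed.\<close>

lemma weak_type_cells:
  fixes \<nu> :: "(real^'d) measure" and a :: "real^'d" and k :: nat
  assumes "L > 0" "finite_measure \<nu>" "sets \<nu> = sets lebesgue" "c > 0"
  defines "V \<equiv> \<Union>{cell a L k' m | k' m. k \<le> k' \<and> c * vol (cell a L k' m) < measure \<nu> (cell a L k' m)}"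
  shows "V \<in> sets lebesgue" "emeasure lebesgue V \<le> ennreal (measure \<nu> UNIV / c)"
proof -
  interpret finite_measure \<nu> by fact
  define bad where "bad k' m = (c * vol (cell a L k' m) < measure \<nu> (cell a L k' m))" for k' m
  let ?X = "\<lambda>P. pcell a L P"
  have V: "V = (\<Union>P\<in>stopping_cubes k bad. ?X P)"
  proof (intro equalityI subsetI)
    fix x assume "x \<in> V"
    then obtain k' m where "bad k' m" "k \<le> k'" "x \<in> cell a L k' m" by (auto simp: V_def bad_def)
    then obtain P where "P \<in> stopping_cubes k bad" "x \<in> ?X P" using stopping_cubes_covers[OF assms(1)] by blast
    then show "x \<in> (\<Union>P\<in>stopping_cubes k bad. ?X P)" by blast
  next
    fix x assume "x \<in> (\<Union>P\<in>stopping_cubes k bad. ?X P)"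
    then obtain P where P: "P \<in> stopping_cubes k bad" "x \<in> ?X P" by blast
    from P(1) obtain n m where Pn: "P = (k + n, m)" and "bad (k + n) m" by (rule stopping_cubesE) blast
    then have "cell a L (k + n) m \<in> {cell a L k' m | k' m. k \<le> k' \<and>
        c * vol (cell a L k' m) < measure \<nu> (cell a L k' m)}"
      unfolding bad_def by (intro CollectI exI[of _ "k + n"] exI[of _ m]) auto
    moreover have "x \<in> cell a L (k + n) m" using P(2) Pn by simp
    ultimately show "x \<in> V" unfolding V_def by (rule UnionI)
  qed
  show Vs: "V \<in> sets lebesgue" unfolding V using assms(1)
    by (intro sets.countable_UN') auto
  have "ennreal c * emeasure lebesgue V \<le> emeasure \<nu> V"
    unfolding V
  proof (rule emeasure_UN_le)
    show "disjoint_family_on ?X (stopping_cubes k bad)" by (rule stopping_cubes_disjoint_family) fact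
    fix P assume "P \<in> stopping_cubes k bad"
    then obtain n m where P: "P = (k + n, m)" "bad (k + n) m" by (rule stopping_cubesE) blast
    have "ennreal c * emeasure lebesgue (?X P) = ennreal (c * vol (?X P))"
      using assms by (subst emeasure_eq_measure2) (auto simp: ennreal_mult intro: fmeasurableD2)
    also have "\<dots> \<le> ennreal (measure \<nu> (?X P))"
      using P by (intro ennreal_leI) (auto simp: bad_def)
    finally show "ennreal c * emeasure lebesgue (?X P) \<le> emeasure \<nu> (?X P)"
      by (simp add: emeasure_eq_measure)
  qed (use assms in auto)
  also have "\<dots> \<le> emeasure \<nu> UNIV" using assms(3) by (intro emeasure_mono) auto
  finally have "ennreal c * emeasure lebesgue V \<le> ennreal (measure \<nu> UNIV)"
    by (simp add: emeasure_eq_measure)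
  then have "ennreal (1/c) * (ennreal c * emeasure lebesgue V) \<le> ennreal (1/c) * ennreal (measure \<nu> UNIV)"
    by (rule mult_left_mono) simp
  moreover have "ennreal (1/c) * (ennreal c * emeasure lebesgue V) = emeasure lebesgue V"
    using assms(4) by (simp add: mult.assoc[symmetric] ennreal_mult[symmetric] del: emeasure_completion)
  ultimately show "emeasure lebesgue V \<le> ennreal (measure \<nu> UNIV / c)"
    using assms(4) by (simp add: ennreal_mult[symmetric])
qed

text \<open>The shifts occurring in \<open>dil_is_cell\<close>.\<close>

definition classes :: "(int^'d) set" where
  "classes = {t. \<forall>i. 0 \<le> t$i \<and> t$i < 4 * int CARD('d) + 3}"

lemma finite_classes: "finite (classes :: (int^'d) set)"
proof -
  let ?S = "UNIV \<rightarrow>\<^sub>E {0..<4 * int CARD('d) + 3} :: ('d \<Rightarrow> int) set"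
  have "(classes :: (int^'d) set) \<subseteq> vec_lambda ` ?S"
  proof
    fix t :: "int^'d" assume "t \<in> classes"
    then have "vec_nth t \<in> ?S" by (auto simp: classes_def)
    then show "t \<in> vec_lambda ` ?S" by (metis imageI vec_nth_inverse)
  qed
  moreover have "finite ?S" by (intro finite_PiE) auto
  ultimately show ?thesis by (meson finite_surj)
qed

text \<open>The same for averages over dilated cubes: apply \<open>weak_type_cells\<close> in each of the shifted grids.\<close>

lemma weak_type_dils:
  fixes \<nu> :: "(real^'d) measure" and a :: "real^'d"
  assumes "L > 0" "finite_measure \<nu>" "sets \<nu> = sets lebesgue" "c > 0"
  obtains V where "V \<in> lmeasurable"
    "vol V \<le> card (classes :: (int^'d) set) * (measure \<nu> UNIV / c)"
    "\<And>k' m. k \<le> k' \<Longrightarrow> c * vol (dil a L k' m) < measure \<nu> (dil a L k' m) \<Longrightarrow> dil a L k' m \<subseteq> V"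
proof -
  let ?al = "4 * real CARD('d) + 3"
  let ?a = "\<lambda>t::int^'d. (\<chi> i. a$i + L * t$i)"
  define W where "W t = \<Union>{cell (?a t) (?al * L) k' m | k' m. k \<le> k' \<and>
    c * vol (cell (?a t) (?al * L) k' m) < measure \<nu> (cell (?a t) (?al * L) k' m)}" for t
  have pos: "?al * L > 0" using assms by (simp add: add_nonneg_pos)
  have W: "W t \<in> sets lebesgue" "emeasure lebesgue (W t) \<le> ennreal (measure \<nu> UNIV / c)" for t
    unfolding W_def by (rule weak_type_cells[OF pos assms(2-4)])+
  define V where "V = (\<Union>t\<in>classes. W t)"
  have "emeasure lebesgue V \<le> (\<Sum>t\<in>(classes :: (int^'d) set). emeasure lebesgue (W t))"
    unfolding V_def using W finite_classes by (intro emeasure_subadditive_finite) auto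
  also have "\<dots> \<le> (\<Sum>t\<in>(classes :: (int^'d) set). ennreal (measure \<nu> UNIV / c))"
    using W by (intro sum_mono) auto
  also have "\<dots> = ennreal (card (classes :: (int^'d) set) * (measure \<nu> UNIV / c))"
    using assms(4) by (subst sum_ennreal) auto
  finally have em: "emeasure lebesgue V \<le> ennreal (card (classes :: (int^'d) set) * (measure \<nu> UNIV / c))" .
  show ?thesis
  proof (rule that[of V])
    have "V \<in> sets lebesgue" unfolding V_def using W finite_classes by (intro sets.finite_UN) auto
    then show "V \<in> lmeasurable" using em by (intro fmeasurableI) (auto intro: le_less_trans simp del: emeasure_completion)
    show "vol V \<le> card (classes :: (int^'d) set) * (measure \<nu> UNIV / c)"
      unfolding measure_def[of lebesgue] using em assms(4) by (intro enn2real_leI) auto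
    fix k' m assume k: "k \<le> k'" and lt: "c * vol (dil a L k' m) < measure \<nu> (dil a L k' m)"
    obtain t s :: "int^'d" where ts: "\<forall>i. 0 \<le> t$i \<and> t$i < 4 * int CARD('d) + 3"
      "dil a L k' m = cell (?a t) (?al * L) k' s" using dil_is_cell[OF assms(1)] by blast
    have "dil a L k' m \<subseteq> W t" using lt k unfolding W_def ts(2) by blast
    moreover have "t \<in> classes" using ts by (simp add: classes_def)
    ultimately show "dil a L k' m \<subseteq> V" unfolding V_def by blast
  qed
qed

text \<open>Doob's \<open>L\<^sup>2\<close> argument for a finite nested family, by induction on the family. Removing an inclusion-minimal set \<open>Q\<close>,
  the majorant \<open>g\<close> for the remaining sets is constant on \<open>Q\<close>; raising that value from \<open>m\<close> to \<open>max m (A Q)\<close> changes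
  \<open>\<integral>g\<^sup>2\<close> by at most \<open>2 (A Q)(A Q - m)\<mu>(Q)\<close>, which is exactly the change of \<open>2\<integral>hg\<close>. The claim that \<open>g\<close> takes equal
  values at points not separated by the family is what keeps \<open>g\<close> constant on the next minimal set.\<close>

lemma laminar_majorant:
  fixes h :: "'a \<Rightarrow> real" and F :: "'a set set" and M :: "'a measure"
  defines "A \<equiv> \<lambda>P. (LINT x|M. indicator P x * h x) / measure M P"
  assumes "finite F"
    and F: "\<And>P. P \<in> F \<Longrightarrow> P \<in> fmeasurable M" "\<And>P. P \<in> F \<Longrightarrow> 0 < measure M P"
    and lam: "\<And>P Q. P \<in> F \<Longrightarrow> Q \<in> F \<Longrightarrow> P \<inter> Q = {} \<or> P \<subseteq> Q \<or> Q \<subseteq> P"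
    and hP: "\<And>P. P \<in> F \<Longrightarrow> integrable M (\<lambda>x. indicator P x * h x)"
  shows "\<exists>g. (\<forall>x. 0 \<le> g x) \<and> (\<forall>P\<in>F. \<forall>x\<in>P. A P \<le> g x) \<and>
     (\<forall>x y. (\<forall>P\<in>F. x \<in> P \<longleftrightarrow> y \<in> P) \<longrightarrow> g x = g y) \<and>
     integrable M (\<lambda>x. (g x)\<^sup>2) \<and> integrable M (\<lambda>x. h x * g x) \<and> g \<in> borel_measurable M \<and>
     (LINT x|M. (g x)\<^sup>2) \<le> 2 * (LINT x|M. h x * g x)"
  using \<open>finite F\<close> F lam hP
proof (induction "card F" arbitrary: F)
  case 0
  then show ?case by (intro exI[of _ "\<lambda>_. 0"]) auto
next
  case (Suc n)
  then have "F \<noteq> {}" by auto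
  then obtain Q where Q: "Q \<in> F" "\<And>P. P \<in> F \<Longrightarrow> P \<subseteq> Q \<Longrightarrow> P = Q"
    using finite_has_minimal[OF Suc.prems(1)] by metis
  define F' where "F' = F - {Q}"
  have FF: "F = insert Q F'" "Q \<notin> F'" using Q by (auto simp: F'_def)
  have "\<exists>g. (\<forall>x. 0 \<le> g x) \<and> (\<forall>P\<in>F'. \<forall>x\<in>P. A P \<le> g x) \<and>
     (\<forall>x y. (\<forall>P\<in>F'. x \<in> P \<longleftrightarrow> y \<in> P) \<longrightarrow> g x = g y) \<and>
     integrable M (\<lambda>x. (g x)\<^sup>2) \<and> integrable M (\<lambda>x. h x * g x) \<and> g \<in> borel_measurable M \<and>
     (LINT x|M. (g x)\<^sup>2) \<le> 2 * (LINT x|M. h x * g x)"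
    by (rule Suc.hyps(1)) (use Suc.hyps(2) Suc.prems Q in \<open>auto simp: F'_def\<close>)
  then obtain g where g0: "\<And>x. 0 \<le> g x" and gA: "\<And>P x. P \<in> F' \<Longrightarrow> x \<in> P \<Longrightarrow> A P \<le> g x"
    and gc: "\<And>x y. (\<forall>P\<in>F'. x \<in> P \<longleftrightarrow> y \<in> P) \<Longrightarrow> g x = g y"
    and g2: "integrable M (\<lambda>x. (g x)\<^sup>2)" and gh: "integrable M (\<lambda>x. h x * g x)"
    and gm [measurable]: "g \<in> borel_measurable M"
    and gle: "(LINT x|M. (g x)\<^sup>2) \<le> 2 * (LINT x|M. h x * g x)" by blast
  have Qm: "Q \<in> sets M" "emeasure M Q < \<infinity>" "0 < measure M Q" "Q \<in> fmeasurable M"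
    using Suc.prems(2,3)[OF Q(1)] by (auto simp: fmeasurable_def)
  then have "Q \<noteq> {}" by auto
  then obtain x0 where x0: "x0 \<in> Q" by blast
  have const: "g x = g x0" if "x \<in> Q" for x
  proof (rule gc)
    show "\<forall>P\<in>F'. x \<in> P \<longleftrightarrow> x0 \<in> P"
    proof
      fix P assume "P \<in> F'"
      then have "P \<in> F" "P \<noteq> Q" using FF by auto
      then have "P \<inter> Q = {} \<or> Q \<subseteq> P" using Suc.prems(4)[of P Q] Q by blast
      then show "x \<in> P \<longleftrightarrow> x0 \<in> P" using that x0 by blast
    qed
  qed
  define m where "m = g x0"
  \<comment> \<open>The increment of the majorant on \<open>Q\<close>; it vanishes if \<open>A Q \<le> m\<close>.\<close>
  define c where "c = max 0 (A Q - m)"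
  define g' where "g' x = g x + c * indicator Q x" for x
  have iQ: "integrable M (indicator Q :: 'a \<Rightarrow> real)" using Qm by (simp add: integrable_indicator_iff)
  have hQ: "integrable M (\<lambda>x. indicator Q x * h x)" using Suc.prems(5) Q by simp
  have e2: "(g' x)\<^sup>2 = (g x)\<^sup>2 + (2 * m * c + c\<^sup>2) * indicator Q x" for x
    using const[of x] by (auto simp: g'_def m_def indicator_def power2_eq_square algebra_simps)
  have eh: "h x * g' x = h x * g x + c * (indicator Q x * h x)" for x
    by (auto simp: g'_def indicator_def algebra_simps)
  have I2: "integrable M (\<lambda>x. (g' x)\<^sup>2)" unfolding e2 using g2 iQ by auto
  have Ih: "integrable M (\<lambda>x. h x * g' x)" unfolding eh using gh hQ by auto
  have "(LINT x|M. (g' x)\<^sup>2) = (LINT x|M. (g x)\<^sup>2) + (2 * m * c + c\<^sup>2) * measure M Q"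
    unfolding e2 using g2 iQ Qm by (subst Bochner_Integration.integral_add) auto
  moreover have "(LINT x|M. h x * g' x) = (LINT x|M. h x * g x) + c * (A Q * measure M Q)"
    unfolding eh using gh hQ Qm by (subst Bochner_Integration.integral_add) (auto simp: A_def)
  moreover have "(2 * m * c + c\<^sup>2) * measure M Q \<le> 2 * (c * (A Q * measure M Q))"
  proof -
    have "2 * m * c + c\<^sup>2 \<le> 2 * c * A Q"
    proof (cases "A Q \<le> m")
      case False
      then have "c = A Q - m" "0 \<le> c" by (auto simp: c_def)
      then have AQ: "A Q = c + m" by simp
      have "2 * c * A Q - (2 * m * c + c\<^sup>2) = c * c" unfolding AQ by (simp add: power2_eq_square algebra_simps)
      then show ?thesis using zero_le_square[of c] by linarith
    qed (auto simp: c_def)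
    then have "(2 * m * c + c\<^sup>2) * measure M Q \<le> (2 * c * A Q) * measure M Q"
      using Qm by (intro mult_right_mono) auto
    then show ?thesis by simp
  qed
  ultimately have le: "(LINT x|M. (g' x)\<^sup>2) \<le> 2 * (LINT x|M. h x * g' x)" using gle by simp
  have gg': "g x \<le> g' x" for x by (auto simp: g'_def c_def indicator_def)
  have "A P \<le> g' x" if "P \<in> F" "x \<in> P" for P x
  proof (cases "P = Q")
    case True
    then show ?thesis using const[of x] that by (auto simp: g'_def c_def m_def)
  next
    case False
    then have "P \<in> F'" using that FF by blast
    then show ?thesis using gA[of P x] gg'[of x] that by linarith
  qed
  moreover have "g' x = g' y" if "\<forall>P\<in>F. x \<in> P \<longleftrightarrow> y \<in> P" for x y
    using that gc[of x y] FF by (auto simp: g'_def indicator_def)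
  moreover have "0 \<le> g' x" for x using g0[of x] gg'[of x] by linarith
  moreover have "g' \<in> borel_measurable M" unfolding g'_def using Qm by measurable
  ultimately show ?case using I2 Ih le by (intro exI[of _ g']) blast
qed

text \<open>The Carleson embedding that follows: the majorant \<open>g\<close> satisfies \<open>\<integral>g\<^sup>2 \<le> 2\<integral>hg \<le> 2\<integral>h\<^sup>2 + \<integral>g\<^sup>2/2\<close>, and it dominates
  each average on the corresponding \<open>E i\<close>. The constant is the same for all measures.\<close>

lemma laminar_maximal:
  fixes h :: "'a \<Rightarrow> real" and X E :: "'i \<Rightarrow> 'a set"
  assumes "finite I"
    and X: "\<And>i. i \<in> I \<Longrightarrow> X i \<in> fmeasurable M" "\<And>i. i \<in> I \<Longrightarrow> 0 < measure M (X i)"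
    and lam: "\<And>i j. i \<in> I \<Longrightarrow> j \<in> I \<Longrightarrow> X i \<inter> X j = {} \<or> X i \<subseteq> X j \<or> X j \<subseteq> X i"
    and hX: "\<And>i. i \<in> I \<Longrightarrow> integrable M (\<lambda>x. indicator (X i) x * h x)"
    and h: "integrable M (\<lambda>x. (h x)\<^sup>2)" "\<And>x. 0 \<le> h x" 
    and E: "\<And>i. i \<in> I \<Longrightarrow> E i \<in> sets M" "\<And>i. i \<in> I \<Longrightarrow> E i \<subseteq> X i" "disjoint_family_on E I"
  shows "(\<Sum>i\<in>I. ((LINT x|M. indicator (X i) x * h x) / measure M (X i))\<^sup>2 * measure M (E i))
    \<le> 4 * (LINT x|M. (h x)\<^sup>2)"
proof -
  let ?A = "\<lambda>P. (LINT x|M. indicator P x * h x) / measure M P"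
  have "\<exists>g. (\<forall>x. 0 \<le> g x) \<and> (\<forall>P\<in>X`I. \<forall>x\<in>P. ?A P \<le> g x) \<and>
     (\<forall>x y. (\<forall>P\<in>X`I. x \<in> P \<longleftrightarrow> y \<in> P) \<longrightarrow> g x = g y) \<and>
     integrable M (\<lambda>x. (g x)\<^sup>2) \<and> integrable M (\<lambda>x. h x * g x) \<and> g \<in> borel_measurable M \<and>
     (LINT x|M. (g x)\<^sup>2) \<le> 2 * (LINT x|M. h x * g x)"
  proof (rule laminar_majorant)
    fix P Q assume "P \<in> X`I" "Q \<in> X`I"
    then show "P \<inter> Q = {} \<or> P \<subseteq> Q \<or> Q \<subseteq> P" using lam by (metis imageE)
  qed (use assms(1) X hX in auto)
  then obtain g where g: "\<And>x. 0 \<le> g x" "\<And>i x. i \<in> I \<Longrightarrow> x \<in> X i \<Longrightarrow> ?A (X i) \<le> g x"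
     "integrable M (\<lambda>x. (g x)\<^sup>2)" "integrable M (\<lambda>x. h x * g x)"
     "(LINT x|M. (g x)\<^sup>2) \<le> 2 * (LINT x|M. h x * g x)" by blast
  have "2 * (h x * g x) \<le> 2 * (h x)\<^sup>2 + (g x)\<^sup>2 / 2" for x
  proof -
    have "2 * (h x)\<^sup>2 + (g x)\<^sup>2 / 2 - 2 * (h x * g x) = 2 * (h x - g x / 2)\<^sup>2"
      by (simp add: power2_eq_square algebra_simps)
    then show ?thesis by (smt (verit) zero_le_power2)
  qed
  then have "(LINT x|M. 2 * (h x * g x)) \<le> (LINT x|M. 2 * (h x)\<^sup>2 + (g x)\<^sup>2 / 2)"
    using g h by (intro integral_mono) auto
  then have "(LINT x|M. (g x)\<^sup>2) \<le> 2 * (LINT x|M. (h x)\<^sup>2) + (LINT x|M. (g x)\<^sup>2) / 2"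
    using g h by simp
  then have g4: "(LINT x|M. (g x)\<^sup>2) \<le> 4 * (LINT x|M. (h x)\<^sup>2)" by linarith
  have Ef: "E i \<in> fmeasurable M" if "i \<in> I" for i
    using that X E by (meson fmeasurableI2)
  have A0: "0 \<le> ?A (X i)" for i using h(2) by (auto intro!: divide_nonneg_nonneg integral_nonneg_AE)
  have iE: "integrable M (\<lambda>x. (?A (X i))\<^sup>2 * indicator (E i) x)" if "i \<in> I" for i
    using Ef[OF that] by (intro integrable_mult_right) (simp add: integrable_indicator_iff fmeasurable_def)
  have "(LINT x|M. (\<Sum>i\<in>I. (?A (X i))\<^sup>2 * indicator (E i) x)) = (\<Sum>i\<in>I. LINT x|M. (?A (X i))\<^sup>2 * indicator (E i) x)"
    using iE by (rule Bochner_Integration.integral_sum)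
  also have "\<dots> = (\<Sum>i\<in>I. (?A (X i))\<^sup>2 * measure M (E i))"
    using E(1) by (intro sum.cong refl) (simp add: sets.Int_space_eq2)
  finally have "(\<Sum>i\<in>I. (?A (X i))\<^sup>2 * measure M (E i)) = (LINT x|M. (\<Sum>i\<in>I. (?A (X i))\<^sup>2 * indicator (E i) x))" ..
  also have "\<dots> \<le> (LINT x|M. (g x)\<^sup>2)"
  proof (rule integral_mono)
    show "integrable M (\<lambda>x. \<Sum>i\<in>I. (?A (X i))\<^sup>2 * indicator (E i) x)"
      using iE by (rule Bochner_Integration.integrable_sum)
    fix x
    show "(\<Sum>i\<in>I. (?A (X i))\<^sup>2 * indicator (E i) x) \<le> (g x)\<^sup>2"
    proof (cases "\<exists>i\<in>I. x \<in> E i")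
      case True
      then obtain i where i: "i \<in> I" "x \<in> E i" by blast
      have "x \<notin> E j" if "j \<in> I" "j \<noteq> i" for j
        using E(3) i that unfolding disjoint_family_on_def by blast
      then have "(\<Sum>j\<in>I - {i}. (?A (X j))\<^sup>2 * indicator (E j) x) = 0"
        by (intro sum.neutral) simp
      then have "(\<Sum>j\<in>I. (?A (X j))\<^sup>2 * indicator (E j) x) = (?A (X i))\<^sup>2"
        using i assms(1) by (simp only: sum.remove[OF assms(1) i(1)]) simp
      also have "\<dots> \<le> (g x)\<^sup>2"
        by (rule power_mono) (use g(2)[of i x] i E(2) in blast, rule A0)
      finally show ?thesis .
    next
      case False
      then show ?thesis by (simp add: indicator_def)
    qed
  qed (fact g(3))
  finally show ?thesis using g4 by linarith
qed

section \<open>Calderon-Zygmund operators and the far part of the kernel\<close>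

text \<open>The functions for which the kernel represents \<open>T f\<close> off the support of \<open>f\<close>.\<close>

definition nice :: "(real^'d \<Rightarrow> complex) \<Rightarrow> bool" where
  "nice f \<longleftrightarrow> f \<in> borel_measurable lebesgue \<and> bounded (range f) \<and> bounded {y. f y \<noteq> 0}"

definition cut :: "'a set \<Rightarrow> ('a \<Rightarrow> complex) \<Rightarrow> 'a \<Rightarrow> complex" where
  "cut S f x = (if x \<in> S then f x else 0)"

lemma niceI:
  assumes "f \<in> borel_measurable lebesgue" "\<And>x. cmod (f x) \<le> B" "\<And>x. f x \<noteq> 0 \<Longrightarrow> norm x \<le> R"
  shows "nice f"
  unfolding nice_def using assms by (auto simp: bounded_iff)

lemma niceE:
  assumes "nice f"
  obtains B R where "f \<in> borel_measurable lebesgue" "B > 0" "\<And>x. cmod (f x) \<le> B" "\<And>x. f x \<noteq> 0 \<Longrightarrow> norm x \<le> R"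
proof -
  from assms obtain B where "\<And>x. cmod (f x) \<le> B" by (auto simp: nice_def bounded_iff)
  then have B: "cmod (f x) \<le> max B 1" for x by (meson max.coboundedI1)
  from assms obtain R where "\<And>x. f x \<noteq> 0 \<Longrightarrow> norm x \<le> R" by (auto simp: nice_def bounded_iff)
  with B show ?thesis using assms by (intro that[of "max B 1"]) (auto simp: nice_def)
qed

lemma nice_measurable: "nice f \<Longrightarrow> f \<in> borel_measurable lebesgue"
  by (simp add: nice_def)

lemma nice_cut:
  assumes "nice f" "S \<in> sets lebesgue"
  shows "nice (cut S f)"
proof -
  obtain B R where *: "f \<in> borel_measurable lebesgue" "B > 0" "\<And>x. cmod (f x) \<le> B" "\<And>x. f x \<noteq> 0 \<Longrightarrow> norm x \<le> R"
    using niceE[OF assms(1)] by metis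
  show ?thesis
  proof (rule niceI[of _ B R])
    show "cut S f \<in> borel_measurable lebesgue" unfolding cut_def using *(1) assms(2)
      by (intro measurable_If_set) auto
  qed (use * in \<open>auto simp: cut_def less_imp_le split: if_splits\<close>)
qed

lemma nice_add:
  assumes "nice f" "nice g"
  shows "nice (\<lambda>x. f x + g x)"
proof -
  obtain B R where *: "f \<in> borel_measurable lebesgue" "B > 0" "\<And>x. cmod (f x) \<le> B" "\<And>x. f x \<noteq> 0 \<Longrightarrow> norm x \<le> R"
    using niceE[OF assms(1)] by metis
  obtain B' R' where **: "g \<in> borel_measurable lebesgue" "B' > 0" "\<And>x. cmod (g x) \<le> B'" "\<And>x. g x \<noteq> 0 \<Longrightarrow> norm x \<le> R'"
    using niceE[OF assms(2)] by metis
  show ?thesis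
  proof (rule niceI[of _ "B + B'" "max R R'"])
    show "cmod (f x + g x) \<le> B + B'" for x using *(3) **(3) by (meson norm_triangle_mono)
    show "norm x \<le> max R R'" if "f x + g x \<noteq> 0" for x
      using *(4)[of x] **(4)[of x] that by (cases "f x = 0") (auto simp: max_def)
  qed (use * ** in measurable)
qed

lemma nice_scale:
  assumes "nice f"
  shows "nice (\<lambda>x. c * f x)"
proof -
  obtain B R where *: "f \<in> borel_measurable lebesgue" "B > 0" "\<And>x. cmod (f x) \<le> B" "\<And>x. f x \<noteq> 0 \<Longrightarrow> norm x \<le> R"
    using niceE[OF assms(1)] by metis
  show ?thesis
    by (rule niceI[of _ "cmod c * B" R]) (use * in \<open>auto simp: norm_mult intro: mult_left_mono\<close>)
qed

lemma nice_sq: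
  assumes f: "nice f"
  shows "nice (\<lambda>x. complex_of_real ((cmod (f x))\<^sup>2))"
proof -
  obtain B R where *: "f \<in> borel_measurable lebesgue" "B > 0" "\<And>x. cmod (f x) \<le> B" "\<And>x. f x \<noteq> 0 \<Longrightarrow> norm x \<le> R"
    using niceE[OF f] by metis
  show ?thesis
  proof (rule niceI[of _ "B\<^sup>2" R])
    show "(\<lambda>x. complex_of_real ((cmod (f x))\<^sup>2)) \<in> borel_measurable lebesgue" using *(1) by measurable
    show "cmod (complex_of_real ((cmod (f x))\<^sup>2)) \<le> B\<^sup>2" for x using *(3)[of x] by (simp add: norm_power power_mono)
  qed (use * in auto)
qed

lemma nice_indicator_cell: "L > 0 \<Longrightarrow> nice (\<lambda>x. c * indicator (cell a L k m) x)"
proof -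
  assume L: "L > 0"
  have "bounded (cell a L k m)" unfolding cell_eq_hcube[OF L]
    using hcube_between(2) bounded_cbox bounded_subset by blast
  then obtain R where "\<And>x. x \<in> cell a L k m \<Longrightarrow> norm x \<le> R" by (auto simp: bounded_iff)
  moreover have "(\<lambda>x. c * indicator (cell a L k m) x) \<in> borel_measurable lebesgue"
    using L by (intro borel_measurable_times borel_measurable_indicator) auto
  ultimately show ?thesis
    by (intro niceI[of _ "cmod c" R]) (auto simp: indicator_def norm_mult)
qed

lemma nice_zero: "nice (\<lambda>_. 0)"
  by (rule niceI[of _ 0 0]) auto

lemma nice_sum: "(\<And>i. i \<in> I \<Longrightarrow> nice (f i)) \<Longrightarrow> nice (\<lambda>x. \<Sum>i\<in>I. f i x)"
  by (induction I rule: infinite_finite_induct) (auto simp: nice_zero nice_add)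

lemma nice_integrable:
  fixes f :: "real^'d \<Rightarrow> complex"
  assumes "nice f"
  shows "integrable lebesgue f" "integrable lebesgue (\<lambda>x. cmod (f x))" "integrable lebesgue (\<lambda>x. (cmod (f x))\<^sup>2)"
proof -
  obtain B R where *: "f \<in> borel_measurable lebesgue" "B > 0" "\<And>x. cmod (f x) \<le> B" "\<And>x. f x \<noteq> 0 \<Longrightarrow> norm x \<le> R"
    using niceE[OF assms(1)] by metis
  have i: "integrable lebesgue (\<lambda>x. c * indicator (cball (0::real^'d) R) x :: real)" for c
    using emeasure_bounded_finite[of "cball (0::real^'d) R"]
    by (intro integrable_mult_right) (simp add: integrable_indicator_iff less_top)
  have **: "(cmod (f x)) \<le> B * indicator (cball (0::real^'d) R) x" for x
    using *(3)[of x] *(4)[of x] *(2) by (cases "f x = 0") (auto simp: indicator_def less_imp_le)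
  show 1: "integrable lebesgue f"
    using *(1) ** by (intro Bochner_Integration.integrable_bound[OF i[of B]]) (auto simp: *(2) less_imp_le)
  then show "integrable lebesgue (\<lambda>x. cmod (f x))" by auto
  have "(cmod (f x))\<^sup>2 \<le> B\<^sup>2 * indicator (cball (0::real^'d) R) x" for x
    using power_mono[OF **[of x], of 2] by (auto simp: indicator_def split: if_splits)
  then show "integrable lebesgue (\<lambda>x. (cmod (f x))\<^sup>2)"
    using *(1) by (intro Bochner_Integration.integrable_bound[OF i[of "B\<^sup>2"]]) auto
qed

lemma nice_L2: "nice f \<Longrightarrow> f \<in> L2 lebesgue"
  by (simp add: L2_def nice_measurable nice_integrable)

definition mass_measure :: "(real^'d \<Rightarrow> complex) \<Rightarrow> (real^'d) measure" where
  "mass_measure f = density lebesgue (\<lambda>x. ennreal (cmod (f x)))"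

abbreviation mass :: "(real^'d \<Rightarrow> complex) \<Rightarrow> (real^'d) set \<Rightarrow> real" where
  "mass f S \<equiv> measure (mass_measure f) S"

lemma sets_mass_measure [simp]: "sets (mass_measure f) = sets lebesgue"
  by (simp add: mass_measure_def)

lemma emeasure_mass_measure:
  assumes "nice f" "S \<in> sets lebesgue"
  shows "emeasure (mass_measure f) S = ennreal (LINT x|lebesgue. indicator S x * cmod (f x))"
proof -
  have [measurable]: "f \<in> borel_measurable lebesgue" "S \<in> sets lebesgue" using assms by (auto simp: nice_measurable)
  have int: "integrable lebesgue (\<lambda>x. indicator S x * cmod (f x))"
    using nice_integrable(2)[OF assms(1)] by (rule Bochner_Integration.integrable_bound) (auto simp: indicator_def)
  have "emeasure (mass_measure f) S = (\<integral>\<^sup>+x. ennreal (cmod (f x)) * indicator S x \<partial>lebesgue)"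
    unfolding mass_measure_def by (rule emeasure_density) auto
  also have "\<dots> = (\<integral>\<^sup>+x. ennreal (indicator S x * cmod (f x)) \<partial>lebesgue)"
    by (intro nn_integral_cong) (auto simp: indicator_def)
  also have "\<dots> = ennreal (LINT x|lebesgue. indicator S x * cmod (f x))"
    using int by (intro nn_integral_eq_integral) auto
  finally show ?thesis .
qed

lemma finite_mass_measure: "nice f \<Longrightarrow> finite_measure (mass_measure f)"
proof
  assume "nice f"
  then have "emeasure (mass_measure f) UNIV = ennreal (LINT x|lebesgue. indicator UNIV x * cmod (f x))"
    by (rule emeasure_mass_measure) auto
  then show "emeasure (mass_measure f) (space (mass_measure f)) \<noteq> \<infinity>" by (simp add: mass_measure_def)
qed

lemma mass_eq_integral:
  assumes "nice f" "S \<in> sets lebesgue"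
  shows "mass f S = (LINT x|lebesgue. indicator S x * cmod (f x))"
  using emeasure_mass_measure[OF assms] by (simp add: measure_def integral_nonneg_AE)

lemma mass_mono: "nice f \<Longrightarrow> S \<subseteq> S' \<Longrightarrow> S' \<in> sets lebesgue \<Longrightarrow> mass f S \<le> mass f S'"
  by (intro finite_measure.finite_measure_mono finite_mass_measure) auto

lemma mass_cut:
  assumes "nice f" "S \<in> sets lebesgue" "S' \<in> sets lebesgue"
  shows "mass (cut S f) S' = mass f (S \<inter> S')"
  using assms by (simp add: mass_eq_integral nice_cut)
    (auto intro!: Bochner_Integration.integral_cong simp: cut_def indicator_def)

lemma not_in_closure_support:
  assumes "r > 0" "\<And>y. h y \<noteq> (0::complex) \<Longrightarrow> r \<le> norm (z - y)"
  shows "z \<notin> closure {y. h y \<noteq> 0}"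
proof
  assume "z \<in> closure {y. h y \<noteq> 0}"
  then obtain y where "h y \<noteq> 0" "dist y z < r" using assms(1) by (auto simp: closure_approachable)
  then show False using assms(2)[of y] by (simp add: dist_norm norm_minus_commute)
qed

text \<open>The hypotheses in the form used below: \<open>B\<close> bounds the square of the \<open>L\<^sup>2\<close> operator norm.\<close>

locale calderon_zygmund =
  fixes T :: "(real^'d \<Rightarrow> complex) \<Rightarrow> real^'d \<Rightarrow> complex"
    and K :: "real^'d \<Rightarrow> real^'d \<Rightarrow> complex" and Cz \<delta> B :: real
  assumes delta: "0 < \<delta>" and Cz: "0 \<le> Cz" and B: "0 \<le> B"
    and T_L2: "\<And>f. f \<in> L2 lebesgue \<Longrightarrow> T f \<in> L2 lebesgue"
    and T_add: "\<And>f g. f \<in> L2 lebesgue \<Longrightarrow> g \<in> L2 lebesgue \<Longrightarrow> AE x in lebesgue. T (\<lambda>y. f y + g y) x = T f x + T g x"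
    and T_scale: "\<And>c f. f \<in> L2 lebesgue \<Longrightarrow> AE x in lebesgue. T (\<lambda>y. c * f y) x = c * T f x"
    and T_bound: "\<And>f. f \<in> L2 lebesgue \<Longrightarrow> (LINT x|lebesgue. (cmod (T f x))\<^sup>2) \<le> B * (LINT x|lebesgue. (cmod (f x))\<^sup>2)"
    and T_rep: "\<And>f. nice f \<Longrightarrow> AE x in lebesgue. x \<notin> closure {y. f y \<noteq> 0} \<longrightarrow> T f x = (LINT y|lebesgue. K x y * f y)"
    and K_size: "\<And>x y. x \<noteq> y \<Longrightarrow> cmod (K x y) \<le> Cz / norm (x - y) ^ CARD('d)"
    and K_smooth: "\<And>x x' y. norm (x - y) > 2 * norm (x - x') \<Longrightarrow>
          cmod (K x y - K x' y) + cmod (K y x - K y x')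
            \<le> Cz * norm (x - x') powr \<delta> / norm (x - y) powr (real CARD('d) + \<delta>)"
begin

lemma T_measurable: "nice f \<Longrightarrow> T f \<in> borel_measurable lebesgue"
  using T_L2[OF nice_L2] by (auto simp: L2_def)

lemma T_sq_integrable: "nice f \<Longrightarrow> integrable lebesgue (\<lambda>x. (cmod (T f x))\<^sup>2)"
  using T_L2[OF nice_L2] by (auto simp: L2_def)

text \<open>The factor gained from the smoothness of the kernel each time the distance doubles.\<close>

definition decay :: real where "decay = 2 powr (- \<delta>)"

lemma decay: "0 < decay" "decay < 1"
  using delta by (auto simp: decay_def powr_less_one)

lemma decay_sum: "(\<Sum>j<n. decay^(n - 1 - j)) \<le> 1 / (1 - decay)"
proof -
  have "(\<Sum>j<n. decay^(n - 1 - j)) = (\<Sum>j<n. decay^j)"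
    using sum.nat_diff_reindex[of "\<lambda>j. decay^j" n] by simp
  also have "\<dots> \<le> (\<Sum>j. decay^j)" using decay by (intro sum_le_suminf summable_geometric) auto
  also have "\<dots> = 1 / (1 - decay)" using decay by (intro suminf_geometric) auto
  finally show ?thesis .
qed

text \<open>The diameter of a cube is at most \<open>d\<close> times its side, and the dilate of an ancestor has \<open>(2 (4d + 3))^d\<close> times the volume
  of a cube whose side is the lower bound for the distance used in \<open>kernel_chain\<close>.\<close>

definition chain_const :: real where
  "chain_const = Cz * real CARD('d) powr \<delta> * (2 * (4 * real CARD('d) + 3))^CARD('d)"

lemma chain_const: "0 \<le> chain_const" using Cz by (simp add: chain_const_def)

text \<open>For a cube \<open>R\<close> of generation \<open>k + n\<close> and index \<open>m\<close>, this is a sum of the normalised indicators of the dilates of its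
  ancestors back to generation \<open>k\<close>, with weights that decrease geometrically with the size of the ancestor. Up to a
  constant it dominates the variation of the kernel over \<open>R\<close>, and it serves two purposes: integrated against \<open>|f|\<close> it gives
  averages of \<open>|f|\<close>, and integrated by itself it is bounded.\<close>

definition chain_kernel :: "real^'d \<Rightarrow> real \<Rightarrow> nat \<Rightarrow> nat \<Rightarrow> int^'d \<Rightarrow> real^'d \<Rightarrow> real" where
  "chain_kernel a L k n m y = (\<Sum>j<n. decay^(n - 1 - j) * (indicator (dil a L (k+j) (anc (n-j) m)) y /
      vol (dil a L (k+j) (anc (n-j) m))))"

text \<open>If \<open>y\<close> lies in the layer between two consecutive ancestors, its distance from the cube is comparable to the side of the
  larger one, and the smoothness condition gives the corresponding term of the sum.\<close>

lemma kernel_chain: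
  assumes L: "L > 0" and x: "x \<in> cell a L (k+n) m" "x' \<in> cell a L (k+n) m"
    and y: "y \<in> dil a L k (anc n m)" "y \<notin> dil a L (k+n) m"
  shows "cmod (K x y - K x' y) + cmod (K y x - K y x') \<le> chain_const * chain_kernel a L k n m y"
proof -
  obtain j where j: "j < n" "y \<in> dil a L (k+j) (anc (n-j) m)" "y \<notin> dil a L (k+Suc j) (anc (n-Suc j) m)"
    using dil_level[OF L y] by blast
  define s where "s = L / 2^(k+n)"
  define r where "r = L / 2^(k+Suc j)"
  let ?d = "real CARD('d)"
  have s: "s > 0" "r > 0" using L by (auto simp: s_def r_def)
  have sr: "s = r * (1/2)^(n - 1 - j)"
  proof -
    have "k + n = (k + Suc j) + (n - 1 - j)" using j by simp
    then have "s = L / (2^(k + Suc j) * 2^(n - 1 - j))" unfolding s_def by (metis power_add)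
    then show ?thesis by (simp add: r_def power_divide)
  qed
  have xs: "norm (x - x') \<le> ?d * s" using cell_diam[OF L x] unfolding s_def .
  have "(2 * ?d + 1) * s \<le> norm (x - y)" using dil_separation[OF L x(1) y(2)] unfolding s_def .
  moreover have "2 * (?d * s) < (2 * ?d + 1) * s" using s by (simp add: algebra_simps)
  ultimately have far: "norm (x - y) > 2 * norm (x - x')" using xs by linarith
  have "x \<in> cell a L (k + Suc j) (anc (n - Suc j) m)"
    using cell_subset_anc[OF L, of a "k + Suc j" "n - Suc j" m] x j by auto
  from dil_separation[OF L this j(3)] have "(2 * ?d + 1) * r \<le> norm (x - y)" unfolding r_def .
  moreover have "1 * r \<le> (2 * ?d + 1) * r" using s by (intro mult_right_mono) auto
  ultimately have rxy: "r \<le> norm (x - y)" by linarith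
  have "cmod (K x y - K x' y) + cmod (K y x - K y x')
     \<le> Cz * norm (x - x') powr \<delta> / norm (x - y) powr (?d + \<delta>)"
    by (rule K_smooth[OF far])
  also have "\<dots> \<le> Cz * (?d * s) powr \<delta> / r powr (?d + \<delta>)"
    using xs rxy s delta Cz by (intro frac_le mult_left_mono powr_mono2 mult_nonneg_nonneg) auto
  also have "(?d * s) powr \<delta> = ?d powr \<delta> * r powr \<delta> * decay^(n - 1 - j)"
  proof -
    have "((1/2)^(n - 1 - j)) powr \<delta> = decay^(n - 1 - j)"
    proof -
      have q2: "decay = (1/2) powr \<delta>" unfolding decay_def by (simp add: powr_minus powr_divide inverse_eq_divide)
      show ?thesis unfolding q2 by (simp add: powr_realpow[symmetric] powr_powr mult.commute)
    qed
    then show ?thesis unfolding sr using s by (simp add: powr_mult)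
  qed
  also have "r powr (?d + \<delta>) = r^CARD('d) * r powr \<delta>"
    using s by (simp add: powr_add powr_realpow)
  also have "Cz * (?d powr \<delta> * r powr \<delta> * decay^(n - 1 - j)) / (r^CARD('d) * r powr \<delta>)
      = Cz * ?d powr \<delta> * decay^(n - 1 - j) / r^CARD('d)" using s by simp
  also have "\<dots> = chain_const * (decay^(n - 1 - j) * (1 / vol (dil a L (k+j) (anc (n-j) m))))"
  proof -
    have "L / 2^(k+j) = 2 * r" by (simp add: r_def)
    then have "vol (dil a L (k+j) (anc (n-j) m)) = (4 * ?d + 3)^CARD('d) * (2 * r)^CARD('d)"
      using measure_dil[OF L, of a "k+j"] by simp
    also have "\<dots> = (2 * (4 * ?d + 3))^CARD('d) * r^CARD('d)" by (simp only: power_mult_distrib mult_ac)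
    finally have e: "vol (dil a L (k+j) (anc (n-j) m)) = (2 * (4 * ?d + 3))^CARD('d) * r^CARD('d)" .
    define Al where "Al = (2 * (4 * ?d + 3))^CARD('d)"
    have "Al > 0" unfolding Al_def by (intro zero_less_power) (simp add: add_nonneg_pos)
    then show ?thesis unfolding e chain_const_def Al_def[symmetric] using s by simp
  qed
  also have "decay^(n - 1 - j) * (1 / vol (dil a L (k+j) (anc (n-j) m))) \<le> chain_kernel a L k n m y"
  proof -
    let ?t = "\<lambda>j. decay^(n - 1 - j) * (indicator (dil a L (k+j) (anc (n-j) m)) y /
      vol (dil a L (k+j) (anc (n-j) m)))"
    have "?t j \<le> sum ?t {..<n}"
      using j(1) decay by (intro member_le_sum) auto
    then show ?thesis using j(2) by (simp add: chain_kernel_def)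
  qed
  finally show ?thesis using chain_const by (simp add: mult_left_mono)
qed

lemma chain_kernel_nonneg: "0 \<le> chain_kernel a L k n m y"
  using decay by (auto simp: chain_kernel_def intro!: sum_nonneg)

lemma chain_kernel_integral:
  assumes L: "L > 0"
  shows "integrable lebesgue (chain_kernel a L k n m)" "(LINT y|lebesgue. chain_kernel a L k n m y) \<le> 1 / (1 - decay)"
proof -
  let ?D = "\<lambda>j. dil a L (k+j) (anc (n-j) m)"
  have i: "integrable lebesgue (\<lambda>y. decay^(n - 1 - j) * (indicator (?D j) y / vol (?D j)))" for j
    using L dil_lmeasurable[OF L, of a "k+j" "anc (n-j) m"]
    by (intro integrable_mult_right integrable_divide) (simp add: integrable_indicator_iff fmeasurable_def del: emeasure_completion dil_lmeasurable)
  then show "integrable lebesgue (chain_kernel a L k n m)" unfolding chain_kernel_def[abs_def] by (intro Bochner_Integration.integrable_sum)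
  have "(LINT y|lebesgue. chain_kernel a L k n m y) = (\<Sum>j<n. LINT y|lebesgue. decay^(n - 1 - j) * (indicator (?D j) y / vol (?D j)))"
    unfolding chain_kernel_def using i by (intro Bochner_Integration.integral_sum) auto
  also have "\<dots> = (\<Sum>j<n. decay^(n - 1 - j))"
  proof (intro sum.cong refl)
    fix j
    have "(LINT y|lebesgue. indicator (?D j) y) = vol (?D j)" using L by simp
    moreover have "vol (?D j) > 0" using measure_dil_pos[OF L] .
    ultimately show "(LINT y|lebesgue. decay^(n - 1 - j) * (indicator (?D j) y / vol (?D j))) = decay^(n - 1 - j)"
      by (simp only: integral_mult_right_zero integral_divide_zero) simp
  qed
  also have "\<dots> \<le> 1 / (1 - decay)" by (rule decay_sum)
  finally show "(LINT y|lebesgue. chain_kernel a L k n m y) \<le> 1 / (1 - decay)" .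
qed

text \<open>The smoothness condition in the second variable makes \<open>K x\<close> continuous away from \<open>x\<close>.\<close>

lemma kernel_measurable:
  assumes "h \<in> borel_measurable lebesgue" "h x = 0"
  shows "(\<lambda>y. K x y * h y) \<in> borel_measurable lebesgue"
proof -
  have "continuous_on (- {x}) (K x)"
  proof (rule continuous_on_eq_continuous_at[THEN iffD2, rule_format])
    show "open (- {x})" by auto
    fix y assume "y \<in> - {x}"
    then have yx: "y \<noteq> x" by auto
    define R where "R = Cz / norm (y - x) powr (real CARD('d) + \<delta>)"
    have ev: "eventually (\<lambda>y'. norm (K x y' - K x y) \<le> norm (y - y') powr \<delta> * R) (at y)"
    proof -
      have "eventually (\<lambda>y'. dist y' y < norm (y - x) / 2) (at y)"
        using yx unfolding eventually_at by (intro exI[of _ "norm (y - x) / 2"]) auto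
      then show ?thesis
      proof (rule eventually_mono)
        fix y' assume "dist y' y < norm (y - x) / 2"
        then have "norm (y - x) > 2 * norm (y - y')" by (simp add: dist_norm norm_minus_commute)
        from K_smooth[OF this] have "cmod (K x y - K x y') \<le> Cz * norm (y - y') powr \<delta> / norm (y - x) powr (real CARD('d) + \<delta>)"
          by (smt (verit) norm_ge_zero)
        then show "norm (K x y' - K x y) \<le> norm (y - y') powr \<delta> * R" by (simp add: R_def norm_minus_commute mult_ac)
      qed
    qed
    have "((\<lambda>y'. norm (y - y') powr \<delta> * R) \<longlongrightarrow> 0) (at y)"
    proof -
      have "((\<lambda>y'. norm (y - y')) \<longlongrightarrow> 0) (at y)" by (rule tendsto_eq_intros | simp)+
      then have "((\<lambda>y'. norm (y - y') powr \<delta>) \<longlongrightarrow> 0) (at y)"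
        using tendsto_zero_powrI[OF _ tendsto_const[of \<delta> "at y"] _ delta] by auto
      then show ?thesis by (rule tendsto_mult_left_zero)
    qed
    then have "((\<lambda>y'. K x y' - K x y) \<longlongrightarrow> 0) (at y)"
      by (rule Lim_null_comparison[OF ev])
    then show "isCont (K x) y" by (simp add: isCont_def LIM_zero_iff)
  qed
  then have "(\<lambda>y. indicator (- {x}) y *\<^sub>R K x y) \<in> borel_measurable borel"
    by (rule borel_measurable_continuous_on_indicator[rotated]) auto
  then have [measurable]: "(\<lambda>y. indicator (- {x}) y *\<^sub>R K x y) \<in> borel_measurable lebesgue"
    by (intro measurable_completion) auto
  have "(\<lambda>y. K x y * h y) = (\<lambda>y. (indicator (- {x}) y *\<^sub>R K x y) * h y)"
    using assms(2) by (auto simp: indicator_def fun_eq_iff)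
  also have "\<dots> \<in> borel_measurable lebesgue" using assms(1) by measurable
  finally show ?thesis .
qed

lemma kernel_integrable:
  assumes "nice h" "r > 0" "\<And>y. h y \<noteq> 0 \<Longrightarrow> r \<le> norm (x - y)"
  shows "integrable lebesgue (\<lambda>y. K x y * h y)"
proof (rule Bochner_Integration.integrable_bound)
  show "integrable lebesgue (\<lambda>y. Cz / r^CARD('d) * cmod (h y))"
    using nice_integrable(2)[OF assms(1)] by (intro integrable_mult_right)
  have "h x = 0" using assms(2) assms(3)[of x] by force
  then show "(\<lambda>y. K x y * h y) \<in> borel_measurable lebesgue"
    using assms(1) by (intro kernel_measurable nice_measurable)
  have "norm (K x y * h y) \<le> norm (Cz / r^CARD('d) * cmod (h y))" for y
  proof (cases "h y = 0")
    case False
    then have r: "r \<le> norm (x - y)" by (rule assms(3))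
    then have "x \<noteq> y" using assms(2) by auto
    then have "cmod (K x y) \<le> Cz / norm (x - y) ^ CARD('d)" by (rule K_size)
    also have "\<dots> \<le> Cz / r ^ CARD('d)" using r assms(2) Cz by (intro frac_le power_mono) auto
    finally have "cmod (K x y) * cmod (h y) \<le> Cz / r ^ CARD('d) * cmod (h y)"
      by (rule mult_right_mono) simp
    then show ?thesis using assms(2) Cz by (simp add: norm_mult abs_mult)
  qed simp
  then show "AE y in lebesgue. norm (K x y * h y) \<le> norm (Cz / r^CARD('d) * cmod (h y))" by simp
qed

text \<open>The far part of \<open>T f\<close> oscillates little on a cube, provided that the averages of \<open>|f|\<close> over the dilated strict ancestors of
  that cube are bounded.\<close>

lemma oscillation:
  assumes L: "L > 0" and f: "nice f" and x: "x \<in> cell a L (k+n) m" "x' \<in> cell a L (k+n) m"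
    and M0: "0 \<le> M" and M: "\<And>j. j < n \<Longrightarrow> mass f (dil a L (k+j) (anc (n-j) m)) \<le> M * vol (dil a L (k+j) (anc (n-j) m))"
  defines "h \<equiv> cut (dil a L k (anc n m) - dil a L (k+n) m) f"
  shows "cmod ((LINT y|lebesgue. K x y * h y) - (LINT y|lebesgue. K x' y * h y)) \<le> chain_const / (1 - decay) * M"
proof -
  let ?D = "\<lambda>j. dil a L (k+j) (anc (n-j) m)"
  have h: "nice h" unfolding h_def using f L by (intro nice_cut sets.Diff) auto
  define r where "r = (2 * real CARD('d) + 1) * (L/2^(k+n))"
  have r: "r > 0" unfolding r_def using L by (intro mult_pos_pos add_nonneg_pos) auto
  have sep: "r \<le> norm (z - y)" if "h y \<noteq> 0" "z \<in> cell a L (k+n) m" for y z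
    using that dil_separation[OF L that(2)] by (auto simp: h_def cut_def r_def split: if_splits)
  have i: "integrable lebesgue (\<lambda>y. K x y * h y)" "integrable lebesgue (\<lambda>y. K x' y * h y)"
    using kernel_integrable[OF h r] sep x by blast+
  have iD: "integrable lebesgue (\<lambda>y. indicator (?D j) y * cmod (f y))" for j
  proof -
    have "integrable lebesgue (\<lambda>y. cmod (cut (?D j) f y))"
      using f L by (intro nice_integrable nice_cut) auto
    moreover have "(\<lambda>y. cmod (cut (?D j) f y)) = (\<lambda>y. indicator (?D j) y * cmod (f y))"
      by (auto simp: cut_def indicator_def)
    ultimately show ?thesis by simp
  qed
  let ?I = "\<lambda>y. \<Sum>j<n. decay^(n - 1 - j) / vol (?D j) * (indicator (?D j) y * cmod (f y))"
  have iI: "integrable lebesgue ?I"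
    using iD by (intro Bochner_Integration.integrable_sum integrable_mult_right)
  have "cmod ((LINT y|lebesgue. K x y * h y) - (LINT y|lebesgue. K x' y * h y))
      = cmod (LINT y|lebesgue. K x y * h y - K x' y * h y)"
    using i by (subst Bochner_Integration.integral_diff) auto
  also have "\<dots> \<le> (LINT y|lebesgue. cmod (K x y * h y - K x' y * h y))" by (rule integral_norm_bound)
  also have "\<dots> \<le> (LINT y|lebesgue. chain_const * ?I y)"
  proof (rule integral_mono)
    fix y
    show "cmod (K x y * h y - K x' y * h y) \<le> chain_const * ?I y"
    proof (cases "y \<in> dil a L k (anc n m) - dil a L (k+n) m")
      case True
      then have "cmod (K x y - K x' y) \<le> chain_const * chain_kernel a L k n m y"
        using kernel_chain[OF L x, of y] by (smt (verit) DiffE norm_ge_zero)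
      then have "cmod (K x y - K x' y) * cmod (f y) \<le> chain_const * chain_kernel a L k n m y * cmod (f y)"
        by (rule mult_right_mono) simp
      also have "\<dots> = chain_const * ?I y"
        unfolding chain_kernel_def by (simp add: sum_distrib_right sum_distrib_left mult_ac)
      finally show ?thesis using True by (simp add: h_def cut_def norm_mult left_diff_distrib[symmetric])
    next
      case False
      have "0 \<le> ?I y" using decay by (intro sum_nonneg) auto
      then show ?thesis using False chain_const by (auto simp: h_def cut_def)
    qed
  qed (use i iI in auto)
  also have "\<dots> = chain_const * (\<Sum>j<n. decay^(n - 1 - j) / vol (?D j) * mass f (?D j))"
    using iD by (simp add: Bochner_Integration.integral_sum mass_eq_integral[OF f] L)
  also have "\<dots> \<le> chain_const * (\<Sum>j<n. decay^(n - 1 - j) * M)"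
  proof (intro mult_left_mono sum_mono chain_const)
    fix j assume "j \<in> {..<n}"
    then have "mass f (?D j) / vol (?D j) \<le> M"
      using M[of j] measure_dil_pos[OF L, of a "k+j"] by (simp add: pos_divide_le_eq)
    then show "decay^(n - 1 - j) / vol (?D j) * mass f (?D j) \<le> decay^(n - 1 - j) * M"
      using mult_left_mono[of _ M "decay^(n - 1 - j)"] decay by fastforce
  qed
  also have "\<dots> \<le> chain_const * (1 / (1 - decay) * M)"
    unfolding sum_distrib_right[symmetric] by (intro mult_left_mono mult_right_mono decay_sum chain_const M0)
  finally show ?thesis by simp
qed

text \<open>Because \<open>b\<close> has mean zero, the kernel may be replaced by its difference from the value at a point of the cube.\<close>

lemma bad_part_pointwise:
  assumes L: "L > 0" and b: "nice b" and supp: "\<And>y. b y \<noteq> 0 \<Longrightarrow> y \<in> cell a L (k+n) m"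
    and mean: "(LINT y|lebesgue. b y) = 0"
  shows "AE z in lebesgue. z \<in> dil a L k (anc n m) - dil a L (k+n) m \<longrightarrow>
    cmod (T b z) \<le> chain_const * chain_kernel a L k n m z * (LINT y|lebesgue. cmod (b y))"
  using T_rep[OF b]
proof (rule AE_mp, intro AE_I2 impI)
  fix z assume rep: "z \<notin> closure {y. b y \<noteq> 0} \<longrightarrow> T b z = (LINT y|lebesgue. K z y * b y)"
    and z: "z \<in> dil a L k (anc n m) - dil a L (k+n) m"
  define r where "r = (2 * real CARD('d) + 1) * (L/2^(k+n))"
  have r: "r > 0" unfolding r_def using L by (intro mult_pos_pos add_nonneg_pos) auto
  have sep: "r \<le> norm (z - y)" if "b y \<noteq> 0" for y
    using that dil_separation[OF L supp[OF that], of z] z by (simp add: r_def norm_minus_commute)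
  have "z \<notin> closure {y. b y \<noteq> 0}" by (rule not_in_closure_support[OF r sep])
  with rep have Tb: "T b z = (LINT y|lebesgue. K z y * b y)" by blast
  obtain y0 where y0: "y0 \<in> cell a L (k+n) m"
    using measure_cell_pos[OF L, of a "k+n" m] by (metis equals0I less_irrefl measure_empty)
  have i: "integrable lebesgue (\<lambda>y. K z y * b y)" by (rule kernel_integrable[OF b r sep])
  have ib: "integrable lebesgue b" "integrable lebesgue (\<lambda>y. cmod (b y))" using nice_integrable[OF b] by auto
  have "T b z = (LINT y|lebesgue. K z y * b y - K z y0 * b y)"
    using i ib mean Tb by (subst Bochner_Integration.integral_diff) auto
  then have "cmod (T b z) \<le> (LINT y|lebesgue. cmod (K z y * b y - K z y0 * b y))"
    by (metis integral_norm_bound)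
  also have "\<dots> \<le> (LINT y|lebesgue. chain_const * chain_kernel a L k n m z * cmod (b y))"
  proof (rule integral_mono)
    fix y
    show "cmod (K z y * b y - K z y0 * b y) \<le> chain_const * chain_kernel a L k n m z * cmod (b y)"
    proof (cases "b y = 0")
      case False
      have "cmod (K z y - K z y0) \<le> chain_const * chain_kernel a L k n m z"
        using kernel_chain[OF L supp[OF False] y0, of z] z by (smt (verit) DiffE norm_ge_zero)
      then show ?thesis by (simp add: left_diff_distrib[symmetric] norm_mult mult_right_mono)
    qed simp
  qed (use i ib in auto)
  finally show "cmod (T b z) \<le> chain_const * chain_kernel a L k n m z * (LINT y|lebesgue. cmod (b y))" by simp
qed

end

section \<open>The Calderon-Zygmund decomposition\<close>

lemma small_cell_in_open:
  fixes U :: "(real^'d) set" and x :: "real^'d"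
  assumes L: "L > 0" and "open U" "x \<in> U"
  obtains n where "cell a L (k+n) (idx a L (k+n) x) \<subseteq> U"
proof -
  obtain e where e: "e > 0" "ball x e \<subseteq> U" using assms openE by blast
  have "((\<lambda>n. CARD('d) * (L / 2^(k+n))) \<longlonglongrightarrow> 0)"
  proof -
    have "(\<lambda>n. CARD('d) * (L / 2^k) * (1/2)^n) \<longlonglongrightarrow> CARD('d) * (L / 2^k) * 0"
      by (intro tendsto_mult tendsto_const LIMSEQ_power_zero) auto
    moreover have "CARD('d) * (L / 2^k) * (1/2)^n = CARD('d) * (L / 2^(k+n))" for n
      by (simp add: power_add power_divide)
    ultimately show ?thesis by (simp only: mult_zero_right)
  qed
  then have "eventually (\<lambda>n. CARD('d) * (L / 2^(k+n)) < e) sequentially"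
    using e(1) order_tendstoD(2) by blast
  then obtain n where n: "CARD('d) * (L / 2^(k+n)) < e" by (auto simp: eventually_sequentially)
  have "cell a L (k+n) (idx a L (k+n) x) \<subseteq> ball x e"
  proof
    fix y assume "y \<in> cell a L (k+n) (idx a L (k+n) x)"
    from cell_diam[OF L cell_idx this] n show "y \<in> ball x e" by (simp add: dist_norm)
  qed
  with e(2) show ?thesis using that by blast
qed

text \<open>Allows the Calderon-Zygmund decomposition to use finitely many cubes only.\<close>

lemma finite_subfamily_tail:
  fixes X :: "'i::countable \<Rightarrow> 'a set"
  assumes "finite_measure M" "\<And>i. i \<in> I \<Longrightarrow> X i \<in> sets M" "e > 0"
  obtains F where "finite F" "F \<subseteq> I" "measure M ((\<Union>i\<in>I. X i) - (\<Union>i\<in>F. X i)) < e"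
proof -
  interpret finite_measure M by fact
  define F where "F n = {i \<in> I. to_nat i < n}" for n
  have finF: "finite (F n)" for n
  proof -
    have "F n \<subseteq> to_nat -` {..<n}" by (auto simp: F_def)
    moreover have "finite (to_nat -` {..<n} :: 'i set)" by (intro finite_vimageI) auto
    ultimately show ?thesis by (rule finite_subset)
  qed
  define A where "A n = (\<Union>i\<in>I. X i) - (\<Union>i\<in>F n. X i)" for n
  have A: "A n \<in> sets M" for n unfolding A_def
    using assms(2) by (intro sets.Diff sets.countable_UN') (auto simp: F_def)
  have "decseq A" by (auto simp: decseq_def A_def F_def)
  then have "(\<lambda>n. measure M (A n)) \<longlonglongrightarrow> measure M (\<Inter>n. A n)"
    using A by (intro finite_Lim_measure_decseq) auto
  moreover have "(\<Inter>n. A n) = {}" by (auto simp: A_def F_def)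
  ultimately have "(\<lambda>n. measure M (A n)) \<longlonglongrightarrow> 0" by simp
  then have "eventually (\<lambda>n. measure M (A n) < e) sequentially" using assms(3) order_tendstoD(2) by blast
  then obtain n where "measure M (A n) < e" by (auto simp: eventually_sequentially)
  then show ?thesis using finF[of n] by (intro that[of "F n"]) (auto simp: A_def F_def)
qed

lemma nice_mean_bound:
  assumes "nice f" "S \<in> sets lebesgue"
  shows "cmod (LINT x|lebesgue. cut S f x) \<le> mass f S"
proof -
  have "cmod (LINT x|lebesgue. cut S f x) \<le> (LINT x|lebesgue. cmod (cut S f x))" by (rule integral_norm_bound)
  also have "(\<lambda>x. cmod (cut S f x)) = (\<lambda>x. indicator S x * cmod (f x))" by (auto simp: cut_def)
  finally show ?thesis using mass_eq_integral[OF assms] by simp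
qed

lemma mass_finite_Union:
  assumes "nice f" "finite F" "\<And>i. i \<in> F \<Longrightarrow> X i \<in> sets lebesgue" "disjoint_family_on X F"
  shows "(\<Sum>i\<in>F. mass f (X i)) \<le> mass f UNIV"
proof -
  have "(\<Sum>i\<in>F. mass f (X i)) = mass f (\<Union>i\<in>F. X i)"
    using assms by (intro finite_measure.finite_measure_finite_Union[symmetric] finite_mass_measure) auto
  also have "\<dots> \<le> mass f UNIV" using assms by (intro mass_mono) auto
  finally show ?thesis .
qed

lemma nice_mass_superlevel:
  assumes f: "nice f" and "l > 0"
  shows "{x. l < cmod (f x)} \<in> lmeasurable" "vol {x. l < cmod (f x)} \<le> mass f UNIV / l"
proof -
  have [measurable]: "f \<in> borel_measurable lebesgue" by (rule nice_measurable[OF f])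
  have "{x \<in> space lebesgue. l < cmod (f x)} \<in> sets lebesgue" by measurable
  then have s: "{x. l < cmod (f x)} \<in> sets lebesgue" by simp
  have "ennreal l * emeasure lebesgue {x. l < cmod (f x)} = (\<integral>\<^sup>+x. ennreal l * indicator {x. l < cmod (f x)} x \<partial>lebesgue)"
    using s by (simp add: nn_integral_cmult_indicator del: emeasure_completion)
  also have "\<dots> \<le> (\<integral>\<^sup>+x. ennreal (cmod (f x)) \<partial>lebesgue)"
    by (intro nn_integral_mono) (auto simp: indicator_def intro: ennreal_leI)
  also have "\<dots> = ennreal (mass f UNIV)"
    using nice_integrable(2)[OF f] mass_eq_integral[OF f, of UNIV] by (simp add: nn_integral_eq_integral)
  finally have *: "ennreal l * emeasure lebesgue {x. l < cmod (f x)} \<le> ennreal (mass f UNIV)" .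
  then have "ennreal (1/l) * (ennreal l * emeasure lebesgue {x. l < cmod (f x)}) \<le> ennreal (1/l) * ennreal (mass f UNIV)"
    by (rule mult_left_mono) simp
  moreover have "ennreal (1/l) * (ennreal l * emeasure lebesgue {x. l < cmod (f x)}) = emeasure lebesgue {x. l < cmod (f x)}"
    using assms(2) by (simp add: mult.assoc[symmetric] ennreal_mult[symmetric] del: emeasure_completion)
  ultimately have e: "emeasure lebesgue {x. l < cmod (f x)} \<le> ennreal (mass f UNIV / l)"
    using assms(2) by (simp add: ennreal_mult[symmetric] del: emeasure_completion)
  with s show "{x. l < cmod (f x)} \<in> lmeasurable"
    by (intro fmeasurableI) (auto intro: le_less_trans simp del: emeasure_completion)
  show "vol {x. l < cmod (f x)} \<le> mass f UNIV / l"
    unfolding measure_def[of lebesgue] using e assms(2) by (intro enn2real_leI) auto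
qed

text \<open>In place of Lebesgue's differentiation theorem, an exceptional set is enclosed in an open set of almost the same measure:
  small dyadic cubes around a point of an open set lie entirely inside it.\<close>

lemma measure_superset_open:
  assumes "E \<in> lmeasurable" "e > 0"
  obtains U where "open U" "E \<subseteq> U" "U \<in> lmeasurable" "vol U \<le> vol E + e"
proof -
  obtain U where U: "open U" "E \<subseteq> U" "(U - E) \<in> lmeasurable" "emeasure lebesgue (U - E) < ennreal e"
    using sets_lebesgue_outer_open[OF fmeasurableD[OF assms(1)] assms(2)] by blast
  have Ueq: "U = E \<union> (U - E)" using U by blast
  have "U \<in> lmeasurable" using fmeasurable.Un[OF assms(1) U(3)] Ueq by simp
  moreover have "vol U \<le> vol E + vol (U - E)"
    using measure_Un_le[of E lebesgue "U - E"] assms(1) U(3) Ueq by (metis fmeasurableD)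
  moreover have "vol (U - E) \<le> e"
    unfolding measure_def using U(4) assms(2) by (intro enn2real_leI) (auto intro: less_imp_le)
  ultimately show ?thesis using U by (intro that[of U]) auto
qed

text \<open>The cubes are stopped when the average of \<open>|f0|\<close> exceeds the height \<open>l\<close>, or when half of the cube is covered by an open
  set containing \<open>{|f0| > l}\<close>. The second condition guarantees \<open>|f0| \<le> l\<close> at every point outside the stopping cubes.
  Only finitely many of the cubes contribute a bad part \<open>b P\<close>; on the others \<open>f0\<close> stays in the good part \<open>g\<close>, where its
  square has small integral. Thus the bad part is a finite sum and \<open>T\<close> may be applied term by term.\<close>

lemma calderon_zygmund_decomposition:
  fixes f0 :: "real^'d \<Rightarrow> complex"
  assumes L: "L > 0" and f0: "nice f0" and supp: "\<And>x. f0 x \<noteq> 0 \<Longrightarrow> x \<in> dil a L k m"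
    and l: "l > 0" and N0: "mass f0 UNIV > 0" and small: "4 * mass f0 UNIV \<le> l * vol (cell a L k m)"
  obtains F :: "(nat \<times> (int^'d)) set" and g b where
    "finite F" "nice g" "\<And>P. P \<in> F \<Longrightarrow> nice (b P)" "f0 = (\<lambda>x. g x + (\<Sum>P\<in>F. b P x))"
    "\<And>P. P \<in> F \<Longrightarrow> \<exists>n m'. P = (k+n, m') \<and> cell a L k m \<subseteq> dil a L k (anc n m')"
    "\<And>P x. P \<in> F \<Longrightarrow> b P x \<noteq> 0 \<Longrightarrow> x \<in> pcell a L P"
    "\<And>P. P \<in> F \<Longrightarrow> (LINT x|lebesgue. b P x) = 0"
    "(\<Sum>P\<in>F. LINT x|lebesgue. cmod (b P x)) \<le> 2 * mass f0 UNIV"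
    "(LINT x|lebesgue. (cmod (g x))\<^sup>2) \<le> (2 + 2^CARD('d)) * l * mass f0 UNIV"
    "(\<Sum>P\<in>F. vol (pcell a L P)) \<le> 5 * mass f0 UNIV / l"
proof -
  let ?N = "mass f0 UNIV" and ?X = "\<lambda>P. pcell a L P"
  define v where "v = vol (cell a L k m)"
  have v: "vol (cell a L k m') = v" "v > 0" for m'
    using measure_cell_pos[OF L, of a k m] by (auto simp: v_def measure_cell[OF L])
  obtain U where U: "open U" "{x. l < cmod (f0 x)} \<subseteq> U" "U \<in> lmeasurable"
      "vol U \<le> vol {x. l < cmod (f0 x)} + ?N / l"
    using measure_superset_open[OF nice_mass_superlevel(1)[OF f0 l]] N0 l by (metis divide_pos_pos)
  define V where "V = U \<inter> dil a L k m"
  have Vm: "V \<in> lmeasurable" unfolding V_def using U(3) L by (intro fmeasurable.Int) auto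
  have "vol V \<le> vol U" using U(3) Vm by (intro measure_mono_fmeasurable) (auto simp: V_def)
  also have "\<dots> \<le> 2 * ?N / l" using U(4) nice_mass_superlevel(2)[OF f0 l] by (simp add: field_simps)
  finally have V2: "vol V \<le> 2 * ?N / l" .
  have Vhalf: "vol V \<le> v / 2"
  proof -
    have "2 * ?N / l \<le> v / 2" using small l by (simp add: v_def field_simps)
    with V2 show ?thesis by simp
  qed
  define bad where "bad k' m' \<longleftrightarrow> l * vol (cell a L k' m') < mass f0 (cell a L k' m') \<or>
     vol (cell a L k' m') / 2 < vol (V \<inter> cell a L k' m')" for k' m'
  define J where "J = stopping_cubes k bad"
  have cs: "?X P \<in> sets lebesgue" for P using L by simp
  have VX: "V \<inter> ?X P \<in> lmeasurable" for P using Vm cs by (metis fmeasurable_Int_fmeasurable)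
  \<comment> \<open>The stopping process starts below the height: the whole mass of \<open>f0\<close> is at most \<open>l/4\<close> times the volume of one initial cube.\<close>
  have not_bad: "\<not> bad k m'" for m'
  proof -
    have "mass f0 (cell a L k m') \<le> ?N" using f0 by (intro mass_mono) auto
    also have "\<dots> \<le> l * v" using small N0 by (simp add: v_def)
    finally have 1: "mass f0 (cell a L k m') \<le> l * v" .
    have "vol (V \<inter> cell a L k m') \<le> vol V" using Vm L by (intro measure_mono_fmeasurable) (auto intro!: sets.Int fmeasurableD)
    with 1 Vhalf show ?thesis by (simp add: bad_def v)
  qed
  have bad_meets: "cell a L k' m' \<inter> dil a L k m \<noteq> {}" if "bad k' m'" for k' m'
  proof
    assume e: "cell a L k' m' \<inter> dil a L k m = {}"
    then have c: "cut (cell a L k' m') f0 = (\<lambda>_. 0)" using supp by (fastforce simp: cut_def fun_eq_iff)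
    have "mass f0 (cell a L k' m') = mass (cut (cell a L k' m') f0) UNIV"
      using mass_cut[OF f0, of "cell a L k' m'" UNIV] L by simp
    also have "\<dots> = 0" using c by (simp add: mass_eq_integral nice_zero)
    finally have "mass f0 (cell a L k' m') = 0" .
    moreover have "V \<inter> cell a L k' m' = {}" using e by (auto simp: V_def)
    ultimately show False using that l measure_cell_pos[OF L, of a k' m'] by (simp add: bad_def mult_less_0_iff)
  qed
  have JE: "\<exists>n m'. P = (k + Suc n, m') \<and> bad (k + Suc n) m' \<and> \<not> bad (k + n) (anc 1 m') \<and>
      cell a L k m \<subseteq> dil a L k (anc (Suc n) m')" if PJ: "P \<in> J" for P
  proof -
    from PJ obtain n m' where P: "P = (k + n, m')" "bad (k + n) m'" "\<And>j. j < n \<Longrightarrow> \<not> bad (k + j) (anc (n - j) m')"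
      unfolding J_def by (rule stopping_cubesE) blast
    have "n \<noteq> 0" using P(2) not_bad by (metis add.right_neutral)
    then obtain n' where n': "n = Suc n'" using not0_implies_Suc by blast
    obtain x where x: "x \<in> cell a L (k+n) m'" "x \<in> dil a L k m" using bad_meets[OF P(2)] by blast
    have "idx a L k x = anc n m'" using x(1) cell_subset_anc[OF L, of a k n m'] by (auto simp: cell_def)
    then have "cell a L k m \<subseteq> dil a L k (anc n m')"
      using x(2) by (auto simp: cell_def dil_def abs_minus_commute)
    with P n' P(3)[of n'] show ?thesis by auto
  qed
  have disj: "disjoint_family_on ?X J" unfolding J_def by (rule stopping_cubes_disjoint_family[OF L])
  have avg: "mass f0 (?X P) \<le> 2^CARD('d) * l * vol (?X P)" if PJ: "P \<in> J" for P
  proof -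
    obtain n m' where P: "P = (k + Suc n, m')" "\<not> bad (k + n) (anc 1 m')" using JE[OF PJ] by blast
    have "?X P \<subseteq> cell a L (k+n) (anc 1 m')" using cell_subset_anc[OF L, of a "k+n" 1 m'] P by simp
    then have "mass f0 (?X P) \<le> mass f0 (cell a L (k+n) (anc 1 m'))" using L by (intro mass_mono[OF f0]) auto
    also have "\<dots> \<le> l * vol (cell a L (k+n) (anc 1 m'))" using P(2) by (simp add: bad_def)
    also have "vol (cell a L (k+n) (anc 1 m')) = 2^CARD('d) * vol (?X P)"
      using measure_cell_anc[OF L, of a "k+n" "anc 1 m'" 1 m'] P by simp
    finally show ?thesis by (simp add: mult_ac)
  qed
  let ?f2 = "\<lambda>x. complex_of_real ((cmod (f0 x))\<^sup>2)"
  have f2: "nice ?f2" by (rule nice_sq[OF f0])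
  obtain F where F: "finite F" "F \<subseteq> J" "mass ?f2 ((\<Union>P\<in>J. ?X P) - (\<Union>P\<in>F. ?X P)) < l * ?N"
  proof (rule finite_subfamily_tail[OF finite_mass_measure[OF f2], of J ?X "l * ?N"])
    show "?X P \<in> sets (mass_measure ?f2)" for P using cs[of P] by (simp only: sets_mass_measure)
    show "0 < l * ?N" using l N0 by simp
  qed
  \<comment> \<open>The stopped region that remains in the good part.\<close>
  define R where "R = (\<Union>P\<in>J. ?X P) - (\<Union>P\<in>F. ?X P)"
  have Rs: "R \<in> sets lebesgue" unfolding R_def using cs F
    by (intro sets.Diff sets.countable_UN') auto
  have outside: "cmod (f0 x) \<le> l" if "x \<notin> (\<Union>P\<in>J. ?X P)" for x
  proof (rule ccontr)
    assume *: "\<not> cmod (f0 x) \<le> l"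
    then have "f0 x \<noteq> 0" using l by auto
    then have xd: "x \<in> dil a L k m" by (rule supp)
    have "x \<in> U" using * U by auto
    then obtain n where n: "cell a L (k+n) (idx a L (k+n) x) \<subseteq> U" using small_cell_in_open[OF L U(1)] by metis
    have "cell a L (k+n) (idx a L (k+n) x) \<subseteq> dil a L k m"
    proof
      fix y assume "y \<in> cell a L (k+n) (idx a L (k+n) x)"
      then have "idx a L k y = idx a L k x"
        using anc_idx[OF L, of n a k x] anc_idx[OF L, of n a k y] by (simp add: cell_def)
      then show "y \<in> dil a L k m" using xd by (simp add: dil_def)
    qed
    with n have "V \<inter> cell a L (k+n) (idx a L (k+n) x) = cell a L (k+n) (idx a L (k+n) x)" by (auto simp: V_def)
    then have "bad (k+n) (idx a L (k+n) x)"
      using measure_cell_pos[OF L, of a "k+n" "idx a L (k+n) x"] by (simp add: bad_def)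
    then have "\<exists>P\<in>stopping_cubes k bad. x \<in> ?X P"
      using stopping_cubes_covers[where bad = bad and k' = "k+n" and m = "idx a L (k+n) x" and k = k and x = x and a = a, OF L]
      by (metis cell_idx le_add1)
    with that show False unfolding J_def by auto
  qed
  define c where "c P = (LINT x|lebesgue. cut (?X P) f0 x) / vol (?X P)" for P
  define b where "b P x = cut (?X P) f0 x - c P * indicator (?X P) x" for P x
  define g where "g x = f0 x - (\<Sum>P\<in>F. b P x)" for x
  have nb: "nice (b P)" for P
  proof -
    have "nice (\<lambda>x. cut (?X P) f0 x + (- c P) * indicator (?X P) x)"
      by (intro nice_add nice_cut f0 cs nice_indicator_cell L)
    moreover have "b P = (\<lambda>x. cut (?X P) f0 x + (- c P) * indicator (?X P) x)" by (simp add: b_def fun_eq_iff)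
    ultimately show ?thesis by simp
  qed
  have ng: "nice g"
  proof -
    have "nice (\<lambda>x. f0 x + (-1) * (\<Sum>P\<in>F. b P x))" by (intro nice_add nice_scale nice_sum nb f0)
    then show ?thesis by (simp add: g_def[abs_def])
  qed
  have muX: "vol (?X P) > 0" for P by (rule measure_cell_pos[OF L])
  have cP: "cmod (c P) \<le> mass f0 (?X P) / vol (?X P)" for P
    unfolding c_def using nice_mean_bound[OF f0 cs[of P]] muX[of P]
    by (simp add: norm_divide divide_right_mono less_imp_le)
  have indi: "integrable lebesgue (\<lambda>x. indicator (?X P) x :: complex)" "(LINT x|lebesgue. indicator (?X P) x :: complex) = vol (?X P)"
     "integrable lebesgue (\<lambda>x. indicator (?X P) x :: real)" "(LINT x|lebesgue. indicator (?X P) x :: real) = vol (?X P)"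
     for P
  proof -
    have "?X P \<in> lmeasurable" using L by simp
    then show i: "integrable lebesgue (\<lambda>x. indicator (?X P) x :: real)"
      by (simp add: integrable_indicator_iff fmeasurable_def del: emeasure_completion)
    show r: "(LINT x|lebesgue. indicator (?X P) x :: real) = vol (?X P)" using L by simp
    have e: "(\<lambda>x. indicator (?X P) x :: complex) = (\<lambda>x. complex_of_real (indicator (?X P) x))"
      by (auto simp: indicator_def)
    show "integrable lebesgue (\<lambda>x. indicator (?X P) x :: complex)"
      unfolding e using i by (rule integrable_of_real)
    show "(LINT x|lebesgue. indicator (?X P) x :: complex) = vol (?X P)"
      unfolding e integral_complex_of_real r ..
  qed
  have ic: "integrable lebesgue (cut (?X P) f0)" "integrable lebesgue (\<lambda>x. cmod (cut (?X P) f0 x))" for P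
    using nice_integrable[OF nice_cut[OF f0 cs[of P]]] by auto
  have mean: "(LINT x|lebesgue. b P x) = 0" for P
  proof -
    have "(LINT x|lebesgue. b P x) = (LINT x|lebesgue. cut (?X P) f0 x) - c P * vol (?X P)"
      unfolding b_def using ic indi by (subst Bochner_Integration.integral_diff) auto
    also have "\<dots> = 0" using muX[of P] by (simp add: c_def)
    finally show ?thesis .
  qed
  have massX: "(LINT x|lebesgue. cmod (cut (?X P) f0 x)) = mass f0 (?X P)" for P
  proof -
    have "(\<lambda>x. cmod (cut (?X P) f0 x)) = (\<lambda>x. indicator (?X P) x * cmod (f0 x))" by (auto simp: cut_def)
    then show ?thesis using mass_eq_integral[OF f0 cs[of P]] by simp
  qed
  have b1: "(LINT x|lebesgue. cmod (b P x)) \<le> 2 * mass f0 (?X P)" for P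
  proof -
    have "(LINT x|lebesgue. cmod (b P x)) \<le> (LINT x|lebesgue. cmod (cut (?X P) f0 x) + cmod (c P) * indicator (?X P) x)"
    proof (rule integral_mono)
      show "integrable lebesgue (\<lambda>x. cmod (cut (?X P) f0 x) + cmod (c P) * indicator (?X P) x)"
        using ic indi by (intro Bochner_Integration.integrable_add integrable_mult_right)
      fix x show "cmod (b P x) \<le> cmod (cut (?X P) f0 x) + cmod (c P) * indicator (?X P) x"
        unfolding b_def by (rule order_trans[OF norm_triangle_ineq4]) (simp add: norm_mult indicator_def)
    qed (rule nice_integrable(2)[OF nb])
    also have "\<dots> = mass f0 (?X P) + cmod (c P) * vol (?X P)"
      using ic indi massX by (subst Bochner_Integration.integral_add) auto
    also have "cmod (c P) * vol (?X P) \<le> mass f0 (?X P)"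
      using cP[of P] muX[of P] by (simp add: pos_le_divide_eq)
    finally show ?thesis by simp
  qed
  have disjF: "disjoint_family_on ?X F" using disj F(2) by (meson disjoint_family_on_mono)
  have sumF: "(\<Sum>P\<in>F. mass f0 (?X P)) \<le> ?N" by (rule mass_finite_Union[OF f0 F(1) cs disjF])
  have b_sum: "(\<Sum>P\<in>F. LINT x|lebesgue. cmod (b P x)) \<le> 2 * ?N"
  proof -
    have "(\<Sum>P\<in>F. LINT x|lebesgue. cmod (b P x)) \<le> (\<Sum>P\<in>F. 2 * mass f0 (?X P))" by (intro sum_mono b1)
    also have "\<dots> \<le> 2 * ?N" using sumF by (simp add: sum_distrib_left[symmetric])
    finally show ?thesis .
  qed
  have size: "(\<Sum>P\<in>F. vol (?X P)) \<le> 5 * ?N / l"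
  proof -
    have "vol (?X P) \<le> mass f0 (?X P) / l + 2 * vol (V \<inter> ?X P)" if "P \<in> F" for P
    proof -
      have "P \<in> J" using that F(2) by blast
      then obtain n m' where P: "P = (k + Suc n, m')" "bad (k + Suc n) m'" using JE by blast
      have "l * vol (?X P) < mass f0 (?X P) \<or> vol (?X P) / 2 < vol (V \<inter> ?X P)"
        using P by (simp add: bad_def)
      then show ?thesis
      proof
        assume "l * vol (?X P) < mass f0 (?X P)"
        then have "vol (?X P) \<le> mass f0 (?X P) / l" using l by (simp add: pos_le_divide_eq mult.commute)
        then show ?thesis using measure_nonneg[of lebesgue "V \<inter> ?X P"] by linarith
      next
        assume "vol (?X P) / 2 < vol (V \<inter> ?X P)"
        moreover have "0 \<le> mass f0 (?X P) / l" using l by simp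
        ultimately show ?thesis by linarith
      qed
    qed
    then have "(\<Sum>P\<in>F. vol (?X P)) \<le> (\<Sum>P\<in>F. mass f0 (?X P) / l + 2 * vol (V \<inter> ?X P))" by (rule sum_mono)
    also have "\<dots> = (\<Sum>P\<in>F. mass f0 (?X P)) / l + 2 * (\<Sum>P\<in>F. vol (V \<inter> ?X P))"
      by (simp add: sum.distrib sum_divide_distrib sum_distrib_left)
    also have "(\<Sum>P\<in>F. vol (V \<inter> ?X P)) = vol (\<Union>P\<in>F. V \<inter> ?X P)"
    proof (rule measure_finite_Union[symmetric])
      show "disjoint_family_on (\<lambda>P. V \<inter> ?X P) F" using disjF unfolding disjoint_family_on_def by blast
      show "(\<lambda>P. V \<inter> ?X P) ` F \<subseteq> sets lebesgue" using VX fmeasurableD by blast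
      show "emeasure lebesgue (V \<inter> ?X P) \<noteq> \<infinity>" for P
        using VX[of P] unfolding fmeasurable_def by auto
    qed (rule F(1))
    also have "\<dots> \<le> vol V"
    proof (rule measure_mono_fmeasurable[OF _ _ Vm])
      show "(\<Union>P\<in>F. V \<inter> ?X P) \<in> sets lebesgue" using F(1) VX fmeasurableD by (intro sets.finite_UN) blast+
    qed auto
    also have "(\<Sum>P\<in>F. mass f0 (?X P)) / l \<le> ?N / l" using sumF l by (intro divide_right_mono) auto
    finally show ?thesis using V2 by (simp add: field_simps)
  qed
  have g2: "(LINT x|lebesgue. (cmod (g x))\<^sup>2) \<le> (2 + 2^CARD('d)) * l * ?N"
  proof -
    \<comment> \<open>The three summands majorise \<open>|g|\<^sup>2\<close> outside all stopping cubes, on the stopped region left in the good part, and on the selected cubes, where \<open>g\<close> is the average of \<open>f0\<close>.\<close>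
    let ?u = "\<lambda>x. l * cmod (f0 x) + indicator R x * cmod (?f2 x) +
      (\<Sum>P\<in>F. 2^CARD('d) * l * (mass f0 (?X P) / vol (?X P)) * indicator (?X P) x)"
    have iR: "integrable lebesgue (\<lambda>x. indicator R x * cmod (?f2 x))"
      using nice_integrable(2)[OF f2] Rs by (intro Bochner_Integration.integrable_bound[OF nice_integrable(2)[OF f2]])
        (auto simp: indicator_def intro!: borel_measurable_times borel_measurable_indicator)
    have iS: "integrable lebesgue (\<lambda>x. \<Sum>P\<in>F. 2^CARD('d) * l * (mass f0 (?X P) / vol (?X P)) * indicator (?X P) x)"
      using indi by (intro Bochner_Integration.integrable_sum integrable_mult_right)
    have pw: "(cmod (g x))\<^sup>2 \<le> ?u x" for x
    proof -
      have S0: "0 \<le> (\<Sum>P\<in>F. 2^CARD('d) * l * (mass f0 (?X P) / vol (?X P)) * indicator (?X P) x)"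
        using l by (intro sum_nonneg mult_nonneg_nonneg divide_nonneg_nonneg) auto
      have R0: "0 \<le> indicator R x * cmod (?f2 x)" by simp
      have f00: "0 \<le> l * cmod (f0 x)" using l by simp
      show ?thesis
      proof (cases "\<exists>P\<in>F. x \<in> ?X P")
        case True
        then obtain P where P: "P \<in> F" "x \<in> ?X P" by blast
        have others: "x \<notin> ?X P'" if "P' \<in> F" "P' \<noteq> P" for P'
          using disjF that P unfolding disjoint_family_on_def by blast
        have "(\<Sum>P'\<in>F - {P}. b P' x) = 0"
          using others by (intro sum.neutral) (auto simp: b_def cut_def)
        then have "(\<Sum>P\<in>F. b P x) = b P x" by (simp add: sum.remove[OF F(1) P(1)])
        then have "g x = c P" using P by (simp add: g_def b_def cut_def)
        then have "(cmod (g x))\<^sup>2 = cmod (c P) * cmod (c P)" by (simp add: power2_eq_square)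
        also have "\<dots> \<le> (2^CARD('d) * l) * (mass f0 (?X P) / vol (?X P))"
        proof (rule mult_mono)
          have "mass f0 (?X P) / vol (?X P) \<le> 2^CARD('d) * l"
            using avg[of P] P F(2) muX[of P] by (auto simp: pos_divide_le_eq)
          with cP[of P] show "cmod (c P) \<le> 2^CARD('d) * l" by linarith
        qed (use cP l in auto)
        also have "\<dots> = (2^CARD('d) * l) * (mass f0 (?X P) / vol (?X P)) * indicator (?X P) x" using P by simp
        also have "\<dots> \<le> (\<Sum>P\<in>F. 2^CARD('d) * l * (mass f0 (?X P) / vol (?X P)) * indicator (?X P) x)"
          using l by (intro member_le_sum[OF P(1)] F(1) mult_nonneg_nonneg divide_nonneg_nonneg) auto
        finally show ?thesis using R0 f00 by linarith
      next
        case False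
        then have "(\<Sum>P\<in>F. b P x) = 0" by (intro sum.neutral) (auto simp: b_def cut_def)
        then have gx: "g x = f0 x" by (simp add: g_def)
        show ?thesis
        proof (cases "x \<in> (\<Union>P\<in>J. ?X P)")
          case True
          then have "x \<in> R" using False by (auto simp: R_def)
          then have "(cmod (g x))\<^sup>2 = indicator R x * cmod (?f2 x)" by (simp add: gx norm_power)
          then show ?thesis using S0 f00 by linarith
        next
          case False
          from outside[OF this] have "(cmod (g x))\<^sup>2 \<le> l * cmod (f0 x)"
            unfolding gx power2_eq_square by (rule mult_right_mono) simp
          then show ?thesis using S0 R0 by linarith
        qed
      qed
    qed
    have "(LINT x|lebesgue. (cmod (g x))\<^sup>2) \<le> (LINT x|lebesgue. ?u x)"
      using nice_integrable(3)[OF ng] iR iS nice_integrable(2)[OF f0] pw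
      by (intro integral_mono Bochner_Integration.integrable_add integrable_mult_right)
    also have "\<dots> = l * (LINT x|lebesgue. cmod (f0 x)) + (LINT x|lebesgue. indicator R x * cmod (?f2 x))
       + (\<Sum>P\<in>F. LINT x|lebesgue. 2^CARD('d) * l * (mass f0 (?X P) / vol (?X P)) * indicator (?X P) x)"
      using iR iS nice_integrable(2)[OF f0] indi
      by (subst Bochner_Integration.integral_add) (auto simp del: norm_of_real intro!: Bochner_Integration.integral_sum)
    also have "(LINT x|lebesgue. cmod (f0 x)) = ?N" using mass_eq_integral[OF f0, of UNIV] by simp
    also have "(LINT x|lebesgue. indicator R x * cmod (?f2 x)) = mass ?f2 R"
      using mass_eq_integral[OF f2 Rs] by simp
    also have "(\<Sum>P\<in>F. LINT x|lebesgue. 2^CARD('d) * l * (mass f0 (?X P) / vol (?X P)) * indicator (?X P) x)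
       = 2^CARD('d) * l * (\<Sum>P\<in>F. mass f0 (?X P))"
      unfolding sum_distrib_left
    proof (intro sum.cong refl)
      fix P
      have "(LINT x|lebesgue. 2^CARD('d) * l * (mass f0 (?X P) / vol (?X P)) * indicator (?X P) x)
        = 2^CARD('d) * l * (mass f0 (?X P) / vol (?X P)) * vol (?X P)"
        by (simp only: integral_mult_right_zero indi)
      also have "\<dots> = 2^CARD('d) * l * mass f0 (?X P)" using muX[of P] by simp
      finally show "(LINT x|lebesgue. 2^CARD('d) * l * (mass f0 (?X P) / vol (?X P)) * indicator (?X P) x) = 2^CARD('d) * l * mass f0 (?X P)" .
    qed
    also have "2^CARD('d) * l * (\<Sum>P\<in>F. mass f0 (?X P)) \<le> 2^CARD('d) * l * ?N"
      using sumF l by (intro mult_left_mono) auto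
    finally show ?thesis using F(3) by (simp add: R_def algebra_simps)
  qed
  show ?thesis
  proof (rule that[of F g b])
    show "f0 = (\<lambda>x. g x + (\<Sum>P\<in>F. b P x))" by (simp add: g_def)
    show "\<exists>n m'. P = (k+n, m') \<and> cell a L k m \<subseteq> dil a L k (anc n m')" if "P \<in> F" for P
    proof -
      have "P \<in> J" using that F(2) by blast
      then show ?thesis using JE by blast
    qed
    show "x \<in> ?X P" if "b P x \<noteq> 0" for P x using that by (auto simp: b_def cut_def indicator_def split: if_splits)
  qed (use F(1) ng nb mean b_sum g2 size in auto)
qed

section \<open>The local weak-type estimate\<close>

lemma lmeasure_mono_AE:
  assumes "S' \<in> lmeasurable" "AE x in lebesgue. x \<in> S \<longrightarrow> x \<in> S'"
  shows "vol S \<le> vol S'"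
proof -
  have "emeasure lebesgue S \<le> emeasure lebesgue S'"
    using assms by (intro emeasure_mono_AE) (auto dest: fmeasurableD)
  moreover have "emeasure lebesgue S' < \<infinity>" using assms(1) unfolding fmeasurable_def by blast
  ultimately show ?thesis unfolding measure_def by (intro enn2real_mono) (simp_all del: emeasure_completion)
qed

lemma lebesgue_Markov:
  fixes u :: "'a::euclidean_space \<Rightarrow> real"
  assumes "integrable lebesgue u" "\<And>x. 0 \<le> u x" "c > 0"
  shows "{x. c \<le> u x} \<in> lmeasurable" "vol {x. c \<le> u x} \<le> (LINT x|lebesgue. u x) / c"
proof -
  have [measurable]: "u \<in> borel_measurable lebesgue" using assms(1) by auto
  have "{x \<in> space lebesgue. c \<le> u x} \<in> sets lebesgue" by measurable
  then have s: "{x. c \<le> u x} \<in> sets lebesgue" by simp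
  have "emeasure lebesgue {x \<in> space lebesgue. c \<le> u x} \<le> ennreal (1 / c * (LINT x|lebesgue. u x))"
    using assms by (intro integral_Markov_inequality) auto
  then have e: "emeasure lebesgue {x. c \<le> u x} \<le> ennreal (1 / c * (LINT x|lebesgue. u x))" by simp
  with s show "{x. c \<le> u x} \<in> lmeasurable"
    by (intro fmeasurableI) (auto intro: le_less_trans simp del: emeasure_completion)
  have "0 \<le> (LINT x|lebesgue. u x)" using assms(2) by (simp add: integral_nonneg_AE)
  then show "vol {x. c \<le> u x} \<le> (LINT x|lebesgue. u x) / c"
    unfolding measure_def[of lebesgue] using e assms(3) by (intro enn2real_leI) auto
qed

lemma AE_eq_0_of_integral_sq:
  fixes f :: "'a \<Rightarrow> complex"
  assumes "f \<in> borel_measurable M" "integrable M (\<lambda>x. (cmod (f x))\<^sup>2)" "(LINT x|M. (cmod (f x))\<^sup>2) \<le> 0"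
  shows "AE x in M. f x = 0"
proof -
  have "(LINT x|M. (cmod (f x))\<^sup>2) = 0" using assms(3) by (intro antisym) (auto simp: integral_nonneg_AE)
  then have "AE x in M. (cmod (f x))\<^sup>2 = 0"
    using integral_nonneg_eq_0_iff_AE[OF assms(2)] by auto
  then show ?thesis by (rule AE_mp) auto
qed

lemma mass_0_AE:
  assumes "nice f" "mass f UNIV = 0"
  shows "AE x in lebesgue. f x = 0"
proof -
  have "(LINT x|lebesgue. cmod (f x)) = 0" using mass_eq_integral[OF assms(1), of UNIV] assms(2) by simp
  then have "AE x in lebesgue. cmod (f x) = 0"
    using integral_nonneg_eq_0_iff_AE[OF nice_integrable(2)[OF assms(1)]] by auto
  then show ?thesis by (rule AE_mp) auto
qed

context calderon_zygmund
begin

lemma T_null: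
  assumes "nice f" "mass f UNIV = 0"
  shows "AE x in lebesgue. T f x = 0"
proof (rule AE_eq_0_of_integral_sq)
  have "(LINT x|lebesgue. (cmod (f x))\<^sup>2) = 0"
    by (rule integral_eq_zero_AE, rule AE_mp[OF mass_0_AE[OF assms]]) auto
  then show "(LINT x|lebesgue. (cmod (T f x))\<^sup>2) \<le> 0" using T_bound[OF nice_L2[OF assms(1)]] by simp
qed (use assms T_measurable T_sq_integrable in auto)

lemma T_sum:
  assumes "finite F" "nice g" "\<And>P. P \<in> F \<Longrightarrow> nice (b P)"
  shows "AE x in lebesgue. T (\<lambda>x. g x + (\<Sum>P\<in>F. b P x)) x = T g x + (\<Sum>P\<in>F. T (b P) x)"
  using assms(1,3)
proof (induction F)
  case empty
  then show ?case by simp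
next
  case (insert P F)
  let ?h = "\<lambda>x. g x + (\<Sum>P\<in>F. b P x)"
  have n: "nice ?h" "nice (b P)" using insert.prems assms(2) by (auto intro!: nice_add nice_sum)
  have eq: "(\<lambda>x. g x + (\<Sum>P\<in>insert P F. b P x)) = (\<lambda>x. ?h x + b P x)"
    using insert.hyps by (auto simp: fun_eq_iff algebra_simps)
  have "AE x in lebesgue. T (\<lambda>x. ?h x + b P x) x = T ?h x + T (b P) x"
    using n by (intro T_add nice_L2)
  moreover have "AE x in lebesgue. T ?h x = T g x + (\<Sum>P\<in>F. T (b P) x)" using insert by auto
  ultimately show ?case unfolding eq
    by eventually_elim (use insert.hyps in \<open>simp add: algebra_simps\<close>)
qed

text \<open>Decompose at height \<open>Bc\<close> times the average. The good part is estimated in \<open>L\<^sup>2\<close>, the dilates of the selected cubes are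
  removed, and outside them \<open>bad_part_pointwise\<close> gives an integrable bound. The three terms of the constant come from
  these three contributions.\<close>

lemma local_weak_type_fixed_height:
  fixes a :: "real^'d" and m :: "int^'d"
  defines "Al \<equiv> (4 * real CARD('d) + 3)^CARD('d)"
  assumes L: "L > 0" and f0: "nice f0" and supp: "\<And>x. f0 x \<noteq> 0 \<Longrightarrow> x \<in> dil a L k m"
    and N0: "mass f0 UNIV > 0" and Bc: "4 * Al \<le> Bc" and A: "A \<ge> 1"
  defines "t \<equiv> mass f0 UNIV / vol (dil a L k m)"
  shows "vol {x \<in> cell a L k m. A * t < cmod (T f0 x)}
     \<le> (4 * B * (2 + 2^CARD('d)) * Bc * Al / A + 5 * Al\<^sup>2 / Bc + 4 * chain_const / (1 - decay) * Al / A) * vol (cell a L k m)"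
proof -
  let ?N = "mass f0 UNIV" and ?X = "\<lambda>P. pcell a L P"
  define v where "v = vol (cell a L k m)"
  have v: "v > 0" using measure_cell_pos[OF L] by (simp add: v_def)
  have Al1: "Al \<ge> 1" unfolding Al_def by (intro one_le_power) simp
  have tN: "t = ?N / (Al * v)" unfolding t_def v_def Al_def measure_dil_cell[OF L] ..
  have t: "t > 0" unfolding tN using N0 v Al1 by simp
  have Nt: "?N = t * (Al * v)" unfolding tN using v Al1 by simp
  define l where "l = Bc * t"
  have Bc0: "Bc > 0" using Bc Al1 by linarith
  have l: "l > 0" using t Bc0 by (simp add: l_def)
  have "4 * ?N \<le> l * v"
  proof -
    have "(4 * Al) * (t * v) \<le> Bc * (t * v)" using Bc t v by (intro mult_right_mono) auto
    then show ?thesis unfolding Nt l_def by (simp add: mult_ac)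
  qed
  then have small: "4 * mass f0 UNIV \<le> l * vol (cell a L k m)" by (simp add: v_def)
  obtain F :: "(nat \<times> (int^'d)) set" and g b where
    F: "finite F" and g: "nice g" and b: "\<And>P. P \<in> F \<Longrightarrow> nice (b P)" and eq: "f0 = (\<lambda>x. g x + (\<Sum>P\<in>F. b P x))"
    and loc: "\<And>P. P \<in> F \<Longrightarrow> \<exists>n m'. P = (k+n, m') \<and> cell a L k m \<subseteq> dil a L k (anc n m')"
    and bs: "\<And>P x. P \<in> F \<Longrightarrow> b P x \<noteq> 0 \<Longrightarrow> x \<in> pcell a L P"
    and mean: "\<And>P. P \<in> F \<Longrightarrow> (LINT x|lebesgue. b P x) = 0"
    and b1: "(\<Sum>P\<in>F. LINT x|lebesgue. cmod (b P x)) \<le> 2 * mass f0 UNIV"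
    and g2: "(LINT x|lebesgue. (cmod (g x))\<^sup>2) \<le> (2 + 2^CARD('d)) * l * mass f0 UNIV"
    and size: "(\<Sum>P\<in>F. vol (pcell a L P)) \<le> 5 * mass f0 UNIV / l"
    using calderon_zygmund_decomposition[OF L f0 supp l N0 small] by blast
  \<comment> \<open>The level \<open>A t\<close> is split evenly between the good and the bad part; \<open>S2\<close> is the removed set.\<close>
  define S1 where "S1 = {x. (A * t / 2)\<^sup>2 \<le> (cmod (T g x))\<^sup>2}"
  define S2 where "S2 = (\<Union>P\<in>F. pdil a L P)"
  define u where "u x = (\<Sum>P\<in>F. (LINT y|lebesgue. cmod (b P y)) * (chain_const * chain_kernel a L k (fst P - k) (snd P) x))" for x
  define S3 where "S3 = {x. A * t / 2 \<le> u x}"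
  have At: "A * t / 2 > 0" using A t by simp
  have S1: "S1 \<in> lmeasurable" "vol S1 \<le> (LINT x|lebesgue. (cmod (T g x))\<^sup>2) / (A * t / 2)\<^sup>2"
  proof -
    have At2: "(A * t / 2)\<^sup>2 > 0" using At by (rule zero_less_power)
    show "S1 \<in> lmeasurable" unfolding S1_def
      by (rule lebesgue_Markov(1)[OF T_sq_integrable[OF g] _ At2]) simp
    show "vol S1 \<le> (LINT x|lebesgue. (cmod (T g x))\<^sup>2) / (A * t / 2)\<^sup>2" unfolding S1_def
      by (rule lebesgue_Markov(2)[OF T_sq_integrable[OF g] _ At2]) simp
  qed
  have S2: "S2 \<in> lmeasurable" unfolding S2_def using F L by (intro fmeasurable.finite_UN) auto
  have iu: "integrable lebesgue u" unfolding u_def[abs_def]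
    using chain_kernel_integral(1)[OF L] by (intro Bochner_Integration.integrable_sum integrable_mult_right) auto
  have u0: "0 \<le> u x" for x unfolding u_def using chain_const chain_kernel_nonneg
    by (intro sum_nonneg mult_nonneg_nonneg integral_nonneg_AE) auto
  have S3: "S3 \<in> lmeasurable" "vol S3 \<le> (LINT x|lebesgue. u x) / (A * t / 2)"
    unfolding S3_def by (rule lebesgue_Markov[OF iu u0 At])+
  have bb: "AE x in lebesgue. \<forall>P\<in>F. x \<in> cell a L k m - S2 \<longrightarrow>
     cmod (T (b P) x) \<le> (LINT y|lebesgue. cmod (b P y)) * (chain_const * chain_kernel a L k (fst P - k) (snd P) x)"
  proof (intro AE_finite_allI F)
    fix P assume P: "P \<in> F"
    obtain n m' where Pn: "P = (k+n, m')" "cell a L k m \<subseteq> dil a L k (anc n m')" using loc[OF P] by blast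
    have "AE x in lebesgue. x \<in> dil a L k (anc n m') - dil a L (k+n) m' \<longrightarrow>
       cmod (T (b P) x) \<le> chain_const * chain_kernel a L k n m' x * (LINT y|lebesgue. cmod (b P y))"
      by (rule bad_part_pointwise[OF L b[OF P]]) (use bs[OF P] mean[OF P] Pn in auto)
    then show "AE x in lebesgue. x \<in> cell a L k m - S2 \<longrightarrow>
       cmod (T (b P) x) \<le> (LINT y|lebesgue. cmod (b P y)) * (chain_const * chain_kernel a L k (fst P - k) (snd P) x)"
    proof (rule AE_mp, intro AE_I2 impI)
      fix x assume i: "x \<in> dil a L k (anc n m') - dil a L (k+n) m' \<longrightarrow>
         cmod (T (b P) x) \<le> chain_const * chain_kernel a L k n m' x * (LINT y|lebesgue. cmod (b P y))"
        and x: "x \<in> cell a L k m - S2"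
      have "x \<notin> dil a L (k+n) m'" using x P Pn(1) by (auto simp: S2_def)
      with x Pn(2) i show "cmod (T (b P) x) \<le> (LINT y|lebesgue. cmod (b P y)) * (chain_const * chain_kernel a L k (fst P - k) (snd P) x)"
        using Pn(1) by (auto simp: mult_ac)
    qed
  qed
  have "AE x in lebesgue. T f0 x = T g x + (\<Sum>P\<in>F. T (b P) x)"
    unfolding eq by (rule T_sum[OF F g b])
  with bb have "AE x in lebesgue. x \<in> {x \<in> cell a L k m. A * t < cmod (T f0 x)} \<longrightarrow> x \<in> S1 \<union> (S2 \<union> S3)"
  proof eventually_elim
    case (elim x)
    show ?case
    proof
      assume x: "x \<in> {x \<in> cell a L k m. A * t < cmod (T f0 x)}"
      show "x \<in> S1 \<union> (S2 \<union> S3)"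
      proof (rule ccontr)
        assume n: "x \<notin> S1 \<union> (S2 \<union> S3)"
        have "\<not> A * t / 2 \<le> cmod (T g x)" using n At power_mono[of "A * t / 2" "cmod (T g x)" 2] by (auto simp: S1_def)
        moreover have "cmod (\<Sum>P\<in>F. T (b P) x) \<le> u x"
          unfolding u_def by (rule order_trans[OF norm_sum sum_mono]) (use elim(1) x n in auto)
        moreover have "u x < A * t / 2" using n by (auto simp: S3_def)
        ultimately have "cmod (T g x) + cmod (\<Sum>P\<in>F. T (b P) x) < A * t" by linarith
        moreover have "cmod (T f0 x) \<le> cmod (T g x) + cmod (\<Sum>P\<in>F. T (b P) x)"
          unfolding elim(2) by (rule norm_triangle_ineq)
        ultimately show False using x by auto
      qed
    qed
  qed
  then have "vol {x \<in> cell a L k m. A * t < cmod (T f0 x)} \<le> vol (S1 \<union> (S2 \<union> S3))"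
    using S1 S2 S3 by (intro lmeasure_mono_AE fmeasurable.Un)
  also have "\<dots> \<le> vol S1 + vol (S2 \<union> S3)"
    using S1 S2 S3 by (intro measure_Un_le) (auto dest: fmeasurableD)
  also have "vol (S2 \<union> S3) \<le> vol S2 + vol S3"
    using S2 S3 by (intro measure_Un_le) (auto dest: fmeasurableD)
  also have "vol S1 \<le> 4 * B * (2 + 2^CARD('d)) * Bc * Al / A * v"
  proof -
    have "(LINT x|lebesgue. (cmod (T g x))\<^sup>2) \<le> B * (LINT x|lebesgue. (cmod (g x))\<^sup>2)"
      by (rule T_bound[OF nice_L2[OF g]])
    also have "\<dots> \<le> B * ((2 + 2^CARD('d)) * l * ?N)" using g2 B by (rule mult_left_mono)
    finally have "vol S1 \<le> B * ((2 + 2^CARD('d)) * l * ?N) / (A * t / 2)\<^sup>2"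
      using S1(2) by (meson divide_right_mono order_trans zero_le_power2)
    also have "\<dots> = 4 * B * (2 + 2^CARD('d)) * Bc * Al * v / A\<^sup>2"
      unfolding Nt l_def using t A by (simp add: field_simps power2_eq_square)
    also have "\<dots> \<le> 4 * B * (2 + 2^CARD('d)) * Bc * Al * v / A"
      using A B Bc0 Al1 v by (intro divide_left_mono mult_nonneg_nonneg mult_pos_pos) (auto simp: power2_eq_square add_nonneg_nonneg)
    finally show ?thesis by simp
  qed
  also have "vol S2 \<le> 5 * Al\<^sup>2 / Bc * v"
  proof -
    have "vol S2 \<le> (\<Sum>P\<in>F. vol (pdil a L P))"
      unfolding S2_def using F L by (intro measure_UNION_le) auto
    also have "\<dots> = Al * (\<Sum>P\<in>F. vol (?X P))"
      unfolding Al_def measure_dil_cell[OF L] by (simp add: sum_distrib_left)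
    also have "\<dots> \<le> Al * (5 * ?N / l)" using size Al1 by (intro mult_left_mono) auto
    also have "\<dots> = 5 * Al\<^sup>2 / Bc * v" unfolding Nt l_def using t by (simp add: power2_eq_square)
    finally show ?thesis .
  qed
  also have "vol S3 \<le> 4 * chain_const / (1 - decay) * Al / A * v"
  proof -
    have "(LINT x|lebesgue. u x) = (\<Sum>P\<in>F. LINT x|lebesgue. (LINT y|lebesgue. cmod (b P y)) * (chain_const * chain_kernel a L k (fst P - k) (snd P) x))"
      unfolding u_def using chain_kernel_integral(1)[OF L] by (intro Bochner_Integration.integral_sum integrable_mult_right) auto
    also have "\<dots> = (\<Sum>P\<in>F. (LINT y|lebesgue. cmod (b P y)) * (chain_const * (LINT x|lebesgue. chain_kernel a L k (fst P - k) (snd P) x)))"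
      by (simp only: integral_mult_right_zero)
    also have "\<dots> \<le> (\<Sum>P\<in>F. (LINT y|lebesgue. cmod (b P y)) * (chain_const * (1 / (1 - decay))))"
      using chain_kernel_integral(2)[OF L] chain_const by (intro sum_mono mult_left_mono) (auto simp: integral_nonneg_AE)
    also have "\<dots> = (\<Sum>P\<in>F. LINT y|lebesgue. cmod (b P y)) * (chain_const * (1 / (1 - decay)))"
      by (simp only: sum_distrib_right)
    also have "\<dots> \<le> 2 * ?N * (chain_const * (1 / (1 - decay)))"
      using b1 chain_const decay by (intro mult_right_mono) auto
    finally have "vol S3 \<le> 2 * ?N * (chain_const * (1 / (1 - decay))) / (A * t / 2)"
      using S3(2) At by (meson divide_right_mono less_imp_le order_trans)
    also have "\<dots> = 4 * chain_const / (1 - decay) * Al / A * v"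
      unfolding Nt using t A decay by (simp add: field_simps)
    finally show ?thesis .
  qed
  finally show ?thesis unfolding v_def[symmetric] by (simp add: algebra_simps)
qed

lemma local_weak_type:
  assumes "\<epsilon> > 0"
  obtains A where "A \<ge> 1"
    "\<And>a L k m f. L > 0 \<Longrightarrow> nice f \<Longrightarrow>
      vol {x \<in> cell a L k m. A * (mass f (dil a L k m) / vol (dil a L k m)) < cmod (T (cut (dil a L k m) f) x)}
       \<le> \<epsilon> * vol (cell a L k m)"
proof -
  define Al where "Al = (4 * real CARD('d) + 3)^CARD('d)"
  have Al1: "Al \<ge> 1" unfolding Al_def by (intro one_le_power) simp
  \<comment> \<open>The height makes the removed set smaller than \<open>\<epsilon>/2\<close>; then the level \<open>A\<close>, which may depend on the height, makes the other two contributions smaller than \<open>\<epsilon>/2\<close>.\<close>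
  define Bc where "Bc = 4 * Al + 10 * Al\<^sup>2 / \<epsilon>"
  have Bc: "4 * Al \<le> Bc" "0 < Bc" using assms Al1 by (auto simp: Bc_def intro!: add_pos_nonneg)
  define D where "D = 4 * B * (2 + 2^CARD('d)) * Bc * Al + 4 * chain_const / (1 - decay) * Al"
  have D0: "0 \<le> D" unfolding D_def using B Bc Al1 chain_const decay
    by (intro add_nonneg_nonneg mult_nonneg_nonneg divide_nonneg_nonneg) auto
  define A where "A = 1 + 2 * D / \<epsilon>"
  have A: "A \<ge> 1" using D0 assms by (simp add: A_def)
  have "D / A \<le> \<epsilon> / 2"
  proof -
    have "2 * D \<le> \<epsilon> * A" using assms D0 by (simp add: A_def field_simps)
    then show ?thesis using A by (simp add: field_simps)
  qed
  moreover have "5 * Al\<^sup>2 / Bc \<le> \<epsilon> / 2"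
  proof -
    have "10 * Al\<^sup>2 \<le> \<epsilon> * Bc" using assms Al1 by (simp add: Bc_def field_simps)
    then show ?thesis using Bc by (simp add: field_simps)
  qed
  moreover have "4 * B * (2 + 2^CARD('d)) * Bc * Al / A + 5 * Al\<^sup>2 / Bc + 4 * chain_const / (1 - decay) * Al / A = D / A + 5 * Al\<^sup>2 / Bc"
    by (simp add: D_def add_divide_distrib)
  ultimately have const: "4 * B * (2 + 2^CARD('d)) * Bc * Al / A + 5 * Al\<^sup>2 / Bc + 4 * chain_const / (1 - decay) * Al / A \<le> \<epsilon>"
    by linarith
  show ?thesis
  proof (rule that[OF A])
    fix a :: "real^'d" and L :: real and k and m :: "int^'d" and f
    assume L: "L > 0" and f: "nice (f :: real^'d \<Rightarrow> complex)"
    let ?f0 = "cut (dil a L k m) f"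
    have f0: "nice ?f0" using f L by (intro nice_cut) auto
    have mf: "mass f (dil a L k m) = mass ?f0 UNIV" using mass_cut[OF f, of "dil a L k m" UNIV] L by simp
    show "vol {x \<in> cell a L k m. A * (mass f (dil a L k m) / vol (dil a L k m)) < cmod (T ?f0 x)}
       \<le> \<epsilon> * vol (cell a L k m)"
    proof (cases "mass ?f0 UNIV = 0")
      case True
      have "vol {x \<in> cell a L k m. A * (mass f (dil a L k m) / vol (dil a L k m)) < cmod (T ?f0 x)}
          \<le> vol ({} :: (real^'d) set)"
      proof (rule lmeasure_mono_AE)
        show "AE x in lebesgue. x \<in> {x \<in> cell a L k m. A * (mass f (dil a L k m) / vol (dil a L k m)) < cmod (T ?f0 x)} \<longrightarrow> x \<in> {}"
          by (rule AE_mp[OF T_null[OF f0 True]]) (simp add: mf True)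
      qed simp
      also have "\<dots> \<le> \<epsilon> * vol (cell a L k m)" using assms by simp
      finally show ?thesis .
    next
      case False
      then have pos: "mass ?f0 UNIV > 0" by (simp add: zero_less_measure_iff)
      have "vol {x \<in> cell a L k m. A * (mass f (dil a L k m) / vol (dil a L k m)) < cmod (T ?f0 x)}
         \<le> (4 * B * (2 + 2^CARD('d)) * Bc * Al / A + 5 * Al\<^sup>2 / Bc + 4 * chain_const / (1 - decay) * Al / A) * vol (cell a L k m)"
        unfolding mf Al_def
        by (rule local_weak_type_fixed_height[OF L f0 _ pos _ A]) (use Bc in \<open>auto simp: cut_def Al_def split: if_splits\<close>)
      also have "\<dots> \<le> \<epsilon> * vol (cell a L k m)" using const by (rule mult_right_mono) simp
      finally show ?thesis .
    qed
  qed
qed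

end

section \<open>Sparse domination\<close>

definition dil_avg :: "real^'d \<Rightarrow> real \<Rightarrow> (real^'d \<Rightarrow> complex) \<Rightarrow> nat \<times> (int^'d) \<Rightarrow> real" where
  "dil_avg a L f P = mass f (pdil a L P) / vol (pdil a L P)"

lemma dil_avg_nonneg: "0 \<le> dil_avg a L f P"
  by (simp add: dil_avg_def)

lemma classes_card: "card (classes :: (int^'d) set) \<ge> 1"
proof -
  have "0 \<in> (classes :: (int^'d) set)" by (simp add: classes_def)
  then show ?thesis using finite_classes by (metis One_nat_def Suc_leI card_gt_0_iff empty_iff)
qed

context calderon_zygmund
begin

text \<open>The outcome of one stopping step at \<open>Q\<close>: strict dyadic subcubes that fill at most half of \<open>Q\<close>, with a bound for
  \<open>T(f 1\<^bsub>Q*\<^esub>)\<close> outside them and a comparison with \<open>T(f 1\<^bsub>P*\<^esub>)\<close> on each of them.\<close>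

definition stopping_children :: "real \<Rightarrow> real^'d \<Rightarrow> real \<Rightarrow> (real^'d \<Rightarrow> complex) \<Rightarrow> nat \<times> (int^'d) \<Rightarrow>
    (nat \<times> (int^'d)) set \<Rightarrow> bool" where
  "stopping_children c a L f Q J \<longleftrightarrow>
    (\<forall>P\<in>J. fst Q < fst P \<and> pcell a L P \<subseteq> pcell a L Q) \<and>
    disjoint_family_on (\<lambda>P. pcell a L P) J \<and>
    2 * emeasure lebesgue (\<Union>P\<in>J. pcell a L P) \<le> emeasure lebesgue (pcell a L Q) \<and>
    (\<forall>x \<in> pcell a L Q - (\<Union>P\<in>J. pcell a L P).
       cmod (T (cut (pdil a L Q) f) x) \<le> c * dil_avg a L f Q) \<and>
    (\<forall>P\<in>J. AE x in lebesgue. x \<in> pcell a L P \<longrightarrow>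
       cmod (T (cut (pdil a L Q) f) x) \<le> cmod (T (cut (pdil a L P) f) x) + c * dil_avg a L f Q)"

text \<open>The parent of a stopping cube \<open>P\<close> is not stopped, so the exceptional set covers at most half of \<open>P\<close>, and the averages over the
  dilates of all strict ancestors are controlled. Together with the weak-type estimate on \<open>P\<close> itself this yields a point of \<open>P\<close> where both
  \<open>T(f 1\<^bsub>Q*\<^esub>)\<close> and \<open>T(f 1\<^bsub>P*\<^esub>)\<close> are small, hence also their difference, the far part; by \<open>oscillation\<close>
  the far part is then small on all of \<open>P\<close>. The thresholds are such that each of the two kinds of stopping cubes fills at
  most a quarter of \<open>Q\<close>, and the density threshold \<open>1 / (2 \<cdot> 2^d)\<close> for a cube becomes one half for its child.\<close>

lemma stopping_step_fixed_height:
  fixes a :: "real^'d" and m :: "int^'d" and f :: "real^'d \<Rightarrow> complex"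
  defines "eps \<equiv> 1 / (16 * 2^CARD('d))"
    and "A' \<equiv> 4 * real (card (classes :: (int^'d) set)) * (4 * real CARD('d) + 3)^CARD('d)"
  assumes L: "L > 0" and f: "nice f" and A: "A \<ge> 1"
    and weak: "\<And>k m f. nice f \<Longrightarrow>
      vol {x \<in> cell a L k m. A * (mass f (dil a L k m) / vol (dil a L k m)) < cmod (T (cut (dil a L k m) f) x)}
       \<le> eps * vol (cell a L k m)"
  defines "C3 \<equiv> A + A * 2^CARD('d) * A' + chain_const / (1 - decay) * A'"
  shows "\<exists>J. stopping_children C3 a L f (k, m) J"
proof -
  let ?X = "\<lambda>P. pcell a L P"
  let ?Q = "cell a L k m" and ?D = "dil a L k m"
  define t where "t = dil_avg a L f (k, m)"
  define d2 where "d2 = (2::real)^CARD('d)"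
  have d2: "d2 \<ge> 1" by (simp add: d2_def)
  have eps: "eps > 0" "16 * d2 * eps = 1" using d2 by (auto simp: eps_def d2_def)
  have t0: "0 \<le> t" by (simp add: t_def dil_avg_nonneg)
  define Al where "Al = (4 * real CARD('d) + 3)^CARD('d)"
  have Al1: "Al \<ge> 1" unfolding Al_def by (intro one_le_power) simp
  have A'1: "A' \<ge> 1"
  proof -
    have "1 * 1 \<le> real (card (classes :: (int^'d) set)) * Al"
      using classes_card Al1 by (intro mult_mono) auto
    then show ?thesis by (simp add: A'_def Al_def)
  qed
  define v where "v = vol ?Q"
  have v: "v > 0" using measure_cell_pos[OF L] by (simp add: v_def)
  define f0 where "f0 = cut ?D f"
  have f0: "nice f0" unfolding f0_def using f L by (intro nice_cut) auto
  have mt: "mass f ?D = t * vol ?D" using measure_dil_pos[OF L, of a k m] by (simp add: t_def dil_avg_def)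
  \<comment> \<open>The exceptional set of the weak-type estimate; the open set \<open>U\<close> below contains it and still has measure at most \<open>2 eps |Q|\<close>.\<close>
  define E where "E = {x \<in> ?Q. A * t < cmod (T f0 x)}"
  have superm: "{x \<in> cell a L k' m'. c < cmod (T g x)} \<in> lmeasurable" if "nice g" for g c k' m'
  proof -
    have [measurable]: "T g \<in> borel_measurable lebesgue" by (rule T_measurable[OF that])
    have "{x \<in> space lebesgue. c < cmod (T g x)} \<in> sets lebesgue" by measurable
    then have "cell a L k' m' \<inter> {x. c < cmod (T g x)} \<in> lmeasurable" using L
      by (intro fmeasurable_Int_fmeasurable) auto
    moreover have "{x \<in> cell a L k' m'. c < cmod (T g x)} = cell a L k' m' \<inter> {x. c < cmod (T g x)}" by blast
    ultimately show ?thesis by simp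
  qed
  have E: "E \<in> lmeasurable" unfolding E_def by (rule superm[OF f0])
  have E1: "vol E \<le> eps * v" using weak[OF f, of k m] unfolding E_def f0_def v_def t_def dil_avg_def by simp
  obtain U where U: "open U" "E \<subseteq> U" "U \<in> lmeasurable" "vol U \<le> vol E + eps * v"
    using measure_superset_open[OF E, of "eps * v"] eps v by (metis mult_pos_pos)
  have U2: "vol U \<le> 2 * eps * v" using U(4) E1 by linarith
  have UX: "U \<inter> cell a L k' m' \<in> lmeasurable" for k' m'
    using U(3) L by (intro fmeasurable_Int_fmeasurable) auto
  define bad where "bad k' m' \<longleftrightarrow> anc (k' - k) m' = m \<and>
     (1 / (2 * d2) * vol (cell a L k' m') < vol (U \<inter> cell a L k' m') \<or>
      A' * t * vol (dil a L k' m') < mass f (dil a L k' m'))" for k' m'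
  define J where "J = stopping_cubes k bad"
  have nbk: "\<not> bad k m"
  proof -
    have "vol (U \<inter> ?Q) \<le> vol U" using U(3) UX by (intro measure_mono_fmeasurable) (auto intro: fmeasurableD)
    also have "\<dots> \<le> 1 / (2 * d2) * v"
    proof -
      have "2 * eps \<le> 1 / (2 * d2)" using eps d2 by (simp add: field_simps)
      then have "2 * eps * v \<le> 1 / (2 * d2) * v" using v by (intro mult_right_mono) auto
      then show ?thesis using U2 by linarith
    qed
    moreover have "mass f ?D \<le> A' * t * vol ?D"
    proof -
      have "1 * (t * vol ?D) \<le> A' * (t * vol ?D)" using A'1 t0 by (intro mult_right_mono) auto
      then show ?thesis using mt by (simp add: mult.assoc)
    qed
    ultimately show ?thesis by (simp add: bad_def v_def)
  qed
  have JE: "\<exists>n m'. P = (k + Suc n, m') \<and> bad (k + Suc n) m' \<and> anc (Suc n) m' = m \<and>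
      (\<forall>j<Suc n. \<not> 1 / (2 * d2) * vol (cell a L (k + j) (anc (Suc n - j) m')) < vol (U \<inter> cell a L (k + j) (anc (Suc n - j) m'))
        \<and> mass f (dil a L (k + j) (anc (Suc n - j) m')) \<le> A' * t * vol (dil a L (k + j) (anc (Suc n - j) m')))"
    if PJ: "P \<in> J" for P
  proof -
    from PJ obtain n m' where P: "P = (k + n, m')" "bad (k + n) m'" "\<And>j. j < n \<Longrightarrow> \<not> bad (k + j) (anc (n - j) m')"
      unfolding J_def by (rule stopping_cubesE) blast
    have am: "anc n m' = m" using P(2) by (simp add: bad_def)
    have "n \<noteq> 0" using P(2) nbk am by (metis add.right_neutral anc_0)
    then obtain n' where n': "n = Suc n'" using not0_implies_Suc by blast
    have "anc (k + j - k) (anc (n - j) m') = m" if "j < n" for j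
      using am that by (simp add: anc_anc)
    then have "\<not> 1 / (2 * d2) * vol (cell a L (k + j) (anc (n - j) m')) < vol (U \<inter> cell a L (k + j) (anc (n - j) m'))
        \<and> mass f (dil a L (k + j) (anc (n - j) m')) \<le> A' * t * vol (dil a L (k + j) (anc (n - j) m'))" if "j < n" for j
      using P(3)[OF that] that unfolding bad_def by (meson not_le)
    with P am n' show ?thesis by blast
  qed
  have sub: "k < fst P" "?X P \<subseteq> ?Q" "pdil a L P \<subseteq> ?D" if PJ: "P \<in> J" for P
  proof -
    obtain n m' where P: "P = (k + Suc n, m')" "anc (Suc n) m' = m" using JE[OF PJ] by blast
    show "k < fst P" "?X P \<subseteq> ?Q" "pdil a L P \<subseteq> ?D"
      using P cell_subset_anc[OF L, of a k "Suc n" m'] dil_subset_anc[OF L, of a k "Suc n" m'] by auto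
  qed
  have disj: "disjoint_family_on ?X J" unfolding J_def by (rule stopping_cubes_disjoint_family[OF L])
  define \<nu> where "\<nu> = density lebesgue (indicator U :: real^'d \<Rightarrow> ennreal)"
  have em\<nu>: "emeasure \<nu> S = emeasure lebesgue (U \<inter> S)" if "S \<in> sets lebesgue" for S
    unfolding \<nu>_def using U(3) that by (intro emeasure_restricted) (auto intro: fmeasurableD)
  have m\<nu>: "measure \<nu> S = vol (U \<inter> S)" if "S \<in> sets lebesgue" for S
    unfolding measure_def using em\<nu>[OF that] by simp
  have fin\<nu>: "finite_measure \<nu>"
  proof
    have "emeasure lebesgue U < \<infinity>" using U(3) unfolding fmeasurable_def by blast
    moreover have "space \<nu> = UNIV" by (simp add: \<nu>_def)
    ultimately show "emeasure \<nu> (space \<nu>) \<noteq> \<infinity>" using em\<nu>[of UNIV] by auto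
  qed
  define V1 where "V1 = \<Union>{cell a L k' m | k' m. k \<le> k' \<and> 1 / (2 * d2) * vol (cell a L k' m) < measure \<nu> (cell a L k' m)}"
  have V1: "V1 \<in> sets lebesgue" "emeasure lebesgue V1 \<le> ennreal (measure \<nu> UNIV / (1 / (2 * d2)))"
    unfolding V1_def using weak_type_cells[OF L fin\<nu>, of "1 / (2 * d2)" a k] d2 by (simp_all add: \<nu>_def del: emeasure_completion)
  have "measure \<nu> UNIV / (1 / (2 * d2)) \<le> v / 4"
  proof -
    have "measure \<nu> UNIV / (1 / (2 * d2)) = 2 * d2 * vol U" using m\<nu>[of UNIV] by simp
    also have "\<dots> \<le> 2 * d2 * (2 * eps * v)" using U2 d2 by (intro mult_left_mono) auto
    also have "\<dots> = (16 * d2 * eps) * (v / 4)" by simp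
    finally show ?thesis unfolding eps by simp
  qed
  then have V1v: "emeasure lebesgue V1 \<le> ennreal (v / 4)" using V1(2) ennreal_leI order_trans by blast
  \<comment> \<open>The region of large averages. If \<open>t = 0\<close>, then \<open>f\<close> vanishes on the dilate of \<open>Q\<close> and no average is large.\<close>
  obtain V2 where V2: "V2 \<in> sets lebesgue" "emeasure lebesgue V2 \<le> ennreal (v / 4)"
    "\<And>P. P \<in> J \<Longrightarrow> A' * t * vol (pdil a L P) < mass f (pdil a L P) \<Longrightarrow> ?X P \<subseteq> V2"
  proof (cases "t = 0")
    case True
    have "mass f (pdil a L P) \<le> 0" if "P \<in> J" for P
    proof -
      have "mass f (pdil a L P) \<le> mass f ?D"
        using sub(3)[OF that] L by (intro mass_mono[OF f]) auto
      then show ?thesis using mt True by simp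
    qed
    then show ?thesis using True by (intro that[of "{}"]) force+
  next
    case False
    then have At: "A' * t > 0" using A'1 t0 by simp
    obtain V where V: "V \<in> lmeasurable"
      "vol V \<le> card (classes :: (int^'d) set) * (mass f0 UNIV / (A' * t))"
      "\<And>k' m. k \<le> k' \<Longrightarrow> A' * t * vol (dil a L k' m) < mass f0 (dil a L k' m) \<Longrightarrow> dil a L k' m \<subseteq> V"
      using weak_type_dils[OF L finite_mass_measure[OF f0] sets_mass_measure At, of k a] by blast
    show ?thesis
    proof (rule that[of V])
      have "mass f0 UNIV = t * (Al * v)"
        using mass_cut[OF f, of ?D UNIV] L mt measure_dil_cell[OF L, of a k m] by (simp add: f0_def Al_def v_def)
      then have "card (classes :: (int^'d) set) * (mass f0 UNIV / (A' * t)) = v / 4"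
        using False Al1 classes_card[where 'd='d] unfolding A'_def Al_def[symmetric] by (simp add: field_simps)
      then have "vol V \<le> v / 4" using V(2) by (simp only:)
      moreover have "emeasure lebesgue V = ennreal (vol V)" using V(1) by (intro emeasure_eq_measure2)
      ultimately show "emeasure lebesgue V \<le> ennreal (v / 4)" by (simp add: ennreal_leI del: emeasure_completion)
      fix P assume P: "P \<in> J" "A' * t * vol (pdil a L P) < mass f (pdil a L P)"
      have "mass f0 (pdil a L P) = mass f (?D \<inter> pdil a L P)"
        unfolding f0_def using L by (intro mass_cut[OF f]) auto
      also have "?D \<inter> pdil a L P = pdil a L P" using sub(3)[OF P(1)] by blast
      finally have "pdil a L P \<subseteq> V" using V(3)[of "fst P" "snd P"] P sub(1)[OF P(1)] by simp
      then show "?X P \<subseteq> V" using cell_subset_dil by blast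
    qed (use V in \<open>auto intro: fmeasurableD\<close>)
  qed
  have cover: "(\<Union>P\<in>J. ?X P) \<subseteq> V1 \<union> V2"
  proof (rule UN_least)
    fix P assume PJ: "P \<in> J"
    obtain n m' where P: "P = (k + Suc n, m')" "bad (k + Suc n) m'" using JE[OF PJ] by blast
    from P(2) consider "1 / (2 * d2) * vol (cell a L (k + Suc n) m') < vol (U \<inter> cell a L (k + Suc n) m')"
      | "A' * t * vol (dil a L (k + Suc n) m') < mass f (dil a L (k + Suc n) m')" unfolding bad_def by blast
    then show "?X P \<subseteq> V1 \<union> V2"
    proof cases
      case 1
      then have "1 / (2 * d2) * vol (?X P) < measure \<nu> (?X P)" using m\<nu>[of "?X P"] L P(1) by simp
      moreover have "k \<le> fst P" using P(1) by simp
      ultimately have "?X P \<subseteq> V1" unfolding V1_def by blast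
      then show ?thesis by blast
    next
      case 2
      then show ?thesis using V2(3)[OF PJ] P(1) by auto
    qed
  qed
  have half: "2 * emeasure lebesgue (\<Union>P\<in>J. ?X P) \<le> emeasure lebesgue ?Q"
  proof -
    have "emeasure lebesgue (\<Union>P\<in>J. ?X P) \<le> emeasure lebesgue (V1 \<union> V2)"
      using cover V1 V2 by (intro emeasure_mono sets.Un)
    also have "\<dots> \<le> emeasure lebesgue V1 + emeasure lebesgue V2" using V1 V2 by (intro emeasure_subadditive)
    also have "\<dots> \<le> ennreal (v / 4) + ennreal (v / 4)" using V1v V2 by (intro add_mono)
    also have "\<dots> = ennreal (v / 2)" using v by (simp add: ennreal_plus[symmetric] del: ennreal_plus)
    finally have "2 * emeasure lebesgue (\<Union>P\<in>J. ?X P) \<le> 2 * ennreal (v / 2)" by (intro mult_left_mono) auto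
    also have "2 * ennreal (v / 2) = ennreal v"
      using v ennreal_mult[of 2 "v/2"] by simp
    also have "ennreal v = emeasure lebesgue ?Q"
      unfolding v_def using emeasure_eq_measure2[of ?Q lebesgue] L by (simp del: emeasure_completion)
    finally show ?thesis .
  qed
  have C3A: "A * t \<le> C3 * t"
  proof -
    have "0 \<le> A * 2^CARD('d) * A'" "0 \<le> chain_const / (1 - decay) * A'" using A A'1 chain_const decay by (auto intro!: mult_nonneg_nonneg)
    then have "A \<le> C3" by (simp add: C3_def)
    then show ?thesis using t0 by (rule mult_right_mono)
  qed
  have outside: "cmod (T f0 x) \<le> C3 * t" if x: "x \<in> ?Q - (\<Union>P\<in>J. ?X P)" for x
  proof -
    have "x \<notin> U"
    proof
      assume "x \<in> U"
      then obtain n where n: "cell a L (k+n) (idx a L (k+n) x) \<subseteq> U" using small_cell_in_open[OF L U(1)] by metis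
      then have "U \<inter> cell a L (k+n) (idx a L (k+n) x) = cell a L (k+n) (idx a L (k+n) x)" by blast
      moreover have "vol (cell a L (k+n) (idx a L (k+n) x)) > 0" by (rule measure_cell_pos[OF L])
      moreover have "1 / (2 * d2) * y < y" if "y > 0" for y using that d2 by (simp add: field_simps)
      moreover have "anc n (idx a L (k+n) x) = m" using x anc_idx[OF L, of n a k x] by (simp add: cell_def)
      ultimately have "bad (k+n) (idx a L (k+n) x)" unfolding bad_def by simp
      then have "\<exists>P\<in>stopping_cubes k bad. x \<in> ?X P"
        using stopping_cubes_covers[where bad = bad and k' = "k+n" and m = "idx a L (k+n) x" and k = k and x = x and a = a, OF L]
        by (metis cell_idx le_add1)
      then show False using x unfolding J_def by blast
    qed
    then have "x \<notin> E" using U(2) by blast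
    then have "cmod (T f0 x) \<le> A * t" using x by (auto simp: E_def)
    then show ?thesis using C3A by linarith
  qed
  have inside: "AE x in lebesgue. x \<in> ?X P \<longrightarrow>
       cmod (T f0 x) \<le> cmod (T (cut (pdil a L P) f) x) + C3 * t" if PJ: "P \<in> J" for P
  proof -
    obtain n m' where P: "P = (k + Suc n, m')" "anc (Suc n) m' = m"
      and par: "\<And>j. j < Suc n \<Longrightarrow> \<not> 1 / (2 * d2) * vol (cell a L (k + j) (anc (Suc n - j) m')) < vol (U \<inter> cell a L (k + j) (anc (Suc n - j) m'))"
      "\<And>j. j < Suc n \<Longrightarrow> mass f (dil a L (k + j) (anc (Suc n - j) m')) \<le> A' * t * vol (dil a L (k + j) (anc (Suc n - j) m'))"
      using JE[OF PJ] by blast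
    let ?P = "cell a L (k + Suc n) m'" and ?DP = "dil a L (k + Suc n) m'"
    define fP where "fP = cut ?DP f"
    define h where "h = cut (?D - ?DP) f"
    have fP: "nice fP" unfolding fP_def using f L by (intro nice_cut) auto
    have h: "nice h" unfolding h_def using f L by (intro nice_cut sets.Diff) auto
    have DPD: "?DP \<subseteq> ?D" using sub(3)[OF PJ] P by simp
    then have split: "f0 = (\<lambda>x. fP x + h x)" by (auto simp: f0_def fP_def h_def cut_def fun_eq_iff)
    have ae1: "AE x in lebesgue. T f0 x = T fP x + T h x"
      unfolding split using fP h by (intro T_add nice_L2)
    have ae2: "AE x in lebesgue. x \<in> ?P \<longrightarrow> T h x = (LINT y|lebesgue. K x y * h y)"
      using T_rep[OF h]
    proof (rule AE_mp, intro AE_I2 impI)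
      fix x assume i: "x \<notin> closure {y. h y \<noteq> 0} \<longrightarrow> T h x = (LINT y|lebesgue. K x y * h y)" and x: "x \<in> ?P"
      have "x \<notin> closure {y. h y \<noteq> 0}"
      proof (rule not_in_closure_support)
        show "0 < (2 * real CARD('d) + 1) * (L/2^(k + Suc n))" using L by (intro mult_pos_pos add_nonneg_pos) auto
        fix y assume "h y \<noteq> 0"
        then have "y \<notin> ?DP" by (auto simp: h_def cut_def split: if_splits)
        then show "(2 * real CARD('d) + 1) * (L/2^(k + Suc n)) \<le> norm (x - y)" by (rule dil_separation[OF L x])
      qed
      then show "T h x = (LINT y|lebesgue. K x y * h y)" using i by blast
    qed
    define tP where "tP = dil_avg a L f (k + Suc n, m')"
    have tP0: "0 \<le> tP" by (simp add: tP_def dil_avg_nonneg)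
    have tP: "tP \<le> d2 * A' * t"
    proof -
      have s: "?DP \<subseteq> dil a L (k + n) (anc 1 m')" using dil_subset_anc[OF L, of a "k+n" 1 m'] by simp
      have "mass f ?DP \<le> mass f (dil a L (k + n) (anc 1 m'))" using s L by (intro mass_mono[OF f]) auto
      also have "\<dots> \<le> A' * t * vol (dil a L (k + n) (anc 1 m'))" using par(2)[of n] by simp
      also have "vol (dil a L (k + n) (anc 1 m')) = d2 * vol ?DP"
        unfolding measure_dil_cell[OF L] using measure_cell_anc[OF L, of a "k+n" "anc 1 m'" 1 m'] by (simp add: d2_def)
      finally show ?thesis unfolding tP_def dil_avg_def using measure_dil_pos[OF L, of a "k + Suc n" m']
        by (simp add: pos_divide_le_eq mult_ac)
    qed
    have UP: "vol (U \<inter> ?P) \<le> vol ?P / 2"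
    proof -
      have s: "?P \<subseteq> cell a L (k + n) (anc 1 m')" using cell_subset_anc[OF L, of a "k+n" 1 m'] by simp
      have "vol (U \<inter> ?P) \<le> vol (U \<inter> cell a L (k + n) (anc 1 m'))"
        using s UX by (intro measure_mono_fmeasurable) (auto intro: fmeasurableD)
      also have "\<dots> \<le> 1 / (2 * d2) * vol (cell a L (k + n) (anc 1 m'))" using par(1)[of n] by simp
      also have "vol (cell a L (k + n) (anc 1 m')) = d2 * vol ?P"
        using measure_cell_anc[OF L, of a "k+n" "anc 1 m'" 1 m'] by (simp add: d2_def)
      finally show ?thesis using d2 by simp
    qed
    define W where "W = {x \<in> ?P. A * tP < cmod (T fP x)}"
    have W: "W \<in> lmeasurable" "vol W \<le> eps * vol ?P"
      using superm[OF fP] weak[OF f, of "k + Suc n" m'] unfolding W_def fP_def tP_def dil_avg_def by auto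
    \<comment> \<open>The exceptional sets of \<open>T f0\<close> and \<open>T fP\<close> do not exhaust \<open>P\<close>.\<close>
    have "\<exists>x' \<in> ?P. T f0 x' = T fP x' + T h x' \<and> T h x' = (LINT y|lebesgue. K x' y * h y) \<and> x' \<notin> U \<and> x' \<notin> W"
    proof (rule ccontr)
      assume *: "\<not> ?thesis"
      have "AE x in lebesgue. x \<in> ?P \<longrightarrow> x \<in> (U \<inter> ?P) \<union> W"
        using ae1 ae2 by eventually_elim (use * in blast)
      then have "vol ?P \<le> vol ((U \<inter> ?P) \<union> W)" using W UX by (intro lmeasure_mono_AE fmeasurable.Un)
      also have "\<dots> \<le> vol (U \<inter> ?P) + vol W" using W UX by (intro measure_Un_le) (auto intro: fmeasurableD)
      also have "\<dots> \<le> vol ?P / 2 + eps * vol ?P" using UP W by simp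
      also have "\<dots> < vol ?P"
      proof -
        have "1 * (16 * eps) \<le> d2 * (16 * eps)" using eps(1) d2 by (intro mult_right_mono) auto
        moreover have "d2 * (16 * eps) = 1" using eps(2) by (simp only: mult_ac)
        ultimately have "eps * 2 < 1" by linarith
        then show ?thesis using measure_cell_pos[OF L, of a "k + Suc n" m'] by (simp add: field_simps)
      qed
      finally show False by simp
    qed
    then obtain x' where x': "x' \<in> ?P" "T f0 x' = T fP x' + T h x'" "T h x' = (LINT y|lebesgue. K x' y * h y)" "x' \<notin> U" "x' \<notin> W"
      by blast
    have "x' \<in> ?Q" using sub(2)[OF PJ] P x'(1) by auto
    moreover have "x' \<notin> E" using x'(4) U(2) by blast
    ultimately have "cmod (T f0 x') \<le> A * t" by (auto simp: E_def)
    moreover have "cmod (T fP x') \<le> A * tP" using x' by (auto simp: W_def)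
    moreover have "A * tP \<le> A * (d2 * A' * t)" using tP A by (intro mult_left_mono) auto
    moreover have "cmod (T h x') \<le> cmod (T f0 x') + cmod (T fP x')"
      using x'(2) norm_triangle_ineq4[of "T f0 x'" "T fP x'"] by simp
    ultimately have hx': "cmod (LINT y|lebesgue. K x' y * h y) \<le> (A + A * d2 * A') * t"
      using x'(3) by (simp add: algebra_simps)
    show ?thesis using ae1 ae2
    proof eventually_elim
      case (elim x)
      show ?case
      proof
        assume "x \<in> ?X P"
        then have x: "x \<in> ?P" using P by simp
        have "cmod ((LINT y|lebesgue. K x y * h y) - (LINT y|lebesgue. K x' y * h y)) \<le> chain_const / (1 - decay) * (A' * t)"
          using oscillation[OF L f x x'(1), of "A' * t"] par(2) A'1 t0 unfolding h_def P(2) by simp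
        moreover have "cmod (LINT y|lebesgue. K x y * h y) \<le> cmod (LINT y|lebesgue. K x' y * h y) +
           cmod ((LINT y|lebesgue. K x y * h y) - (LINT y|lebesgue. K x' y * h y))"
          by (rule norm_triangle_sub)
        ultimately have "cmod (T h x) \<le> (A + A * d2 * A') * t + chain_const / (1 - decay) * (A' * t)"
          using hx' elim(2) x by simp
        also have "\<dots> = C3 * t" by (simp add: C3_def d2_def algebra_simps)
        finally have "cmod (T h x) \<le> C3 * t" .
        moreover have "cmod (T f0 x) \<le> cmod (T fP x) + cmod (T h x)" unfolding elim(1) by (rule norm_triangle_ineq)
        ultimately show "cmod (T f0 x) \<le> cmod (T (cut (pdil a L P) f) x) + C3 * t"
          using P by (simp add: fP_def)
      qed
    qed
  qed
  show ?thesis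
    unfolding stopping_children_def fst_conv snd_conv f0_def[symmetric] t_def[symmetric]
    using sub disj half outside inside by (intro exI[of _ J] conjI ballI) blast+
qed

lemma stopping_step:
  obtains C3 where "C3 \<ge> 0"
    "\<And>(a::real^'d) L f Q. L > 0 \<Longrightarrow> nice f \<Longrightarrow> \<exists>J. stopping_children C3 a L f Q J"
proof -
  let ?A' = "4 * real (card (classes :: (int^'d) set)) * (4 * real CARD('d) + 3)^CARD('d)"
  have "1 / (16 * 2^CARD('d)) > (0::real)" by simp
  from local_weak_type[OF this] obtain A where A: "A \<ge> 1"
    "\<And>a L k m f. L > 0 \<Longrightarrow> nice f \<Longrightarrow>
      vol {x \<in> cell a L k m. A * (mass f (dil a L k m) / vol (dil a L k m)) < cmod (T (cut (dil a L k m) f) x)}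
       \<le> 1 / (16 * 2^CARD('d)) * vol (cell a L k m)" by blast
  show ?thesis
  proof (rule that[of "A + A * 2^CARD('d) * ?A' + chain_const / (1 - decay) * ?A'"], goal_cases)
    case 1
    show ?case using A(1) chain_const decay by (intro add_nonneg_nonneg mult_nonneg_nonneg divide_nonneg_nonneg) auto
  next
    case (2 a L f Q)
    then show ?case
      using stopping_step_fixed_height[where k = "fst Q" and m = "snd Q" and a = a, OF 2 A(1) A(2)[OF 2(1)]] by simp
  qed
qed

end

primrec generation :: "('i \<Rightarrow> 'i set) \<Rightarrow> 'i \<Rightarrow> nat \<Rightarrow> 'i set" where
  "generation J Q 0 = {Q}"
| "generation J Q (Suc n) = (\<Union>P\<in>generation J Q n. J P)"

text \<open>The part of \<open>X P\<close> not covered by the children is disjoint from all later generations. What is covered in every generation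
  is null, since its measure in each cube is at most \<open>2\<^sup>-\<^sup>n\<close> times the measure of the cube, for all \<open>n\<close>.\<close>

lemma stopping_tree_sparse:
  fixes X :: "'i::countable \<Rightarrow> 'a set" and Q :: 'i and J :: "'i \<Rightarrow> 'i set"
  defines "S \<equiv> \<Union>n. generation J Q n"
    and "E \<equiv> \<lambda>P. X P - (\<Union>R\<in>J P. X R)"
  assumes X: "\<And>P. X P \<in> sets M" and XQ: "emeasure M (X Q) < \<infinity>"
    and sub: "\<And>P R. R \<in> J P \<Longrightarrow> X R \<subseteq> X P"
    and disj: "\<And>P. disjoint_family_on X (J P)"
    and half: "\<And>P. 2 * emeasure M (\<Union>R\<in>J P. X R) \<le> emeasure M (X P)"
  shows "disjoint_family_on E S" "emeasure M (X Q - (\<Union>P\<in>S. E P)) = 0"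
proof -
  have g_disj: "P = P'" if "P \<in> generation J Q n" "P' \<in> generation J Q n" "x \<in> X P" "x \<in> X P'" for n P P' x
    using that
  proof (induction n arbitrary: P P')
    case (Suc n)
    then obtain R R' where R: "R \<in> generation J Q n" "P \<in> J R" "R' \<in> generation J Q n" "P' \<in> J R'" by auto
    then have "x \<in> X R" "x \<in> X R'" using Suc.prems sub by blast+
    then have "R = R'" using Suc.IH R by blast
    then show ?case using disj[of R] R Suc.prems unfolding disjoint_family_on_def by blast
  qed simp
  have dec: "\<exists>R\<in>generation J Q n. x \<in> X R" if "P \<in> generation J Q (n + j)" "x \<in> X P" for n j P x
    using that
  proof (induction j arbitrary: P)
    case (Suc j)
    then obtain R where "R \<in> generation J Q (n + j)" "P \<in> J R" by auto
    then show ?case using Suc sub by blast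
  qed auto
  have later: "x \<notin> E P" if P: "P \<in> generation J Q n" and P': "P' \<in> generation J Q n'" and lt: "n < n'" and xP': "x \<in> X P'" for n n' P P' x
  proof
    assume x: "x \<in> E P"
    obtain j where "n' = Suc n + j" using lt by (metis Suc_leI le_Suc_ex)
    then obtain R where R: "R \<in> generation J Q (Suc n)" "x \<in> X R" using dec[of P' "Suc n" j x] P' xP' by blast
    then obtain P0 where P0: "P0 \<in> generation J Q n" "R \<in> J P0" by auto
    have "x \<in> X P0" "x \<in> X P" using P0 R sub x by (auto simp: E_def)
    then have "P0 = P" using g_disj P0 P by blast
    then show False using x P0 R by (auto simp: E_def)
  qed
  show "disjoint_family_on E S"
    unfolding disjoint_family_on_def
  proof (intro ballI impI)
    fix P P' assume "P \<in> S" "P' \<in> S" "P \<noteq> P'"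
    then obtain n n' where n: "P \<in> generation J Q n" "P' \<in> generation J Q n'" by (auto simp: S_def)
    show "E P \<inter> E P' = {}"
    proof (rule ccontr)
      assume "E P \<inter> E P' \<noteq> {}"
      then obtain x where x: "x \<in> E P" "x \<in> E P'" by blast
      then have xX: "x \<in> X P" "x \<in> X P'" by (auto simp: E_def)
      have "\<not> n < n'" "\<not> n' < n" using later n x xX by blast+
      then have "n = n'" by simp
      then show False using g_disj[of P n P' x] n xX \<open>P \<noteq> P'\<close> by blast
    qed
  qed
  define Z where "Z = X Q - (\<Union>P\<in>S. E P)"
  have Es: "E P \<in> sets M" for P unfolding E_def using X by (intro sets.Diff sets.countable_UN') auto
  have Z: "Z \<in> sets M" unfolding Z_def using X Es by (intro sets.Diff sets.countable_UN') auto
  \<comment> \<open>The measure of the part that is covered in every generation.\<close>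
  define N where "N = density M (indicator Z :: 'a \<Rightarrow> ennreal)"
  have sN: "sets N = sets M" by (simp add: N_def)
  have eN: "emeasure N A = emeasure M (Z \<inter> A)" if "A \<in> sets M" for A
    unfolding N_def by (rule emeasure_restricted[OF Z that])
  have JS: "R \<in> S" if "P \<in> S" "R \<in> J P" for P R
    using that unfolding S_def by (metis (no_types, lifting) UN_iff UNIV_I generation.simps(2))
  have decay: "\<forall>P\<in>S. 2^n * emeasure N (X P) \<le> emeasure M (X P)" for n
  proof (induction n)
    case 0
    show ?case using X by (auto simp: eN intro!: emeasure_mono)
  next
    case (Suc n)
    show ?case
    proof
      fix P assume P: "P \<in> S"
      have Js: "(\<Union>R\<in>J P. X R) \<in> sets M" using X by (intro sets.countable_UN') auto
      have "Z \<inter> X P \<subseteq> Z \<inter> (\<Union>R\<in>J P. X R)" using P by (auto simp: Z_def E_def)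
      then have "emeasure N (X P) \<le> emeasure N (\<Union>R\<in>J P. X R)"
        using X Js Z unfolding eN[OF X] eN[OF Js] by (intro emeasure_mono) auto
      then have "2 * (2^n * emeasure N (X P)) \<le> 2 * (2^n * emeasure N (\<Union>R\<in>J P. X R))"
        by (intro mult_left_mono) auto
      also have "\<dots> \<le> 2 * emeasure M (\<Union>R\<in>J P. X R)"
      proof (intro mult_left_mono emeasure_UN_le)
        show "2^n * emeasure N (X R) \<le> emeasure M (X R)" if "R \<in> J P" for R using Suc.IH JS[OF P that] by blast
      qed (use X sN disj in auto)
      also have "\<dots> \<le> emeasure M (X P)" by (rule half)
      finally show "2^Suc n * emeasure N (X P) \<le> emeasure M (X P)" by (simp add: mult.assoc)
    qed
  qed
  have QS: "Q \<in> S" unfolding S_def by (rule UN_I[of 0]) auto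
  have "emeasure N (X Q) = emeasure M Z"
    unfolding eN[OF X] by (rule arg_cong[where f = "emeasure M"]) (auto simp: Z_def)
  then have b: "2^n * emeasure M Z \<le> emeasure M (X Q)" for n using decay[of n] QS by auto
  have "emeasure M Z = 0"
  proof (rule ccontr)
    assume nz: "emeasure M Z \<noteq> 0"
    define z y where "z = measure M Z" and "y = measure M (X Q)"
    have "Z \<subseteq> X Q" by (auto simp: Z_def)
    then have Zf: "emeasure M Z < \<infinity>" using XQ X by (meson emeasure_mono le_less_trans)
    then have ez: "emeasure M Z = ennreal z" "emeasure M (X Q) = ennreal y"
      using XQ by (auto simp: z_def y_def emeasure_eq_ennreal_measure)
    have z: "z > 0" using nz ez by (simp add: z_def zero_less_measure_iff)
    obtain n where "y / z < 2^n" using real_arch_pow[of 2 "y/z"] by auto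
    then have "y < 2^n * z" using z by (simp add: pos_divide_less_eq)
    moreover have "ennreal (2^n * z) \<le> ennreal y"
      using b[of n] z by (simp add: ez ennreal_mult ennreal_power[symmetric])
    then have "2^n * z \<le> y" by (simp add: ennreal_le_iff y_def)
    ultimately show False by simp
  qed
  then show "emeasure M (X Q - (\<Union>P\<in>S. E P)) = 0" by (simp add: Z_def)
qed

text \<open>Each cube keeps at least half of its volume for itself.\<close>

definition sparse_family ::
    "real^'d \<Rightarrow> real \<Rightarrow> (nat \<times> (int^'d)) set \<Rightarrow> (nat \<times> (int^'d) \<Rightarrow> (real^'d) set) \<Rightarrow> bool" where
  "sparse_family a L S E \<longleftrightarrow> disjoint_family_on E S \<and>
    (\<forall>P\<in>S. E P \<in> sets lebesgue \<and> E P \<subseteq> pcell a L P \<and>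
       vol (pcell a L P) \<le> 2 * vol (E P))"

lemma sparse_family_subset: "sparse_family a L S E \<Longrightarrow> F \<subseteq> S \<Longrightarrow> sparse_family a L F E"
  unfolding sparse_family_def by (meson disjoint_family_on_mono subsetD)

context calderon_zygmund
begin

text \<open>Iterating the stopping step along the chain of selected cubes that contain \<open>x\<close> adds one average per cube; the chain ends at
  the cube \<open>P\<close> with \<open>x \<in> E P\<close>.\<close>

lemma sparse_domination:
  obtains C3 where "C3 \<ge> 0"
    "\<And>(a::real^'d) L f Q. L > 0 \<Longrightarrow> nice f \<Longrightarrow> \<exists>S E.
      sparse_family a L S E \<and>
      (AE x in lebesgue. x \<in> pcell a L Q \<longrightarrow>
        (\<exists>F. finite F \<and> F \<subseteq> S \<and> (\<forall>P\<in>F. x \<in> pcell a L P) \<and>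
          cmod (T (cut (pdil a L Q) f) x) \<le> C3 * (\<Sum>P\<in>F. dil_avg a L f P)))"
proof -
  obtain C3 where C3: "C3 \<ge> 0"
    "\<And>(a::real^'d) L f Q. L > 0 \<Longrightarrow> nice f \<Longrightarrow> \<exists>J. stopping_children C3 a L f Q J"
    using stopping_step by blast
  show ?thesis
  proof (rule that[OF C3(1)])
    fix a :: "real^'d" and L :: real and f and Q :: "nat \<times> (int^'d)"
    assume L: "L > 0" and f: "nice (f :: real^'d \<Rightarrow> complex)"
    let ?X = "\<lambda>P. pcell a L P"
    let ?T = "\<lambda>P. T (cut (pdil a L P) f)"
    obtain J where "\<And>Q. stopping_children C3 a L f Q (J Q)"
      using C3(2)[OF L f, of a] by metis
    note J0 = this[unfolded stopping_children_def]
    have J: "\<And>Q P. P \<in> J Q \<Longrightarrow> fst Q < fst P" "\<And>Q P. P \<in> J Q \<Longrightarrow> ?X P \<subseteq> ?X Q"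
      "\<And>Q. disjoint_family_on ?X (J Q)"
      "\<And>Q. 2 * emeasure lebesgue (\<Union>P\<in>J Q. ?X P) \<le> emeasure lebesgue (?X Q)"
      "\<And>Q x. x \<in> ?X Q - (\<Union>P\<in>J Q. ?X P) \<Longrightarrow> cmod (?T Q x) \<le> C3 * dil_avg a L f Q"
      "\<And>Q P. P \<in> J Q \<Longrightarrow> AE x in lebesgue. x \<in> ?X P \<longrightarrow> cmod (?T Q x) \<le> cmod (?T P x) + C3 * dil_avg a L f Q"
      using J0 by blast+
    define S where "S = (\<Union>n. generation J Q n)"
    define E where "E P = ?X P - (\<Union>R\<in>J P. ?X R)" for P
    have Xs: "?X P \<in> sets lebesgue" for P using L by simp
    have Js: "(\<Union>R\<in>J P. ?X R) \<in> sets lebesgue" for P using Xs by (intro sets.countable_UN') auto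
    have XQ: "emeasure lebesgue (?X Q) < \<infinity>" unfolding emeasure_cell[OF L] by simp
    have dis: "disjoint_family_on E S"
      unfolding S_def E_def[abs_def] by (rule stopping_tree_sparse(1)[OF Xs XQ J(2) J(3) J(4)])
    have null: "emeasure lebesgue (?X Q - (\<Union>P\<in>S. E P)) = 0"
      unfolding S_def E_def by (rule stopping_tree_sparse(2)[OF Xs XQ J(2) J(3) J(4)])
    have Es: "E P \<in> sets lebesgue" for P unfolding E_def using Xs Js by (intro sets.Diff)
    have Ehalf: "vol (?X P) \<le> 2 * vol (E P)" for P
    proof -
      have Xf: "?X P \<in> lmeasurable" using L by simp
      have JX: "(\<Union>R\<in>J P. ?X R) \<subseteq> ?X P" using J(2) by blast
      have Jf: "(\<Union>R\<in>J P. ?X R) \<in> lmeasurable" by (rule fmeasurableI2[OF Xf JX Js])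
      have "vol (E P) = vol (?X P) - vol (\<Union>R\<in>J P. ?X R)"
        unfolding E_def by (rule measurable_measure_Diff[OF Xf Js JX])
      moreover have "2 * vol (\<Union>R\<in>J P. ?X R) \<le> vol (?X P)"
      proof -
        have "ennreal (2 * vol (\<Union>R\<in>J P. ?X R)) \<le> ennreal (vol (?X P))"
          using J(4)[of P] emeasure_eq_measure2[OF Xf] emeasure_eq_measure2[OF Jf]
          by (simp add: ennreal_mult del: emeasure_completion)
        then show ?thesis by (simp add: ennreal_le_iff)
      qed
      ultimately show ?thesis by linarith
    qed
    \<comment> \<open>The finite sets \<open>F\<close> are the chains of selected strict ancestors; generations increase strictly along a chain, so no cube is counted twice.\<close>
    have path: "\<exists>F. finite F \<and> F \<subseteq> S \<and> (\<forall>R\<in>F. ?X P \<subseteq> ?X R \<and> fst R < fst P) \<and>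
       (AE x in lebesgue. x \<in> ?X P \<longrightarrow> cmod (?T Q x) \<le> C3 * (\<Sum>R\<in>F. dil_avg a L f R) + cmod (?T P x))"
      if "P \<in> generation J Q n" for n P
      using that
    proof (induction n arbitrary: P)
      case 0
      then show ?case by (intro exI[of _ "{}"]) auto
    next
      case (Suc n)
      then obtain R where R: "R \<in> generation J Q n" "P \<in> J R" by auto
      obtain F where F: "finite F" "F \<subseteq> S" "\<And>R'. R' \<in> F \<Longrightarrow> ?X R \<subseteq> ?X R' \<and> fst R' < fst R"
       "AE x in lebesgue. x \<in> ?X R \<longrightarrow> cmod (?T Q x) \<le> C3 * (\<Sum>R\<in>F. dil_avg a L f R) + cmod (?T R x)"
        using Suc.IH[OF R(1)] by blast
      have "R \<notin> F" using F(3) by blast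
      show ?case
      proof (intro exI[of _ "insert R F"] conjI)
        show "insert R F \<subseteq> S" using F(2) R(1) by (auto simp: S_def)
        show "\<forall>R'\<in>insert R F. ?X P \<subseteq> ?X R' \<and> fst R' < fst P"
        proof
          fix R' assume "R' \<in> insert R F"
          then have "?X R \<subseteq> ?X R' \<and> fst R' \<le> fst R" using F(3)[of R'] by auto
          then show "?X P \<subseteq> ?X R' \<and> fst R' < fst P" using J(1,2)[OF R(2)] by auto
        qed
        show "AE x in lebesgue. x \<in> ?X P \<longrightarrow> cmod (?T Q x) \<le> C3 * (\<Sum>R\<in>insert R F. dil_avg a L f R) + cmod (?T P x)"
          using F(4) J(6)[OF R(2)]
        proof eventually_elim
          case (elim x)
          show ?case
          proof
            assume x: "x \<in> ?X P"
            then have "x \<in> ?X R" using J(2)[OF R(2)] by blast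
            with elim x have "cmod (?T Q x) \<le> C3 * (\<Sum>R\<in>F. dil_avg a L f R) + (cmod (?T P x) + C3 * dil_avg a L f R)" by force
            also have "\<dots> = C3 * (\<Sum>R\<in>insert R F. dil_avg a L f R) + cmod (?T P x)"
              using \<open>R \<notin> F\<close> F(1) by (simp add: algebra_simps)
            finally show "cmod (?T Q x) \<le> C3 * (\<Sum>R\<in>insert R F. dil_avg a L f R) + cmod (?T P x)" .
          qed
        qed
      qed (use F(1) in auto)
    qed
    have onE: "AE x in lebesgue. x \<in> E P \<longrightarrow> (\<exists>F. finite F \<and> F \<subseteq> S \<and> (\<forall>R\<in>F. x \<in> ?X R) \<and>
          cmod (?T Q x) \<le> C3 * (\<Sum>R\<in>F. dil_avg a L f R))" if P: "P \<in> S" for P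
    proof -
      obtain n where "P \<in> generation J Q n" using P by (auto simp: S_def)
      from path[OF this] obtain F where F: "finite F" "F \<subseteq> S" "\<And>R'. R' \<in> F \<Longrightarrow> ?X P \<subseteq> ?X R' \<and> fst R' < fst P"
       "AE x in lebesgue. x \<in> ?X P \<longrightarrow> cmod (?T Q x) \<le> C3 * (\<Sum>R\<in>F. dil_avg a L f R) + cmod (?T P x)" by blast
      have "P \<notin> F" using F(3) by blast
      show ?thesis using F(4)
      proof eventually_elim
        case (elim x)
        show ?case
        proof
          assume x: "x \<in> E P"
          then have xP: "x \<in> ?X P" by (simp add: E_def)
          have "cmod (?T P x) \<le> C3 * dil_avg a L f P" using x by (intro J(5)) (simp add: E_def)
          then have "cmod (?T Q x) \<le> C3 * (\<Sum>R\<in>F. dil_avg a L f R) + C3 * dil_avg a L f P" using elim xP by force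
          also have "\<dots> = C3 * (\<Sum>R\<in>insert P F. dil_avg a L f R)"
            using \<open>P \<notin> F\<close> F(1) by (simp add: algebra_simps)
          finally show "\<exists>F. finite F \<and> F \<subseteq> S \<and> (\<forall>R\<in>F. x \<in> ?X R) \<and> cmod (?T Q x) \<le> C3 * (\<Sum>R\<in>F. dil_avg a L f R)"
            using F(1,2,3) P xP by (intro exI[of _ "insert P F"]) auto
        qed
      qed
    qed
    have "countable S" by simp
    then have all: "AE x in lebesgue. \<forall>P\<in>S. x \<in> E P \<longrightarrow> (\<exists>F. finite F \<and> F \<subseteq> S \<and> (\<forall>R\<in>F. x \<in> ?X R) \<and>
          cmod (?T Q x) \<le> C3 * (\<Sum>R\<in>F. dil_avg a L f R))"
      by (rule AE_ball_countable[THEN iffD2]) (use onE in blast)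
    have "?X Q - (\<Union>P\<in>S. E P) \<in> null_sets lebesgue"
      using null Xs Es by (intro null_setsI sets.Diff sets.countable_UN') auto
    then have "AE x in lebesgue. x \<notin> ?X Q - (\<Union>P\<in>S. E P)" by (rule AE_not_in)
    with all have "AE x in lebesgue. x \<in> ?X Q \<longrightarrow>
        (\<exists>F. finite F \<and> F \<subseteq> S \<and> (\<forall>P\<in>F. x \<in> ?X P) \<and> cmod (?T Q x) \<le> C3 * (\<Sum>P\<in>F. dil_avg a L f P))"
      by eventually_elim blast
    then show "\<exists>S E. sparse_family a L S E \<and>
      (AE x in lebesgue. x \<in> ?X Q \<longrightarrow>
        (\<exists>F. finite F \<and> F \<subseteq> S \<and> (\<forall>P\<in>F. x \<in> ?X P) \<and> cmod (?T Q x) \<le> C3 * (\<Sum>P\<in>F. dil_avg a L f P)))"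
      using dis Es Ehalf unfolding sparse_family_def
      by (intro exI[of _ S] exI[of _ E] conjI ballI) (auto simp: E_def)
  qed
qed

end

section \<open>Sparse sums in the weighted space\<close>

lemma cells_laminar:
  assumes L: "L > 0"
  shows "cell a L k m \<inter> cell a L k' m' = {} \<or> cell a L k m \<subseteq> cell a L k' m' \<or> cell a L k' m' \<subseteq> cell a L k m"
proof -
  have *: "cell a L (k+n) m \<inter> cell a L k m' = {} \<or> cell a L (k+n) m \<subseteq> cell a L k m'" for k n m m'
    using cell_subset_anc[OF L, of a k n m] cell_disjoint[of _ a L k "anc n m" m'] by blast
  show ?thesis
  proof (cases "k \<le> k'")
    case True
    then show ?thesis using *[of k "k' - k" m' m] by auto
  next
    case False
    then show ?thesis using *[of k' "k - k'" m m'] by auto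
  qed
qed

locale muckenhoupt =
  fixes w :: "real^'d \<Rightarrow> real"
  assumes A2: "A2_weight w"
begin

abbreviation wm where "wm \<equiv> weight_measure w"
abbreviation sm where "sm \<equiv> weight_measure (\<lambda>x. inverse (w x))"

definition Aw :: real where "Aw = enn2real (A2_constant w)"

lemma w_meas [measurable]: "w \<in> borel_measurable lebesgue"
  using A2 by (auto simp: A2_weight_def weight_def)

lemma w_pos: "AE x in lebesgue. w x > 0"
  using A2 by (auto simp: A2_weight_def weight_def)

lemma w_integrable: "compact S \<Longrightarrow> w absolutely_integrable_on S"
  using A2 by (auto simp: A2_weight_def weight_def)

lemma sets_wm [simp]: "sets wm = sets lebesgue" "space wm = UNIV"
  and sets_sm [simp]: "sets sm = sets lebesgue" "space sm = UNIV"
  by (simp_all add: weight_measure_def)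

lemma meas_wm [simp]: "borel_measurable wm = borel_measurable lebesgue"
  and meas_sm [simp]: "borel_measurable sm = borel_measurable lebesgue"
  by (rule measurable_cong_sets; simp)+

lemma emeasure_wm: "S \<in> sets lebesgue \<Longrightarrow> emeasure wm S = (\<integral>\<^sup>+x. ennreal (w x) * indicator S x \<partial>lebesgue)"
  and emeasure_sm: "S \<in> sets lebesgue \<Longrightarrow> emeasure sm S = (\<integral>\<^sup>+x. ennreal (inverse (w x)) * indicator S x \<partial>lebesgue)"
  unfolding weight_measure_def by (auto intro!: emeasure_density)

lemma AE_wm: "(AE x in wm. P x) \<longleftrightarrow> (AE x in lebesgue. P x)"
proof -
  have "(AE x in wm. P x) \<longleftrightarrow> (AE x in lebesgue. 0 < ennreal (w x) \<longrightarrow> P x)"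
    unfolding weight_measure_def by (rule AE_density) simp
  also have "\<dots> \<longleftrightarrow> (AE x in lebesgue. P x)"
  proof
    assume "AE x in lebesgue. 0 < ennreal (w x) \<longrightarrow> P x"
    with w_pos show "AE x in lebesgue. P x" by eventually_elim simp
  qed auto
  finally show ?thesis .
qed

lemma wm_bounded_finite:
  assumes "bounded S" "S \<in> sets lebesgue"
  shows "emeasure wm S < \<infinity>"
proof -
  obtain R where "\<forall>x\<in>S. norm x \<le> R" using assms(1) unfolding bounded_iff by blast
  then have R: "S \<subseteq> cball 0 R" by auto
  have "set_integrable lebesgue (cball 0 R) w" by (rule w_integrable) simp
  then have "(\<integral>\<^sup>+x. ennreal (norm (indicator (cball 0 R) x *\<^sub>R w x)) \<partial>lebesgue) < \<infinity>"
    unfolding set_integrable_def by (simp add: integrable_iff_bounded)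
  moreover have "emeasure wm S \<le> (\<integral>\<^sup>+x. ennreal (norm (indicator (cball 0 R) x *\<^sub>R w x)) \<partial>lebesgue)"
    unfolding emeasure_wm[OF assms(2)] using R
    by (intro nn_integral_mono) (auto simp: indicator_def intro!: ennreal_leI)
  ultimately show ?thesis by (rule le_less_trans[rotated])
qed

text \<open>Both densities are positive almost everywhere.\<close>

lemma emeasure_pos:
  assumes "S \<in> sets lebesgue" "emeasure lebesgue S > 0"
  shows "emeasure wm S > 0" "emeasure sm S > 0"
proof -
  have S: "\<not> (AE x in lebesgue. x \<notin> S)" using assms by (simp add: AE_iff_measurable[OF assms(1)] del: emeasure_completion)
  have 1: "emeasure wm S \<noteq> 0"
  proof
    assume "emeasure wm S = 0"
    then have "AE x in lebesgue. ennreal (w x) * indicator S x = 0"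
      unfolding emeasure_wm[OF assms(1)] using assms(1) by (subst (asm) nn_integral_0_iff_AE) auto
    with w_pos have "AE x in lebesgue. x \<notin> S" by eventually_elim (auto simp: indicator_def split: if_splits)
    then show False using S by simp
  qed
  have 2: "emeasure sm S \<noteq> 0"
  proof
    assume "emeasure sm S = 0"
    then have "AE x in lebesgue. ennreal (inverse (w x)) * indicator S x = 0"
      unfolding emeasure_sm[OF assms(1)] using assms(1) by (subst (asm) nn_integral_0_iff_AE) auto
    with w_pos have "AE x in lebesgue. x \<notin> S" by eventually_elim (auto simp: indicator_def split: if_splits)
    then show False using S by simp
  qed
  show "emeasure wm S > 0" "emeasure sm S > 0" using 1 2 by (auto simp: zero_less_iff_neq_zero)
qed

text \<open>The supremum is over closed cubes; a half-open cube has the same Lebesgue measure as its closure and smaller weighted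
  measures. As \<open>w(Q) > 0\<close>, finiteness of the supremum also makes \<open>\<sigma>\<close> integrable on cubes.\<close>

lemma A2_hcube:
  fixes c :: "real^'d"
  assumes r: "r > 0"
  shows "hcube c r \<in> fmeasurable wm" "hcube c r \<in> fmeasurable sm"
    "0 < measure wm (hcube c r)" "0 < measure sm (hcube c r)"
    "measure wm (hcube c r) * measure sm (hcube c r) \<le> Aw * (vol (hcube c r))\<^sup>2"
proof -
  let ?Q = "cbox c (\<chi> i. c$i + r)" and ?chain_kernel = "hcube c r"
  define v where "v = r ^ CARD('d)"
  have v: "v > 0" using r by (simp add: v_def)
  have mQ: "?Q \<in> sets lebesgue" "?chain_kernel \<in> sets lebesgue" by auto
  have eQ: "emeasure lebesgue ?Q = ennreal v" "emeasure lebesgue ?chain_kernel = ennreal v"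
    unfolding v_def by (rule emeasure_cubes[OF r])+
  have posQ: "emeasure wm ?Q > 0" "emeasure sm ?Q > 0" "emeasure wm ?chain_kernel > 0" "emeasure sm ?chain_kernel > 0"
    using emeasure_pos[OF mQ(1)] emeasure_pos[OF mQ(2)] eQ v by (simp_all del: emeasure_completion)
  have finw: "emeasure wm ?Q < \<infinity>" by (rule wm_bounded_finite) (auto intro: bounded_cbox)
  have "?Q \<in> cubes" unfolding cubes_def using r by blast
  then have "emeasure wm ?Q / emeasure lebesgue ?Q * (emeasure sm ?Q / emeasure lebesgue ?Q) \<le> A2_constant w"
    unfolding A2_constant_def by (rule SUP_upper)
  also have "A2_constant w = ennreal Aw"
    using A2 unfolding Aw_def A2_weight_def by (simp add: ennreal_enn2real)
  finally have le: "emeasure wm ?Q / ennreal v * (emeasure sm ?Q / ennreal v) \<le> ennreal Aw" unfolding eQ .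
  obtain p where p: "emeasure wm ?Q = ennreal p" "p > 0"
    using finw posQ(1) by (cases "emeasure wm ?Q") (auto simp: ennreal_less_zero_iff)
  have wv: "emeasure wm ?Q / ennreal v = ennreal (p / v)" unfolding p using p v by (intro divide_ennreal) auto
  have fins: "emeasure sm ?Q < \<infinity>"
  proof (rule ccontr)
    assume "\<not> emeasure sm ?Q < \<infinity>"
    then have "emeasure sm ?Q = \<infinity>" by (simp add: less_top[symmetric])
    then have "emeasure sm ?Q / ennreal v = \<infinity>" by (simp add: ennreal_top_divide)
    then show False using le p v unfolding wv by (simp add: ennreal_mult_top top_unique)
  qed
  obtain s where s: "emeasure sm ?Q = ennreal s" "s > 0"
    using fins posQ(2) by (cases "emeasure sm ?Q") (auto simp: ennreal_less_zero_iff)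
  have sv: "emeasure sm ?Q / ennreal v = ennreal (s / v)" unfolding s using s v by (intro divide_ennreal) auto
  have Aw0: "0 \<le> Aw" by (simp add: Aw_def)
  have "ennreal (p / v * (s / v)) \<le> ennreal Aw" using le ennreal_mult[of "p / v" "s / v"] p s v unfolding wv sv by simp
  then have "p / v * (s / v) \<le> Aw" using Aw0 by (simp add: ennreal_le_iff)
  then have ps: "p * s \<le> Aw * v\<^sup>2" using v by (simp add: field_simps power2_eq_square)
  have leQ: "emeasure wm ?chain_kernel \<le> ennreal p" "emeasure sm ?chain_kernel \<le> ennreal s"
    unfolding p(1)[symmetric] s(1)[symmetric] by (rule emeasure_mono[OF hcube_between(2)], simp)+
  show fm: "?chain_kernel \<in> fmeasurable wm" "?chain_kernel \<in> fmeasurable sm"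
    using leQ by (intro fmeasurableI; auto intro: le_less_trans)+
  then have em: "emeasure wm ?chain_kernel = ennreal (measure wm ?chain_kernel)" "emeasure sm ?chain_kernel = ennreal (measure sm ?chain_kernel)"
    by (simp_all add: emeasure_eq_measure2)
  show "0 < measure wm ?chain_kernel" "0 < measure sm ?chain_kernel" using posQ em by (simp_all add: ennreal_less_zero_iff)
  have "measure wm ?chain_kernel \<le> p" "measure sm ?chain_kernel \<le> s" using leQ unfolding em using p s by (simp_all add: ennreal_le_iff)
  then have "measure wm ?chain_kernel * measure sm ?chain_kernel \<le> p * s" using p by (intro mult_mono) auto
  also have "\<dots> \<le> Aw * v\<^sup>2" by (rule ps)
  also have "v = vol ?chain_kernel" unfolding measure_def eQ using v by simp
  finally show "measure wm ?chain_kernel * measure sm ?chain_kernel \<le> Aw * (vol ?chain_kernel)\<^sup>2" .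
qed

lemma Aw_pos: "Aw > 0"
proof -
  have "0 < measure wm (hcube 0 1) * measure sm (hcube 0 1)"
    using A2_hcube(3,4)[of 1 0] by simp
  also have "\<dots> \<le> Aw * (vol (hcube (0::real^'d) 1))\<^sup>2" using A2_hcube(5)[of 1 0] by simp
  finally show ?thesis by (simp add: zero_less_mult_iff)
qed

lemma integral_wm:
  fixes g :: "real^'d \<Rightarrow> real"
  assumes "g \<in> borel_measurable lebesgue"
  shows "(LINT x|wm. g x) = (LINT x|lebesgue. w x * g x)" "integrable wm g \<longleftrightarrow> integrable lebesgue (\<lambda>x. w x * g x)"
proof -
  have "AE x in lebesgue. 0 \<le> w x" using w_pos by (rule AE_mp) auto
  then show "(LINT x|wm. g x) = (LINT x|lebesgue. w x * g x)" "integrable wm g \<longleftrightarrow> integrable lebesgue (\<lambda>x. w x * g x)"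
    unfolding weight_measure_def using assms by (simp_all add: integral_density integrable_density)
qed

lemma integral_sm:
  fixes g :: "real^'d \<Rightarrow> real"
  assumes "g \<in> borel_measurable lebesgue"
  shows "(LINT x|sm. g x) = (LINT x|lebesgue. inverse (w x) * g x)"
    "integrable sm g \<longleftrightarrow> integrable lebesgue (\<lambda>x. inverse (w x) * g x)"
proof -
  have "AE x in lebesgue. 0 \<le> inverse (w x)" using w_pos by (rule AE_mp) auto
  then show "(LINT x|sm. g x) = (LINT x|lebesgue. inverse (w x) * g x)"
    "integrable sm g \<longleftrightarrow> integrable lebesgue (\<lambda>x. inverse (w x) * g x)"
    unfolding weight_measure_def using assms by (simp_all add: integral_density integrable_density)
qed

lemma nice_integrable_wm:
  assumes f: "nice f"
  shows "integrable wm (\<lambda>x. cmod (f x))" "integrable wm (\<lambda>x. (cmod (f x))\<^sup>2)"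
proof -
  have *: "integrable wm (\<lambda>x. cmod (g x))" if g: "nice g" for g
  proof -
    obtain B R where *: "g \<in> borel_measurable lebesgue" "B > 0" "\<And>x. cmod (g x) \<le> B" "\<And>x. g x \<noteq> 0 \<Longrightarrow> norm x \<le> R"
      using niceE[OF g] by metis
    note [measurable] = *(1)
    have "emeasure wm (cball 0 R) < \<infinity>" by (rule wm_bounded_finite) auto
    then have "integrable wm (\<lambda>x. B * indicator (cball 0 R) x :: real)"
      by (intro integrable_mult_right) (simp add: integrable_indicator_iff)
    then show ?thesis
    proof (rule Bochner_Integration.integrable_bound)
      show "(\<lambda>x. cmod (g x)) \<in> borel_measurable wm" by simp
      have "norm (cmod (g x)) \<le> norm (B * indicator (cball 0 R) x :: real)" for x
        using *(2) *(3)[of x] *(4)[of x] by (cases "g x = 0") (auto simp: indicator_def)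
      then show "AE x in wm. norm (cmod (g x)) \<le> norm (B * indicator (cball 0 R) x :: real)" by simp
    qed
  qed
  show "integrable wm (\<lambda>x. cmod (f x))" by (rule *[OF f])
  show "integrable wm (\<lambda>x. (cmod (f x))\<^sup>2)" using *[OF nice_sq[OF f]] by (simp add: norm_power)
qed

text \<open>Since \<open>\<sigma>w = 1\<close>, the inequality \<open>2xy \<le> \<theta>x\<^sup>2\<sigma> + y\<^sup>2w/\<theta>\<close> holds pointwise; integrate it over \<open>E\<close>. It replaces the
  Cauchy-Schwarz inequality \<open>|E|\<^sup>2 \<le> \<sigma>(E) w(E)\<close>.\<close>

lemma weighted_am_gm:
  assumes E: "E \<in> lmeasurable" "E \<in> fmeasurable wm" "E \<in> fmeasurable sm" and th: "\<theta> > 0"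
  shows "2 * x * y * vol E \<le> \<theta> * x\<^sup>2 * measure sm E + y\<^sup>2 / \<theta> * measure wm E"
proof -
  have Es [measurable]: "E \<in> sets lebesgue" using E(1) by (rule fmeasurableD)
  have m: "(indicator E :: real^'d \<Rightarrow> real) \<in> borel_measurable lebesgue" by measurable
  have i1: "integrable lebesgue (\<lambda>z. w z * indicator E z)" "(LINT z|lebesgue. w z * indicator E z) = measure wm E"
    using integral_wm[OF m] E(2) by (auto simp: integrable_indicator_iff fmeasurable_def)
  have i2: "integrable lebesgue (\<lambda>z. inverse (w z) * indicator E z)" "(LINT z|lebesgue. inverse (w z) * indicator E z) = measure sm E"
    using integral_sm[OF m] E(3) by (auto simp: integrable_indicator_iff fmeasurable_def)
  have i0: "integrable lebesgue (indicator E :: real^'d \<Rightarrow> real)" "(LINT z|lebesgue. indicator E z) = vol E"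
    using E(1) by (auto simp: integrable_indicator_iff fmeasurable_def simp del: emeasure_completion)
  have "(LINT z|lebesgue. 2 * x * y * indicator E z) \<le>
     (LINT z|lebesgue. \<theta> * x\<^sup>2 * (inverse (w z) * indicator E z) + y\<^sup>2 / \<theta> * (w z * indicator E z))"
  proof (rule integral_mono_AE)
    show "AE z in lebesgue. 2 * x * y * indicator E z \<le> \<theta> * x\<^sup>2 * (inverse (w z) * indicator E z) + y\<^sup>2 / \<theta> * (w z * indicator E z)"
      using w_pos
    proof eventually_elim
      case (elim z)
      have "\<theta> * x\<^sup>2 * inverse (w z) + y\<^sup>2 / \<theta> * w z - 2 * x * y = (\<theta> * x - y * w z)\<^sup>2 / (\<theta> * w z)"
        using elim th by (simp add: field_simps power2_eq_square)
      moreover have "\<dots> \<ge> 0" using elim th by simp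
      ultimately have "2 * x * y \<le> \<theta> * x\<^sup>2 * inverse (w z) + y\<^sup>2 / \<theta> * w z" by linarith
      then show ?case by (auto simp: indicator_def)
    qed
  qed (use i0 i1 i2 in \<open>auto intro!: integrable_mult_right Bochner_Integration.integrable_add\<close>)
  also have "\<dots> = \<theta> * x\<^sup>2 * measure sm E + y\<^sup>2 / \<theta> * measure wm E"
    using i1 i2 by (subst Bochner_Integration.integral_add) (auto intro!: integrable_mult_right)
  finally show ?thesis using i0 by simp
qed

lemma A2_cell:
  assumes L: "L > 0"
  shows "cell a L k m \<in> fmeasurable wm" "cell a L k m \<in> fmeasurable sm" "0 < measure wm (cell a L k m)"
    "0 < measure sm (cell a L k m)"
  unfolding cell_eq_hcube[OF L] using L by (intro A2_hcube; simp)+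

lemma A2_dil:
  fixes a :: "real^'d" and m :: "int^'d"
  assumes L: "L > 0"
  shows "dil a L k m \<in> fmeasurable wm" "dil a L k m \<in> fmeasurable sm" "0 < measure wm (dil a L k m)"
    "0 < measure sm (dil a L k m)"
    "measure wm (dil a L k m) * measure sm (dil a L k m) \<le> Aw * (vol (dil a L k m))\<^sup>2"
proof -
  have r: "(4 * real CARD('d) + 3) * L/2^k > 0" using L by (simp add: add_nonneg_pos)
  show "dil a L k m \<in> fmeasurable wm" "dil a L k m \<in> fmeasurable sm" "0 < measure wm (dil a L k m)"
    "0 < measure sm (dil a L k m)"
    "measure wm (dil a L k m) * measure sm (dil a L k m) \<le> Aw * (vol (dil a L k m))\<^sup>2"
    unfolding dil_eq_hcube[OF L] by (rule A2_hcube[OF r])+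
qed

text \<open>With \<open>h = |f|w\<close> one has \<open>\<integral>h\<^sup>2\<sigma> = \<integral>|f|\<^sup>2w\<close>, and averages of \<open>|f|\<close> become \<open>\<sigma>\<close>-averages of \<open>h\<close>. Each summand of
  \<open>\<integral>G\<^sup>2w\<close> is split by \<open>weighted_am_gm\<close> into a \<open>\<sigma>\<close>-part and a \<open>w\<close>-part. The former sums to a multiple of \<open>\<integral>|f|\<^sup>2w\<close>, the
  latter to a multiple of \<open>\<integral>G\<^sup>2w\<close>, which is absorbed.\<close>

lemma sparse_sum_bound:
  fixes a :: "real^'d" and F :: "(nat \<times> (int^'d)) set"
  assumes L: "L > 0" and f: "nice f" and F: "finite F"
    and sparse: "sparse_family a L F E"
  defines "G \<equiv> \<lambda>x. \<Sum>P\<in>F. dil_avg a L f P * indicator (pcell a L P) x"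
    and "Al \<equiv> (4 * real CARD('d) + 3)^CARD('d)" and "Ncl \<equiv> real (card (classes :: (int^'d) set))"
  shows "integrable wm (\<lambda>x. (G x)\<^sup>2)" "(LINT x|wm. (G x)\<^sup>2) \<le> 64 * Al\<^sup>2 * Ncl * Aw\<^sup>2 * (LINT x|wm. (cmod (f x))\<^sup>2)"
proof -
  let ?X = "\<lambda>P. pcell a L P"
  let ?D = "\<lambda>P. pdil a L P"
  have E: "\<And>P. P \<in> F \<Longrightarrow> E P \<in> sets lebesgue" "\<And>P. P \<in> F \<Longrightarrow> E P \<subseteq> ?X P"
      "\<And>P. P \<in> F \<Longrightarrow> vol (?X P) \<le> 2 * vol (E P)" "disjoint_family_on E F"
    using sparse by (auto simp: sparse_family_def)
  have [measurable]: "f \<in> borel_measurable lebesgue" by (rule nice_measurable[OF f])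
  have Xs [measurable]: "?X P \<in> sets lebesgue" and Ds [measurable]: "?D P \<in> sets lebesgue" for P using L by auto
  have Al1: "Al \<ge> 1" unfolding Al_def by (intro one_le_power) simp
  have G0: "0 \<le> G x" for x unfolding G_def by (intro sum_nonneg mult_nonneg_nonneg dil_avg_nonneg) auto
  have Gn: "nice (\<lambda>x. complex_of_real (G x))"
  proof -
    have "nice (\<lambda>x. \<Sum>P\<in>F. complex_of_real (dil_avg a L f P) * indicator (?X P) x)"
      by (intro nice_sum nice_indicator_cell L)
    moreover have "complex_of_real (indicator S x) = indicator S x" for S and x :: "real^'d" by (simp add: indicator_def)
    ultimately show ?thesis by (simp add: G_def)
  qed
  have iG2: "integrable wm (\<lambda>x. (G x)\<^sup>2)" using nice_integrable_wm(2)[OF Gn] by simp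
  then show "integrable wm (\<lambda>x. (G x)\<^sup>2)" .
  have iXG: "integrable wm (\<lambda>x. indicator (?X P) x * G x)" for P
  proof -
    have "integrable wm (\<lambda>x. cmod (cut (?X P) (\<lambda>x. complex_of_real (G x)) x))"
      by (intro nice_integrable_wm nice_cut Gn Xs)
    moreover have "cmod (cut (?X P) (\<lambda>x. complex_of_real (G x)) x) = indicator (?X P) x * G x" for x
      using G0[of x] by (simp add: cut_def)
    ultimately show ?thesis by simp
  qed
  define \<Phi> where "\<Phi> = (LINT x|wm. (cmod (f x))\<^sup>2)"
  define N2 where "N2 = (LINT x|wm. (G x)\<^sup>2)"
  have \<Phi>0: "0 \<le> \<Phi>" by (simp add: \<Phi>_def integral_nonneg_AE)
  \<comment> \<open>The absolute value makes \<open>h\<close> nonnegative on the null set where \<open>w\<close> may be negative.\<close>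
  define h where "h x = cmod (f x) * \<bar>w x\<bar>" for x
  have hm [measurable]: "h \<in> borel_measurable lebesgue" unfolding h_def by measurable
  have h2: "integrable sm (\<lambda>x. (h x)\<^sup>2)" "(LINT x|sm. (h x)\<^sup>2) = \<Phi>"
  proof -
    have ae: "AE x in lebesgue. inverse (w x) * (h x)\<^sup>2 = w x * (cmod (f x))\<^sup>2"
      using w_pos by eventually_elim (simp add: h_def power2_eq_square field_simps)
    have m1: "(\<lambda>x. (h x)\<^sup>2) \<in> borel_measurable lebesgue" and m2: "(\<lambda>x. (cmod (f x))\<^sup>2) \<in> borel_measurable lebesgue"
      by measurable
    have "integrable lebesgue (\<lambda>x. inverse (w x) * (h x)\<^sup>2) \<longleftrightarrow> integrable lebesgue (\<lambda>x. w x * (cmod (f x))\<^sup>2)"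
      by (rule integrable_cong_AE[OF _ _ ae]) measurable
    then show "integrable sm (\<lambda>x. (h x)\<^sup>2)"
      using nice_integrable_wm(2)[OF f] integral_wm(2)[OF m2] integral_sm(2)[OF m1] by simp
    have "(LINT x|lebesgue. inverse (w x) * (h x)\<^sup>2) = (LINT x|lebesgue. w x * (cmod (f x))\<^sup>2)"
      by (rule integral_cong_AE[OF _ _ ae]) measurable
    then show "(LINT x|sm. (h x)\<^sup>2) = \<Phi>"
      unfolding \<Phi>_def using integral_wm(1)[OF m2] integral_sm(1)[OF m1] by simp
  qed
  have hD: "integrable sm (\<lambda>x. indicator (?D P) x * h x)" "(LINT x|sm. indicator (?D P) x * h x) = mass f (?D P)" for P
  proof -
    have ae: "AE x in lebesgue. inverse (w x) * (indicator (?D P) x * h x) = cmod (cut (?D P) f x)"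
      using w_pos by eventually_elim (simp add: h_def cut_def)
    have m1: "(\<lambda>x. indicator (?D P) x * h x) \<in> borel_measurable lebesgue" by measurable
    have c: "nice (cut (?D P) f)" by (intro nice_cut f Ds)
    have m2: "(\<lambda>x. cmod (cut (?D P) f x)) \<in> borel_measurable lebesgue" using nice_measurable[OF c] by measurable
    have "integrable lebesgue (\<lambda>x. inverse (w x) * (indicator (?D P) x * h x)) \<longleftrightarrow> integrable lebesgue (\<lambda>x. cmod (cut (?D P) f x))"
      by (rule integrable_cong_AE[OF _ m2 ae]) measurable
    then show "integrable sm (\<lambda>x. indicator (?D P) x * h x)"
      using nice_integrable(2)[OF c] integral_sm(2)[OF m1] by simp
    have "(LINT x|lebesgue. inverse (w x) * (indicator (?D P) x * h x)) = (LINT x|lebesgue. cmod (cut (?D P) f x))"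
      by (rule integral_cong_AE[OF _ m2 ae]) measurable
    also have "(\<lambda>x. cmod (cut (?D P) f x)) = (\<lambda>x. indicator (?D P) x * cmod (f x))" by (auto simp: cut_def)
    also have "(LINT x|lebesgue. indicator (?D P) x * cmod (f x)) = mass f (?D P)" by (rule mass_eq_integral[OF f Ds, symmetric])
    finally show "(LINT x|sm. indicator (?D P) x * h x) = mass f (?D P)" unfolding integral_sm(1)[OF m1] .
  qed
  define A where "A P = (LINT x|sm. indicator (?D P) x * h x) / measure sm (?D P)" for P
  define B where "B P = (LINT x|wm. indicator (?X P) x * G x) / measure wm (?X P)" for P
  have A0: "0 \<le> A P" for P unfolding A_def by (auto simp: h_def intro!: divide_nonneg_nonneg integral_nonneg_AE)
  have B0: "0 \<le> B P" for P unfolding B_def using G0 by (auto intro!: divide_nonneg_nonneg integral_nonneg_AE)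
  have sumB: "(\<Sum>P\<in>F. (B P)\<^sup>2 * measure wm (E P)) \<le> 4 * N2"
    unfolding B_def N2_def
  proof (rule laminar_maximal)
    show "?X P \<inter> ?X P' = {} \<or> ?X P \<subseteq> ?X P' \<or> ?X P' \<subseteq> ?X P" for P P' by (rule cells_laminar[OF L])
  qed (use F E iXG iG2 G0 A2_cell[OF L] in auto)
  have "\<forall>P. \<exists>t s. t \<in> classes \<and> ?D P = cell (\<chi> i. a$i + L * t$i) ((4 * real CARD('d) + 3) * L) (fst P) s"
  proof
    fix P :: "nat \<times> (int^'d)"
    obtain t s :: "int^'d" where "\<forall>i. 0 \<le> t$i \<and> t$i < 4 * int CARD('d) + 3"
      "?D P = cell (\<chi> i. a$i + L * t$i) ((4 * real CARD('d) + 3) * L) (fst P) s"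
      by (rule dil_is_cell[OF L])
    then show "\<exists>t s. t \<in> classes \<and> ?D P = cell (\<chi> i. a$i + L * t$i) ((4 * real CARD('d) + 3) * L) (fst P) s"
      by (intro exI[of _ t] exI[of _ s]) (simp add: classes_def)
  qed
  from choice[OF this] obtain cl where
    "\<forall>P. \<exists>s. cl P \<in> classes \<and> ?D P = cell (\<chi> i. a$i + L * cl P$i) ((4 * real CARD('d) + 3) * L) (fst P) s" by blast
  from choice[OF this] obtain s where
    "\<forall>P. cl P \<in> classes \<and> ?D P = cell (\<chi> i. a$i + L * cl P$i) ((4 * real CARD('d) + 3) * L) (fst P) (s P)" by blast
  then have cl: "\<And>P. cl P \<in> classes"
    "\<And>P. ?D P = cell (\<chi> i. a$i + L * cl P$i) ((4 * real CARD('d) + 3) * L) (fst P) (s P)" by auto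
  have sumA: "(\<Sum>P\<in>F. (A P)\<^sup>2 * measure sm (E P)) \<le> Ncl * (4 * \<Phi>)"
  proof -
    have "(\<Sum>P\<in>F. (A P)\<^sup>2 * measure sm (E P)) = (\<Sum>t\<in>classes. \<Sum>P\<in>{P\<in>F. cl P = t}. (A P)\<^sup>2 * measure sm (E P))"
      using cl by (intro sum.group[symmetric] F finite_classes) auto
    also have "\<dots> \<le> (\<Sum>t\<in>(classes :: (int^'d) set). 4 * \<Phi>)"
    proof (rule sum_mono)
      fix t :: "int^'d"
      show "(\<Sum>P\<in>{P\<in>F. cl P = t}. (A P)\<^sup>2 * measure sm (E P)) \<le> 4 * \<Phi>"
        unfolding A_def h2(2)[symmetric]
      proof (rule laminar_maximal)
        fix P P' assume "P \<in> {P \<in> F. cl P = t}" "P' \<in> {P \<in> F. cl P = t}"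
        then have P: "cl P = t" "cl P' = t" by auto
        have pos: "(4 * real CARD('d) + 3) * L > 0" using L by (simp add: add_nonneg_pos)
        show "?D P \<inter> ?D P' = {} \<or> ?D P \<subseteq> ?D P' \<or> ?D P' \<subseteq> ?D P"
          unfolding cl(2) P by (rule cells_laminar[OF pos])
      next
        show "disjoint_family_on E {P \<in> F. cl P = t}" using E(4) by (rule disjoint_family_on_mono[rotated]) auto
      next
        fix P assume "P \<in> {P \<in> F. cl P = t}"
        then show "E P \<subseteq> ?D P" using E(2)[of P] cell_subset_dil by blast
      qed (use F E hD h2 A2_dil[OF L] in \<open>auto simp: h_def\<close>)
    qed
    also have "\<dots> = Ncl * (4 * \<Phi>)" by (simp add: Ncl_def)
    finally show ?thesis .
  qed
  \<comment> \<open>Chosen such that the \<open>w\<close>-parts add up to half of \<open>N2\<close>.\<close>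
  define \<theta> where "\<theta> = 8 * Al * Aw"
  have \<theta>: "\<theta> > 0" using Al1 Aw_pos by (simp add: \<theta>_def)
  have summand: "dil_avg a L f P * (LINT x|wm. indicator (?X P) x * G x) \<le>
     Aw * Al * (\<theta> * ((A P)\<^sup>2 * measure sm (E P)) + (1 / \<theta>) * ((B P)\<^sup>2 * measure wm (E P)))" if P: "P \<in> F" for P
  proof -
    have D: "measure sm (?D P) > 0" "measure wm (?D P) > 0" "vol (?D P) > 0"
      using A2_dil[OF L, of a "fst P" "snd P"] measure_dil_pos[OF L] by auto
    have X: "measure wm (?X P) > 0" using A2_cell[OF L] by auto
    have wXD: "measure wm (?X P) \<le> measure wm (?D P)"
      using A2_dil(1)[OF L, of a "fst P" "snd P"] by (intro measure_mono_fmeasurable cell_subset_dil) auto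
    have "dil_avg a L f P * (LINT x|wm. indicator (?X P) x * G x) = (A P * measure sm (?D P) / vol (?D P)) * (B P * measure wm (?X P))"
      using D X by (simp add: A_def B_def dil_avg_def hD)
    also have "\<dots> \<le> (A P * measure sm (?D P) / vol (?D P)) * (B P * measure wm (?D P))"
      using wXD A0 B0 by (intro mult_left_mono divide_nonneg_nonneg mult_nonneg_nonneg) auto
    also have "\<dots> = A P * B P / vol (?D P) * (measure wm (?D P) * measure sm (?D P))" by simp
    also have "\<dots> \<le> A P * B P / vol (?D P) * (Aw * (vol (?D P))\<^sup>2)"
      using A2_dil(5)[OF L] A0 B0 by (intro mult_left_mono divide_nonneg_nonneg mult_nonneg_nonneg) auto
    also have "\<dots> = Aw * (A P * B P) * vol (?D P)" using D by (simp add: power2_eq_square)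
    also have "\<dots> \<le> Aw * (A P * B P) * (Al * (2 * vol (E P)))"
    proof (rule mult_left_mono)
      show "vol (?D P) \<le> Al * (2 * vol (E P))"
        unfolding measure_dil_cell[OF L] Al_def[symmetric] using E(3)[OF P] Al1 by (intro mult_left_mono) auto
    qed (use A0 B0 Aw_pos in auto)
    also have "\<dots> = Aw * Al * (2 * A P * B P * vol (E P))" by simp
    also have "\<dots> \<le> Aw * Al * (\<theta> * (A P)\<^sup>2 * measure sm (E P) + (B P)\<^sup>2 / \<theta> * measure wm (E P))"
    proof (rule mult_left_mono[OF weighted_am_gm[OF _ _ _ \<theta>]])
      show "E P \<in> lmeasurable" by (rule fmeasurableI2[OF cell_lmeasurable[OF L] E(2)[OF P] E(1)[OF P]])
      show "E P \<in> fmeasurable wm" "E P \<in> fmeasurable sm"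
        using E(1)[OF P] by (simp_all add: fmeasurableI2[OF A2_cell(1)[OF L] E(2)[OF P]] fmeasurableI2[OF A2_cell(2)[OF L] E(2)[OF P]])
    qed (use Aw_pos Al1 in auto)
    finally show ?thesis by (simp add: mult_ac)
  qed
  have "N2 = (LINT x|wm. (\<Sum>P\<in>F. dil_avg a L f P * (indicator (?X P) x * G x)))"
    unfolding N2_def by (intro Bochner_Integration.integral_cong refl)
      (simp add: power2_eq_square G_def sum_distrib_right mult.assoc)
  also have "\<dots> = (\<Sum>P\<in>F. dil_avg a L f P * (LINT x|wm. indicator (?X P) x * G x))"
    using iXG by (subst Bochner_Integration.integral_sum) (auto intro!: integrable_mult_right)
  also have "\<dots> \<le> (\<Sum>P\<in>F. Aw * Al * (\<theta> * ((A P)\<^sup>2 * measure sm (E P)) + (1 / \<theta>) * ((B P)\<^sup>2 * measure wm (E P))))"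
    by (rule sum_mono) (rule summand)
  also have "\<dots> = Aw * Al * (\<theta> * (\<Sum>P\<in>F. (A P)\<^sup>2 * measure sm (E P)) + (1 / \<theta>) * (\<Sum>P\<in>F. (B P)\<^sup>2 * measure wm (E P)))"
    by (simp only: sum.distrib[symmetric] sum_distrib_left)
  also have "\<dots> \<le> Aw * Al * (\<theta> * (Ncl * (4 * \<Phi>)) + (1 / \<theta>) * (4 * N2))"
    using sumA sumB \<theta> Aw_pos Al1 by (intro mult_left_mono add_mono) auto
  also have "\<dots> = 32 * Al\<^sup>2 * Ncl * Aw\<^sup>2 * \<Phi> + N2 / 2"
    unfolding \<theta>_def using Al1 Aw_pos by (simp add: field_simps power2_eq_square)
  finally show "(LINT x|wm. (G x)\<^sup>2) \<le> 64 * Al\<^sup>2 * Ncl * Aw\<^sup>2 * (LINT x|wm. (cmod (f x))\<^sup>2)"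
    by (simp add: N2_def \<Phi>_def)
qed

end

section \<open>From bounded functions to the weighted space\<close>

definition sqnorm :: "'a measure \<Rightarrow> ('a \<Rightarrow> complex) \<Rightarrow> real" where
  "sqnorm M f = (LINT x|M. (cmod (f x))\<^sup>2)"

lemma sqnorm_nonneg: "0 \<le> sqnorm M f"
  by (simp add: sqnorm_def integral_nonneg_AE)

lemma L2_norm_sqnorm: "L2_norm M f = sqrt (sqnorm M f)"
  by (simp add: L2_norm_def sqnorm_def)

lemma L2_I:
  assumes "f \<in> borel_measurable M" "(\<integral>\<^sup>+x. ennreal ((cmod (f x))\<^sup>2) \<partial>M) \<le> ennreal b" "0 \<le> b"
  shows "f \<in> L2 M" "sqnorm M f \<le> b"
proof -
  have [measurable]: "f \<in> borel_measurable M" by fact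
  have i: "integrable M (\<lambda>x. (cmod (f x))\<^sup>2)"
    using assms(2) by (intro integrableI_nonneg) (auto intro: le_less_trans)
  then show "f \<in> L2 M" using assms(1) by (simp add: L2_def)
  have "ennreal (sqnorm M f) \<le> ennreal b"
    unfolding sqnorm_def using nn_integral_eq_integral[OF i] assms(2) by simp
  then show "sqnorm M f \<le> b" using assms(3) by (simp add: ennreal_le_iff)
qed

lemma L2_nn_integral:
  assumes "f \<in> L2 M"
  shows "(\<integral>\<^sup>+x. ennreal ((cmod (f x))\<^sup>2) \<partial>M) = ennreal (sqnorm M f)"
  using assms unfolding sqnorm_def L2_def by (intro nn_integral_eq_integral) auto

lemma cmod_add_sq: "(cmod (a + b))\<^sup>2 \<le> 2 * (cmod a)\<^sup>2 + 2 * (cmod b)\<^sup>2"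
proof -
  have "(cmod (a + b))\<^sup>2 \<le> (cmod a + cmod b)\<^sup>2" by (intro power_mono norm_triangle_ineq) simp
  also have "\<dots> = 2 * (cmod a)\<^sup>2 + 2 * (cmod b)\<^sup>2 - (cmod a - cmod b)\<^sup>2" by (simp add: power2_eq_square algebra_simps)
  finally show ?thesis by (smt (verit) zero_le_power2)
qed

lemma L2_add:
  assumes f: "f \<in> L2 M" and g: "g \<in> L2 M"
  shows "(\<lambda>x. f x + g x) \<in> L2 M" "sqnorm M (\<lambda>x. f x + g x) \<le> 2 * sqnorm M f + 2 * sqnorm M g"
proof -
  have i: "integrable M (\<lambda>x. (cmod (f x))\<^sup>2)" "integrable M (\<lambda>x. (cmod (g x))\<^sup>2)"
    and [measurable]: "f \<in> borel_measurable M" "g \<in> borel_measurable M"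
    using f g by (auto simp: L2_def)
  have d: "integrable M (\<lambda>x. 2 * (cmod (f x))\<^sup>2 + 2 * (cmod (g x))\<^sup>2)" using i by auto
  have i2: "integrable M (\<lambda>x. (cmod (f x + g x))\<^sup>2)"
    by (rule Bochner_Integration.integrable_bound[OF d]) (use cmod_add_sq in auto)
  then show "(\<lambda>x. f x + g x) \<in> L2 M" by (simp add: L2_def)
  have "sqnorm M (\<lambda>x. f x + g x) \<le> (LINT x|M. 2 * (cmod (f x))\<^sup>2 + 2 * (cmod (g x))\<^sup>2)"
    unfolding sqnorm_def by (rule integral_mono[OF i2 d cmod_add_sq])
  also have "\<dots> = 2 * sqnorm M f + 2 * sqnorm M g" using i by (simp add: sqnorm_def)
  finally show "sqnorm M (\<lambda>x. f x + g x) \<le> 2 * sqnorm M f + 2 * sqnorm M g" .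
qed

lemma L2_scale:
  assumes "f \<in> L2 M"
  shows "(\<lambda>x. c * f x) \<in> L2 M" "sqnorm M (\<lambda>x. c * f x) = (cmod c)\<^sup>2 * sqnorm M f"
  using assms by (auto simp: L2_def sqnorm_def norm_mult power_mult_distrib)

lemma L2_diff:
  assumes f: "f \<in> L2 M" and g: "g \<in> L2 M"
  shows "(\<lambda>x. f x - g x) \<in> L2 M" "sqnorm M (\<lambda>x. f x - g x) \<le> 2 * sqnorm M f + 2 * sqnorm M g"
  using L2_add[OF f L2_scale(1)[OF g, of "-1"]] L2_scale(2)[OF g, of "-1"] by simp_all

lemma sqnorm_cong_AE:
  assumes "f \<in> borel_measurable M" "g \<in> borel_measurable M" "AE x in M. f x = g x"
  shows "sqnorm M f = sqnorm M g" "f \<in> L2 M \<longleftrightarrow> g \<in> L2 M"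
proof -
  have [measurable]: "f \<in> borel_measurable M" "g \<in> borel_measurable M" by fact+
  have ae: "AE x in M. (cmod (f x))\<^sup>2 = (cmod (g x))\<^sup>2" using assms(3) by eventually_elim simp
  show "sqnorm M f = sqnorm M g" unfolding sqnorm_def by (rule integral_cong_AE[OF _ _ ae]) measurable
  have "integrable M (\<lambda>x. (cmod (f x))\<^sup>2) \<longleftrightarrow> integrable M (\<lambda>x. (cmod (g x))\<^sup>2)"
    by (rule integrable_cong_AE[OF _ _ ae]) measurable
  then show "f \<in> L2 M \<longleftrightarrow> g \<in> L2 M" using assms by (simp add: L2_def)
qed

lemma sqnorm_diff_commute: "sqnorm M (\<lambda>x. f x - g x) = sqnorm M (\<lambda>x. g x - f x)"
  by (simp add: sqnorm_def norm_minus_commute)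

text \<open>Passes square-integral bounds to almost everywhere limits.\<close>

lemma Fatou_sq:
  fixes u :: "nat \<Rightarrow> 'a \<Rightarrow> complex"
  assumes [measurable]: "\<And>k. u k \<in> borel_measurable M" "h \<in> borel_measurable M" "g \<in> borel_measurable M"
    and lim: "AE x in M. (\<lambda>k. u k x) \<longlonglongrightarrow> h x"
    and b: "\<And>k. (\<integral>\<^sup>+x. ennreal ((cmod (u k x - g x))\<^sup>2) \<partial>M) \<le> ennreal (b k)" "b \<longlonglongrightarrow> \<beta>"
  shows "(\<integral>\<^sup>+x. ennreal ((cmod (h x - g x))\<^sup>2) \<partial>M) \<le> ennreal \<beta>"
proof -
  have "AE x in M. ennreal ((cmod (h x - g x))\<^sup>2) = liminf (\<lambda>k. ennreal ((cmod (u k x - g x))\<^sup>2))"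
    using lim
  proof eventually_elim
    case (elim x)
    then have "(\<lambda>k. ennreal ((cmod (u k x - g x))\<^sup>2)) \<longlonglongrightarrow> ennreal ((cmod (h x - g x))\<^sup>2)"
      by (intro tendsto_ennrealI tendsto_power tendsto_norm tendsto_diff tendsto_const)
    then show ?case using lim_imp_Liminf[OF sequentially_bot] by metis
  qed
  then have "(\<integral>\<^sup>+x. ennreal ((cmod (h x - g x))\<^sup>2) \<partial>M) = (\<integral>\<^sup>+x. liminf (\<lambda>k. ennreal ((cmod (u k x - g x))\<^sup>2)) \<partial>M)"
    by (rule nn_integral_cong_AE)
  also have "\<dots> \<le> liminf (\<lambda>k. \<integral>\<^sup>+x. ennreal ((cmod (u k x - g x))\<^sup>2) \<partial>M)"
    by (rule nn_integral_liminf) measurable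
  also have "\<dots> \<le> liminf (\<lambda>k. ennreal (b k))" by (intro Liminf_mono always_eventually allI b)
  also have "\<dots> = ennreal \<beta>" by (rule lim_imp_Liminf) (use b(2) in \<open>auto intro: tendsto_ennrealI\<close>)
  finally show ?thesis .
qed

text \<open>The series \<open>\<Sum> 4^k |u (k+1) - u k|\<^sup>2\<close> has finite integral, hence is finite almost everywhere, so the increments are bounded
  by a multiple of \<open>2\<^sup>-\<^sup>k\<close>.\<close>

lemma fast_Cauchy_AE:
  fixes u :: "nat \<Rightarrow> 'a \<Rightarrow> complex"
  assumes u: "\<And>k. u k \<in> L2 M" and le: "\<And>k. sqnorm M (\<lambda>x. u (Suc k) x - u k x) \<le> C * (1/8)^k"
  shows "AE x in M. convergent (\<lambda>k. u k x)"
proof -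
  have [measurable]: "u k \<in> borel_measurable M" for k using u[of k] by (simp add: L2_def)
  have C0: "0 \<le> C" using le[of 0] sqnorm_nonneg[of M "\<lambda>x. u (Suc 0) x - u 0 x"] by simp
  let ?D = "\<lambda>k x. ennreal (4^k * (cmod (u (Suc k) x - u k x))\<^sup>2)"
  have "(\<integral>\<^sup>+x. (\<Sum>k. ?D k x) \<partial>M) = (\<Sum>k. \<integral>\<^sup>+x. ?D k x \<partial>M)"
    by (rule nn_integral_suminf) measurable
  also have "\<dots> \<le> (\<Sum>k. ennreal (C * (1/2)^k))"
  proof (intro suminf_le)
    fix k
    have "(\<integral>\<^sup>+x. ?D k x \<partial>M) = (\<integral>\<^sup>+x. ennreal (4^k) * ennreal ((cmod (u (Suc k) x - u k x))\<^sup>2) \<partial>M)"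
      by (simp add: ennreal_mult)
    also have "\<dots> = ennreal (4^k) * (\<integral>\<^sup>+x. ennreal ((cmod (u (Suc k) x - u k x))\<^sup>2) \<partial>M)"
      by (rule nn_integral_cmult) measurable
    also have "\<dots> = ennreal (4^k * sqnorm M (\<lambda>x. u (Suc k) x - u k x))"
      using L2_nn_integral[OF L2_diff(1)[OF u u]] by (simp add: ennreal_mult sqnorm_nonneg)
    also have "\<dots> \<le> ennreal (4^k * (C * (1/8)^k))"
      using le[of k] by (intro ennreal_leI mult_left_mono) auto
    also have "4^k * (C * (1/8)^k) = C * (1/2)^k"
    proof -
      have "(4::real)^k * (1/8)^k = (1/2)^k" by (simp add: power_mult_distrib[symmetric])
      then show ?thesis by (metis mult.left_commute)
    qed
    finally show "(\<integral>\<^sup>+x. ?D k x \<partial>M) \<le> ennreal (C * (1/2)^k)" .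
  qed auto
  also have "\<dots> = ennreal (\<Sum>k. C * (1/2)^k)"
    using C0 by (intro suminf_ennreal2) (auto intro!: summable_mult summable_geometric)
  also have "\<dots> < \<infinity>" by simp
  finally have "AE x in M. (\<Sum>k. ?D k x) \<noteq> \<infinity>" by (intro nn_integral_noteq_infinite) auto
  then show ?thesis
  proof eventually_elim
    case (elim x)
    define d where "d k = cmod (u (Suc k) x - u k x)" for k
    define e where "e k = ennreal (4^k * (d k)\<^sup>2)" for k
    have ne: "(\<Sum>k. e k) \<noteq> \<infinity>" using elim unfolding e_def d_def .
    obtain m where m: "(\<Sum>k. e k) = ennreal m" "0 \<le> m"
    proof (cases "\<Sum>k. e k" rule: ennreal_cases)
      case (real r)
      show ?thesis by (rule that[OF real(2,1)])
    next
      case top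
      then show ?thesis using ne by simp
    qed
    have "4^k * (d k)\<^sup>2 \<le> m" for k
    proof -
      have "sum e {k} \<le> suminf e" by (rule sum_le_suminf[OF summableI]) simp_all
      then have "e k \<le> ennreal m" by (simp add: m)
      then show ?thesis unfolding e_def using m(2) by (simp only: ennreal_le_iff)
    qed
    moreover have "(2^k * d k)\<^sup>2 = 4^k * (d k)\<^sup>2" for k
      unfolding power_mult_distrib by (simp add: power2_eq_square power_mult_distrib[symmetric])
    ultimately have "(2^k * d k)\<^sup>2 \<le> (sqrt m)\<^sup>2" for k using m(2) by (simp only: real_sqrt_pow2)
    then have "2^k * d k \<le> sqrt m" for k by (rule power2_le_imp_le) (simp add: m)
    then have dk: "d k \<le> sqrt m * (1/2)^k" for k by (simp add: field_simps)
    have "summable (\<lambda>k. sqrt m * (1/2)^k)" by (intro summable_mult summable_geometric) auto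
    then have "summable (\<lambda>k. norm (u (Suc k) x - u k x))"
      by (rule summable_comparison_test'[of _ 0]) (use dk in \<open>auto simp: d_def\<close>)
    then have "summable (\<lambda>k. u (Suc k) x - u k x)" by (rule summable_norm_cancel)
    then have "(\<lambda>n. \<Sum>k<n. u (Suc k) x - u k x) \<longlonglongrightarrow> (\<Sum>k. u (Suc k) x - u k x)" by (rule summable_LIMSEQ)
    then have "(\<lambda>n. u n x - u 0 x) \<longlonglongrightarrow> (\<Sum>k. u (Suc k) x - u k x)"
      unfolding sum_lessThan_telescope[of "\<lambda>k. u k x"] .
    then have "(\<lambda>n. (u n x - u 0 x) + u 0 x) \<longlonglongrightarrow> (\<Sum>k. u (Suc k) x - u k x) + u 0 x"
      by (intro tendsto_add tendsto_const)
    then show "convergent (\<lambda>k. u k x)" by (auto simp: convergent_def)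
  qed
qed

definition trunc :: "nat \<Rightarrow> (real^'d \<Rightarrow> complex) \<Rightarrow> real^'d \<Rightarrow> complex" where
  "trunc n f x = (if norm x \<le> real n \<and> cmod (f x) \<le> real n then f x else 0)"

lemma trunc_nice:
  fixes f :: "real^'d \<Rightarrow> complex"
  assumes [measurable]: "f \<in> borel_measurable lebesgue"
  shows "nice (trunc n f)"
proof (rule niceI[of _ "real n" "real n"])
  have "(\<lambda>x. norm x) \<in> borel_measurable (lebesgue :: (real^'d) measure)"
    by (intro measurable_completion) auto
  then have [measurable]: "Measurable.pred lebesgue (\<lambda>x :: real^'d. norm x \<le> real n \<and> cmod (f x) \<le> real n)"
    by measurable
  show "trunc n f \<in> borel_measurable lebesgue" unfolding trunc_def[abs_def] by measurable
qed (auto simp: trunc_def split: if_splits)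

lemma trunc_L2:
  fixes M :: "(real^'d) measure"
  assumes f: "f \<in> L2 M" and s: "sets M = sets lebesgue"
  shows "trunc n f \<in> L2 M" "(\<lambda>x. f x - trunc n f x) \<in> L2 M" "sqnorm M (trunc n f) \<le> sqnorm M f"
    "sqnorm M (\<lambda>x. f x - trunc n f x) \<le> sqnorm M f" "(\<lambda>n. sqnorm M (\<lambda>x. f x - trunc n f x)) \<longlonglongrightarrow> 0"
proof -
  have mm: "borel_measurable M = borel_measurable lebesgue" by (rule measurable_cong_sets) (simp_all add: s)
  have fm [measurable]: "f \<in> borel_measurable M" and i: "integrable M (\<lambda>x. (cmod (f x))\<^sup>2)" using f by (auto simp: L2_def)
  have tm [measurable]: "trunc n f \<in> borel_measurable M" for n
    using trunc_nice[of f n] fm unfolding mm by (simp add: nice_def)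
  have 1: "(cmod (trunc n f x))\<^sup>2 \<le> (cmod (f x))\<^sup>2" "(cmod (f x - trunc n f x))\<^sup>2 \<le> (cmod (f x))\<^sup>2" for n x
    by (auto simp: trunc_def)
  have i1: "integrable M (\<lambda>x. (cmod (trunc n f x))\<^sup>2)"
    by (rule Bochner_Integration.integrable_bound[OF i]) (use 1 in auto)
  have i2: "integrable M (\<lambda>x. (cmod (f x - trunc n f x))\<^sup>2)"
    by (rule Bochner_Integration.integrable_bound[OF i]) (use 1 in auto)
  show "trunc n f \<in> L2 M" "(\<lambda>x. f x - trunc n f x) \<in> L2 M" using i1 i2 by (auto simp: L2_def)
  show "sqnorm M (trunc n f) \<le> sqnorm M f" "sqnorm M (\<lambda>x. f x - trunc n f x) \<le> sqnorm M f"
    unfolding sqnorm_def by (rule integral_mono[OF i1 i 1(1)], rule integral_mono[OF i2 i 1(2)])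
  have "(\<lambda>n. LINT x|M. (cmod (f x - trunc n f x))\<^sup>2) \<longlonglongrightarrow> (LINT x|M. 0)"
  proof (rule integral_dominated_convergence[OF _ _ i])
    show "AE x in M. (\<lambda>n. (cmod (f x - trunc n f x))\<^sup>2) \<longlonglongrightarrow> 0"
    proof (rule AE_I2)
      fix x
      obtain N where N: "max (norm x) (cmod (f x)) \<le> real N" using real_arch_simple by blast
      have "\<forall>n\<ge>N. (cmod (f x - trunc n f x))\<^sup>2 = 0"
      proof (intro allI impI)
        fix n assume "N \<le> n"
        then have "max (norm x) (cmod (f x)) \<le> real n" using N by (meson of_nat_le_iff order_trans)
        then show "(cmod (f x - trunc n f x))\<^sup>2 = 0" by (simp add: trunc_def)
      qed
      then have "eventually (\<lambda>n. (cmod (f x - trunc n f x))\<^sup>2 = 0) sequentially"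
        unfolding eventually_sequentially by blast
      then show "(\<lambda>n. (cmod (f x - trunc n f x))\<^sup>2) \<longlonglongrightarrow> 0" by (rule tendsto_eventually)
    qed
  qed (use 1 in auto)
  then show "(\<lambda>n. sqnorm M (\<lambda>x. f x - trunc n f x)) \<longlonglongrightarrow> 0" by (simp add: sqnorm_def)
qed

context calderon_zygmund
begin

text \<open>The weighted estimate for nice functions. Sparse domination holds on cubes around the origin that contain the support of
  \<open>f\<close>, with constants independent of the cube; monotone convergence gives the estimate on the whole space.\<close>

lemma nice_weighted_bound:
  obtains C where "C \<ge> 0"
    "\<And>w f. A2_weight w \<Longrightarrow> nice f \<Longrightarrow>
      (\<integral>\<^sup>+x. ennreal ((cmod (T f x))\<^sup>2) \<partial>weight_measure w)
        \<le> ennreal (C * (enn2real (A2_constant w))\<^sup>2 * sqnorm (weight_measure w) f)"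
proof -
  obtain C3 where C3: "C3 \<ge> 0"
    "\<And>(a::real^'d) L f Q. L > 0 \<Longrightarrow> nice f \<Longrightarrow> \<exists>S E.
      sparse_family a L S E \<and>
      (AE x in lebesgue. x \<in> pcell a L Q \<longrightarrow>
        (\<exists>F. finite F \<and> F \<subseteq> S \<and> (\<forall>P\<in>F. x \<in> pcell a L P) \<and>
          cmod (T (cut (pdil a L Q) f) x) \<le> C3 * (\<Sum>P\<in>F. dil_avg a L f P)))"
    by (rule sparse_domination) blast
  define C where "C = C3\<^sup>2 * (64 * ((4 * real CARD('d) + 3)^CARD('d))\<^sup>2 * real (card (classes :: (int^'d) set)))"
  have C0: "C \<ge> 0" by (simp add: C_def)
  show ?thesis
  proof (rule that[OF C0])
    fix w :: "real^'d \<Rightarrow> real" and f :: "real^'d \<Rightarrow> complex"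
    assume w: "A2_weight w" and f: "nice f"
    interpret muckenhoupt w by unfold_locales fact
    let ?b = "C * Aw\<^sup>2 * sqnorm wm f"
    have local: "(\<integral>\<^sup>+x. ennreal ((cmod (T (cut (pdil a L Q) f) x))\<^sup>2) * indicator (pcell a L Q) x \<partial>wm) \<le> ennreal ?b"
      if L: "L > 0" for a :: "real^'d" and L and Q :: "nat \<times> (int^'d)"
    proof -
      let ?X = "\<lambda>P. pcell a L P"
      let ?Tf = "T (cut (pdil a L Q) f)"
      obtain S E where S: "sparse_family a L S E"
         "AE x in lebesgue. x \<in> ?X Q \<longrightarrow> (\<exists>F. finite F \<and> F \<subseteq> S \<and> (\<forall>P\<in>F. x \<in> ?X P) \<and>
          cmod (?Tf x) \<le> C3 * (\<Sum>P\<in>F. dil_avg a L f P))"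
        using C3(2)[OF L f, of a Q] by blast
      define F where "F n = {P \<in> S. to_nat P < n}" for n
      have finF: "finite (F n)" for n
      proof -
        have "F n \<subseteq> to_nat -` {..<n}" by (auto simp: F_def)
        moreover have "finite (to_nat -` {..<n} :: (nat \<times> (int^'d)) set)" by (intro finite_vimageI) auto
        ultimately show ?thesis by (rule finite_subset)
      qed
      have FS: "F n \<subseteq> S" for n by (auto simp: F_def)
      define G where "G n x = (\<Sum>P\<in>F n. dil_avg a L f P * indicator (?X P) x)" for n x
      have G: "integrable wm (\<lambda>x. (G n x)\<^sup>2)" "C3\<^sup>2 * (LINT x|wm. (G n x)\<^sup>2) \<le> ?b" for n
      proof -
        have d: "sparse_family a L (F n) E" by (rule sparse_family_subset[OF S(1) FS])
        have b: "integrable wm (\<lambda>x. (G n x)\<^sup>2)" "(LINT x|wm. (G n x)\<^sup>2) \<le> 64 * ((4 * real CARD('d) + 3)^CARD('d))\<^sup>2 *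
            real (card (classes :: (int^'d) set)) * Aw\<^sup>2 * (LINT x|wm. (cmod (f x))\<^sup>2)"
          unfolding G_def by (rule sparse_sum_bound[OF L f finF d])+
        show "integrable wm (\<lambda>x. (G n x)\<^sup>2)" by (rule b)
        show "C3\<^sup>2 * (LINT x|wm. (G n x)\<^sup>2) \<le> ?b"
          using mult_left_mono[OF b(2), of "C3\<^sup>2"] by (simp add: C_def sqnorm_def mult_ac)
      qed
      have G0: "0 \<le> G n x" for n x unfolding G_def by (intro sum_nonneg mult_nonneg_nonneg dil_avg_nonneg) auto
      have Gm: "G n x \<le> G n' x" if "n \<le> n'" for n n' x
        unfolding G_def using that finF by (intro sum_mono2) (auto simp: F_def dil_avg_nonneg)
      have Gmeas: "G n \<in> borel_measurable lebesgue" for n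
        unfolding G_def[abs_def] using L by (intro borel_measurable_sum borel_measurable_times borel_measurable_const borel_measurable_indicator) auto
      let ?U = "\<lambda>n x. ennreal (C3\<^sup>2 * (G n x)\<^sup>2)"
      have "AE x in lebesgue. ennreal ((cmod (?Tf x))\<^sup>2) * indicator (?X Q) x \<le> (SUP n. ?U n x)"
        using S(2)
      proof eventually_elim
        case (elim x)
        show ?case
        proof (cases "x \<in> ?X Q")
          case True
          then obtain F' where F': "finite F'" "F' \<subseteq> S" "\<And>P. P \<in> F' \<Longrightarrow> x \<in> ?X P" "cmod (?Tf x) \<le> C3 * (\<Sum>P\<in>F'. dil_avg a L f P)"
            using elim by blast
          define n where "n = Suc (Max (insert 0 (to_nat ` F')))"
          have "F' \<subseteq> F n"
          proof
            fix P assume P: "P \<in> F'"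
            then have "to_nat P \<le> Max (insert 0 (to_nat ` F'))" using F'(1) by (intro Max_ge) auto
            then show "P \<in> F n" using P F'(2) by (auto simp: F_def n_def)
          qed
          then have "(\<Sum>P\<in>F'. dil_avg a L f P * indicator (?X P) x) \<le> G n x"
            unfolding G_def using finF by (intro sum_mono2) (auto simp: dil_avg_nonneg)
          moreover have "(\<Sum>P\<in>F'. dil_avg a L f P * indicator (?X P) x) = (\<Sum>P\<in>F'. dil_avg a L f P)"
            using F'(3) by (intro sum.cong) auto
          ultimately have "C3 * (\<Sum>P\<in>F'. dil_avg a L f P) \<le> C3 * G n x" using C3(1) by (intro mult_left_mono) auto
          then have "cmod (?Tf x) \<le> C3 * G n x" using F'(4) by linarith
          then have "(cmod (?Tf x))\<^sup>2 \<le> C3\<^sup>2 * (G n x)\<^sup>2"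
            using power_mono[of "cmod (?Tf x)" "C3 * G n x" 2] by (simp add: power_mult_distrib)
          then have "ennreal ((cmod (?Tf x))\<^sup>2) \<le> ?U n x" by (rule ennreal_leI)
          also have "\<dots> \<le> (SUP n. ?U n x)" by (rule SUP_upper) simp
          finally show ?thesis using True by simp
        qed simp
      qed
      then have "AE x in wm. ennreal ((cmod (?Tf x))\<^sup>2) * indicator (?X Q) x \<le> (SUP n. ?U n x)" unfolding AE_wm .
      then have "(\<integral>\<^sup>+x. ennreal ((cmod (?Tf x))\<^sup>2) * indicator (?X Q) x \<partial>wm) \<le> (\<integral>\<^sup>+x. (SUP n. ?U n x) \<partial>wm)"
        by (rule nn_integral_mono_AE)
      also have "\<dots> = (SUP n. \<integral>\<^sup>+x. ?U n x \<partial>wm)"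
      proof (rule nn_integral_monotone_convergence_SUP)
        show "incseq ?U"
          using Gm G0 by (intro incseq_SucI le_funI ennreal_leI mult_left_mono power_mono) auto
        show "?U n \<in> borel_measurable wm" for n using Gmeas[of n] by simp
      qed
      also have "\<dots> \<le> ennreal ?b"
      proof (rule SUP_least)
        fix n
        have "(\<integral>\<^sup>+x. ?U n x \<partial>wm) = ennreal (LINT x|wm. C3\<^sup>2 * (G n x)\<^sup>2)"
          using G(1)[of n] by (intro nn_integral_eq_integral) auto
        also have "(LINT x|wm. C3\<^sup>2 * (G n x)\<^sup>2) = C3\<^sup>2 * (LINT x|wm. (G n x)\<^sup>2)" by simp
        finally show "(\<integral>\<^sup>+x. ?U n x \<partial>wm) \<le> ennreal ?b" using G(2)[of n] by (simp add: ennreal_leI)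
      qed
      finally show ?thesis .
    qed
    obtain R where R: "\<And>x. f x \<noteq> 0 \<Longrightarrow> norm x \<le> R" using niceE[OF f] by metis
    obtain n0 where n0: "R \<le> real n0" using real_arch_simple by blast
    \<comment> \<open>The cubes with corner \<open>-(n + 1)\<close> and side \<open>2(n + 1)\<close>: generation 0 and index 0 of the grid with these data.\<close>
    define Y where "Y n = {x :: real^'d. \<forall>i. - (real n + 1) \<le> x$i \<and> x$i < real n + 1}" for n
    have cY: "cell (\<chi> i. - (real n + 1)) (2 * (real n + 1)) 0 0 = Y n" for n
      by (subst cell_eq_hcube) (auto simp: hcube_def Y_def)
    have inY: "x \<in> Y n" if "norm x \<le> real n" for x n
      unfolding Y_def
    proof (intro CollectI allI)
      fix i
      have "\<bar>x$i\<bar> \<le> real n" using component_le_norm_cart[of x i] that by linarith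
      then show "- (real n + 1) \<le> x$i \<and> x$i < real n + 1" by linarith
    qed
    have bound: "(\<integral>\<^sup>+x. ennreal ((cmod (T f x))\<^sup>2) * indicator (Y n) x \<partial>wm) \<le> ennreal ?b" if n: "n0 \<le> n" for n
    proof -
      let ?a = "(\<chi> i. - (real n + 1)) :: real^'d" and ?L = "2 * (real n + 1)"
      have "x \<in> Y n" if "f x \<noteq> 0" for x
      proof -
        have "norm x \<le> real n" using R[OF that] n0 n by linarith
        then show ?thesis by (rule inY)
      qed
      then have "x \<in> dil ?a ?L 0 0" if "f x \<noteq> 0" for x
        using that cell_subset_dil[of ?a ?L 0 0] unfolding cY by blast
      then have cf: "cut (dil ?a ?L 0 0) f = f" by (auto simp: cut_def fun_eq_iff)
      have "?L > 0" by simp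
      from local[OF this, of ?a "(0,0)"] show ?thesis unfolding fst_conv snd_conv cY cf .
    qed
    have Ys: "Y n \<in> sets lebesgue" for n unfolding cY[symmetric] by (rule cell_sets_lebesgue) simp
    have Tm: "T f \<in> borel_measurable lebesgue" by (rule T_measurable[OF f])
    have mono: "Y n \<subseteq> Y n'" if "n \<le> n'" for n n'
      unfolding Y_def
    proof (intro subsetI CollectI allI)
      fix x :: "real^'d" and i
      assume "x \<in> {x. \<forall>i. - (real n + 1) \<le> x$i \<and> x$i < real n + 1}"
      then have "- (real n + 1) \<le> x$i \<and> x$i < real n + 1" by simp
      moreover have "real n \<le> real n'" using that by simp
      ultimately show "- (real n' + 1) \<le> x$i \<and> x$i < real n' + 1" by linarith
    qed
    have "(\<integral>\<^sup>+x. ennreal ((cmod (T f x))\<^sup>2) \<partial>wm) = (\<integral>\<^sup>+x. (SUP n. ennreal ((cmod (T f x))\<^sup>2) * indicator (Y n) x) \<partial>wm)"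
    proof (rule nn_integral_cong)
      fix x :: "real^'d"
      obtain n where n: "norm x \<le> real n" using real_arch_simple by blast
      then have xY: "x \<in> Y n" by (rule inY)
      show "ennreal ((cmod (T f x))\<^sup>2) = (SUP n. ennreal ((cmod (T f x))\<^sup>2) * indicator (Y n) x)"
      proof (rule antisym)
        have "ennreal ((cmod (T f x))\<^sup>2) = ennreal ((cmod (T f x))\<^sup>2) * indicator (Y n) x" using xY by simp
        also have "\<dots> \<le> (SUP n. ennreal ((cmod (T f x))\<^sup>2) * indicator (Y n) x)" by (rule SUP_upper) simp
        finally show "ennreal ((cmod (T f x))\<^sup>2) \<le> (SUP n. ennreal ((cmod (T f x))\<^sup>2) * indicator (Y n) x)" .
        show "(SUP n. ennreal ((cmod (T f x))\<^sup>2) * indicator (Y n) x) \<le> ennreal ((cmod (T f x))\<^sup>2)"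
          by (intro SUP_least) (simp add: indicator_def)
      qed
    qed
    also have "\<dots> = (SUP n. \<integral>\<^sup>+x. ennreal ((cmod (T f x))\<^sup>2) * indicator (Y n) x \<partial>wm)"
    proof (rule nn_integral_monotone_convergence_SUP)
      show "incseq (\<lambda>n x. ennreal ((cmod (T f x))\<^sup>2) * indicator (Y n) x)"
      proof (intro incseq_SucI le_funI mult_left_mono)
        show "(indicator (Y n) x :: ennreal) \<le> indicator (Y (Suc n)) x" for n x
          using mono[of n "Suc n"] by (auto simp: indicator_def)
      qed simp
      show "(\<lambda>x. ennreal ((cmod (T f x))\<^sup>2) * indicator (Y n) x) \<in> borel_measurable wm" for n
        using Tm Ys[of n] unfolding meas_wm by measurable
    qed
    also have "\<dots> \<le> ennreal ?b"
    proof (rule SUP_least)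
      fix n
      have "(\<integral>\<^sup>+x. ennreal ((cmod (T f x))\<^sup>2) * indicator (Y n) x \<partial>wm) \<le> (\<integral>\<^sup>+x. ennreal ((cmod (T f x))\<^sup>2) * indicator (Y (max n n0)) x \<partial>wm)"
        using mono[of n "max n n0"] by (intro nn_integral_mono mult_left_mono) (auto simp: indicator_def)
      also have "\<dots> \<le> ennreal ?b" by (rule bound) simp
      finally show "(\<integral>\<^sup>+x. ennreal ((cmod (T f x))\<^sup>2) * indicator (Y n) x \<partial>wm) \<le> ennreal ?b" .
    qed
    finally show "(\<integral>\<^sup>+x. ennreal ((cmod (T f x))\<^sup>2) \<partial>wm) \<le> ennreal (C * (enn2real (A2_constant w))\<^sup>2 * sqnorm wm f)"
      by (simp add: Aw_def)
  qed
qed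

end

text \<open>An operator with a weighted estimate for nice functions, the square of the norm being bounded by \<open>c\<close>.\<close>

locale weighted_calderon_zygmund = calderon_zygmund T K Cz \<delta> B + muckenhoupt w
  for T :: "(real^'d \<Rightarrow> complex) \<Rightarrow> real^'d \<Rightarrow> complex" and K Cz \<delta> B and w :: "real^'d \<Rightarrow> real" +
  fixes c :: real
  assumes c0: "0 \<le> c"
    and nice_bound: "\<And>f. nice f \<Longrightarrow> (\<integral>\<^sup>+x. ennreal ((cmod (T f x))\<^sup>2) \<partial>weight_measure w) \<le> ennreal (c * sqnorm (weight_measure w) f)"
begin

lemma nice_L2_wm: "nice f \<Longrightarrow> f \<in> L2 wm"
  using nice_integrable_wm(2)[of f] by (simp add: L2_def nice_measurable)

lemma L2_wm_measurable: "f \<in> L2 wm \<Longrightarrow> f \<in> borel_measurable lebesgue"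
  by (simp add: L2_def)

lemma T_wm: "nice f \<Longrightarrow> T f \<in> L2 wm" "nice f \<Longrightarrow> sqnorm wm (T f) \<le> c * sqnorm wm f"
  using L2_I[of "T f" wm "c * sqnorm wm f"] nice_bound[of f] T_measurable[of f] c0 by (simp_all add: sqnorm_nonneg)

lemma T_diff:
  assumes "f \<in> L2 lebesgue" "g \<in> L2 lebesgue"
  shows "AE x in lebesgue. T (\<lambda>x. f x - g x) x = T f x - T g x"
proof -
  have "AE x in lebesgue. T (\<lambda>x. f x + (- 1) * g x) x = T f x + T (\<lambda>x. (- 1) * g x) x"
    using assms by (intro T_add L2_scale)
  moreover have "AE x in lebesgue. T (\<lambda>x. (- 1) * g x) x = (- 1) * T g x" by (intro T_scale assms)
  ultimately show ?thesis by eventually_elim simp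
qed

lemma nice_diff: "nice f \<Longrightarrow> nice g \<Longrightarrow> nice (\<lambda>x. f x - g x)"
  using nice_add[OF _ nice_scale[of g "-1"], of f] by simp

lemma T_diff_wm:
  assumes f: "nice f" and g: "nice g"
  shows "sqnorm wm (\<lambda>x. T f x - T g x) \<le> c * sqnorm wm (\<lambda>x. f x - g x)"
proof -
  have "AE x in wm. T (\<lambda>x. f x - g x) x = T f x - T g x"
    unfolding AE_wm by (intro T_diff nice_L2 f g)
  then have "sqnorm wm (\<lambda>x. T f x - T g x) = sqnorm wm (T (\<lambda>x. f x - g x))"
    using T_measurable[OF f] T_measurable[OF g] T_measurable[OF nice_diff[OF f g]]
    by (intro sqnorm_cong_AE) auto
  also have "\<dots> \<le> c * sqnorm wm (\<lambda>x. f x - g x)" by (rule T_wm(2)[OF nice_diff[OF f g]])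
  finally show ?thesis .
qed

text \<open>That \<open>h\<close> is the value of the extension at \<open>f\<close> is expressed by its distance to all \<open>T g\<close> with \<open>g\<close> nice. This
  determines \<open>h\<close> almost everywhere and gives the linearity and boundedness of the extension directly.\<close>

definition extends_to :: "(real^'d \<Rightarrow> complex) \<Rightarrow> (real^'d \<Rightarrow> complex) \<Rightarrow> bool" where
  "extends_to f h \<longleftrightarrow> h \<in> borel_measurable lebesgue \<and>
    (\<forall>g. nice g \<longrightarrow> (\<lambda>x. h x - T g x) \<in> L2 wm \<and> sqnorm wm (\<lambda>x. h x - T g x) \<le> 2 * c * sqnorm wm (\<lambda>x. f x - g x)) \<and>
    (f \<in> L2 lebesgue \<longrightarrow> (AE x in lebesgue. h x = T f x))"

text \<open>Along a rapidly converging sequence of truncations of \<open>f\<close>, the images converge almost everywhere. Fatou's lemma in \<open>L\<^sup>2(w)\<close>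
  estimates the limit, and Fatou's lemma in unweighted \<open>L\<^sup>2\<close> identifies it with \<open>T f\<close> if \<open>f\<close> belongs to both
  spaces.\<close>

lemma extension_value:
  assumes f: "f \<in> L2 wm"
  shows "\<exists>h. extends_to f h"
proof -
  have fm: "f \<in> borel_measurable lebesgue" by (rule L2_wm_measurable[OF f])
  define e where "e n = sqnorm wm (\<lambda>x. f x - trunc n f x)" for n
  have e: "e \<longlonglongrightarrow> 0" unfolding e_def using trunc_L2(5)[OF f] by simp
  have tn: "nice (trunc n f)" for n by (rule trunc_nice[OF fm])
  have fe: "(\<lambda>x. f x - trunc n f x) \<in> L2 wm" for n using trunc_L2(2)[OF f] by simp
  have "\<exists>n. k \<le> n \<and> e n \<le> (1/8)^k" for k
  proof -
    have "eventually (\<lambda>n. e n < (1/8)^k) sequentially" using e by (intro order_tendstoD(2)) auto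
    then obtain N where "\<And>n. n \<ge> N \<Longrightarrow> e n < (1/8)^k" by (auto simp: eventually_sequentially)
    then have "e (max k N) < (1/8)^k" by simp
    then show ?thesis by (intro exI[of _ "max k N"]) auto
  qed
  then obtain r where r: "\<And>k. k \<le> r k" "\<And>k. e (r k) \<le> (1/8)^k" by metis
  define u where "u k = T (trunc (r k) f)" for k
  have uL: "u k \<in> L2 wm" for k unfolding u_def by (rule T_wm(1)[OF tn])
  have um: "u k \<in> borel_measurable lebesgue" for k unfolding u_def by (rule T_measurable[OF tn])
  have "sqnorm wm (\<lambda>x. u (Suc k) x - u k x) \<le> (4 * c) * (1/8)^k" for k
  proof -
    have "sqnorm wm (\<lambda>x. u (Suc k) x - u k x) \<le> c * sqnorm wm (\<lambda>x. trunc (r (Suc k)) f x - trunc (r k) f x)"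
      unfolding u_def by (rule T_diff_wm[OF tn tn])
    also have "sqnorm wm (\<lambda>x. trunc (r (Suc k)) f x - trunc (r k) f x)
       = sqnorm wm (\<lambda>x. (f x - trunc (r k) f x) - (f x - trunc (r (Suc k)) f x))" by simp
    also have "c * \<dots> \<le> c * (2 * e (r k) + 2 * e (r (Suc k)))"
      unfolding e_def by (intro mult_left_mono L2_diff(2) fe c0)
    also have "\<dots> \<le> c * (2 * (1/8)^k + 2 * (1/8)^k)"
    proof (intro mult_left_mono add_mono c0)
      have "(1/8::real)^Suc k \<le> (1/8)^k" by (rule power_decreasing) auto
      then show "e (r (Suc k)) \<le> (1/8)^k" using r(2)[of "Suc k"] by linarith
    qed (use r in auto)
    finally show ?thesis by simp
  qed
  from fast_Cauchy_AE[OF uL this] have conv: "AE x in wm. convergent (\<lambda>k. u k x)" .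
  define h where "h x = lim (\<lambda>k. u k x)" for x
  have lim: "AE x in lebesgue. (\<lambda>k. u k x) \<longlonglongrightarrow> h x"
    using conv unfolding AE_wm h_def convergent_LIMSEQ_iff .
  have hm: "h \<in> borel_measurable lebesgue"
    unfolding h_def by (rule borel_measurable_lim_metric[OF um])
  have 1: "(\<lambda>x. h x - T g x) \<in> L2 wm \<and> sqnorm wm (\<lambda>x. h x - T g x) \<le> 2 * c * sqnorm wm (\<lambda>x. f x - g x)" if g: "nice g" for g
  proof -
    have Tg: "T g \<in> borel_measurable lebesgue" by (rule T_measurable[OF g])
    have fg: "(\<lambda>x. f x - g x) \<in> L2 wm" by (intro L2_diff f nice_L2_wm g)
    have bnd: "(\<integral>\<^sup>+x. ennreal ((cmod (u k x - T g x))\<^sup>2) \<partial>wm) \<le> ennreal (c * (2 * sqnorm wm (\<lambda>x. f x - g x) + 2 * (1/8)^k))" for k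
    proof -
      have "(\<integral>\<^sup>+x. ennreal ((cmod (u k x - T g x))\<^sup>2) \<partial>wm) = ennreal (sqnorm wm (\<lambda>x. u k x - T g x))"
        by (intro L2_nn_integral L2_diff uL T_wm g)
      also have "sqnorm wm (\<lambda>x. u k x - T g x) \<le> c * sqnorm wm (\<lambda>x. trunc (r k) f x - g x)"
        unfolding u_def by (rule T_diff_wm[OF tn g])
      also have "sqnorm wm (\<lambda>x. trunc (r k) f x - g x) = sqnorm wm (\<lambda>x. (f x - g x) - (f x - trunc (r k) f x))" by simp
      also have "c * \<dots> \<le> c * (2 * sqnorm wm (\<lambda>x. f x - g x) + 2 * e (r k))"
        unfolding e_def by (intro mult_left_mono L2_diff(2) fe fg c0)
      also have "\<dots> \<le> c * (2 * sqnorm wm (\<lambda>x. f x - g x) + 2 * (1/8)^k)"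
        using r(2) by (intro mult_left_mono add_mono c0) auto
      finally show ?thesis by (simp add: ennreal_leI)
    qed
    have lims: "(\<lambda>k. c * (2 * sqnorm wm (\<lambda>x. f x - g x) + 2 * (1/8)^k)) \<longlonglongrightarrow> c * (2 * sqnorm wm (\<lambda>x. f x - g x) + 2 * 0)"
      by (intro tendsto_mult tendsto_add tendsto_const LIMSEQ_power_zero) auto
    have "(\<integral>\<^sup>+x. ennreal ((cmod (h x - T g x))\<^sup>2) \<partial>wm) \<le> ennreal (c * (2 * sqnorm wm (\<lambda>x. f x - g x) + 2 * 0))"
      by (rule Fatou_sq[OF _ _ _ _ bnd lims]) (simp_all only: meas_wm um hm Tg AE_wm lim)
    then show ?thesis
      using L2_I[of "\<lambda>x. h x - T g x" wm "2 * c * sqnorm wm (\<lambda>x. f x - g x)"] hm Tg c0 by (simp add: sqnorm_nonneg mult_ac)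
  qed
  have 2: "AE x in lebesgue. h x = T f x" if fl: "f \<in> L2 lebesgue"
  proof -
    define e' where "e' n = sqnorm lebesgue (\<lambda>x. f x - trunc n f x)" for n
    have e': "e' \<longlonglongrightarrow> 0" unfolding e'_def using trunc_L2(5)[OF fl] by simp
    have Tf: "T f \<in> L2 lebesgue" "T f \<in> borel_measurable lebesgue" using T_L2[OF fl] by (auto simp: L2_def)
    have "filterlim r at_top sequentially"
      using r(1) by (intro filterlim_at_top_mono[OF filterlim_ident]) auto
    then have er: "(\<lambda>k. e' (r k)) \<longlonglongrightarrow> 0" by (rule filterlim_compose[OF e'])
    have bnd: "(\<integral>\<^sup>+x. ennreal ((cmod (u k x - T f x))\<^sup>2) \<partial>lebesgue) \<le> ennreal (B * e' (r k))" for k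
    proof -
      have tl: "trunc (r k) f \<in> L2 lebesgue" by (rule nice_L2[OF tn])
      have uk: "u k \<in> L2 lebesgue" unfolding u_def by (rule T_L2[OF tl])
      have "(\<integral>\<^sup>+x. ennreal ((cmod (u k x - T f x))\<^sup>2) \<partial>lebesgue) = ennreal (sqnorm lebesgue (\<lambda>x. u k x - T f x))"
        by (intro L2_nn_integral L2_diff uk Tf)
      also have "sqnorm lebesgue (\<lambda>x. u k x - T f x) = sqnorm lebesgue (\<lambda>x. T f x - u k x)" by (rule sqnorm_diff_commute)
      also have "\<dots> = sqnorm lebesgue (T (\<lambda>x. f x - trunc (r k) f x))"
      proof (rule sqnorm_cong_AE)
        have "AE x in lebesgue. T (\<lambda>x. f x - trunc (r k) f x) x = T f x - T (trunc (r k) f) x" by (rule T_diff[OF fl tl])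
        then show "AE x in lebesgue. T f x - u k x = T (\<lambda>x. f x - trunc (r k) f x) x" unfolding u_def by eventually_elim simp
        show "T (\<lambda>x. f x - trunc (r k) f x) \<in> borel_measurable lebesgue"
          using T_L2[OF L2_diff(1)[OF fl tl]] by (simp add: L2_def)
      qed (use Tf um in auto)
      also have "\<dots> \<le> B * e' (r k)" unfolding e'_def sqnorm_def by (rule T_bound[OF L2_diff(1)[OF fl tl]])
      finally show ?thesis by (simp add: ennreal_leI)
    qed
    have lims: "(\<lambda>k. B * e' (r k)) \<longlonglongrightarrow> B * 0" by (intro tendsto_mult tendsto_const er)
    have "(\<integral>\<^sup>+x. ennreal ((cmod (h x - T f x))\<^sup>2) \<partial>lebesgue) \<le> ennreal (B * 0)"
      by (rule Fatou_sq[OF um hm Tf(2) lim bnd lims])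
    then have z: "(\<lambda>x. h x - T f x) \<in> L2 lebesgue" "sqnorm lebesgue (\<lambda>x. h x - T f x) \<le> 0"
      using L2_I[of "\<lambda>x. h x - T f x" lebesgue 0] hm Tf by simp_all
    have "AE x in lebesgue. h x - T f x = 0"
      using z by (intro AE_eq_0_of_integral_sq) (auto simp: L2_def sqnorm_def)
    then show ?thesis by eventually_elim simp
  qed
  show ?thesis unfolding extends_to_def using hm 1 2 by blast
qed

lemma sqnorm_limit_0_AE:
  assumes "D \<in> L2 wm" "\<And>n. sqnorm wm D \<le> b n" "b \<longlonglongrightarrow> 0"
  shows "AE x in wm. D x = 0"
proof (rule AE_eq_0_of_integral_sq)
  have "sqnorm wm D \<le> 0" using assms(2,3) by (intro LIMSEQ_le_const) auto
  then show "(LINT x|wm. (cmod (D x))\<^sup>2) \<le> 0" by (simp add: sqnorm_def)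
qed (use assms(1) in \<open>auto simp: L2_def\<close>)

text \<open>For nice functions additivity and homogeneity are those of \<open>T\<close>. For general functions the defect is bounded by the
  errors of approximation by truncations, hence it vanishes almost everywhere.\<close>

lemma extension_exists: "\<exists>S. bounded_extension_L2 w T S"
proof -
  have "\<forall>f\<in>L2 wm. \<exists>h. extends_to f h" using extension_value by blast
  from bchoice[OF this] obtain S where "\<forall>f\<in>L2 wm. extends_to f (S f)" by (rule exE)
  then have S: "\<And>f. f \<in> L2 wm \<Longrightarrow> S f \<in> borel_measurable lebesgue"
    "\<And>f g. f \<in> L2 wm \<Longrightarrow> nice g \<Longrightarrow> (\<lambda>x. S f x - T g x) \<in> L2 wm"
    "\<And>f g. f \<in> L2 wm \<Longrightarrow> nice g \<Longrightarrow> sqnorm wm (\<lambda>x. S f x - T g x) \<le> 2 * c * sqnorm wm (\<lambda>x. f x - g x)"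
    "\<And>f. f \<in> L2 wm \<Longrightarrow> f \<in> L2 lebesgue \<Longrightarrow> AE x in lebesgue. S f x = T f x"
    unfolding extends_to_def by blast+
  define e where "e f n = sqnorm wm (\<lambda>x. f x - trunc n f x)" for f n
  have e: "e f \<longlonglongrightarrow> 0" if "f \<in> L2 wm" for f unfolding e_def using trunc_L2(5)[OF that] by simp
  have tn: "nice (trunc n f)" if "f \<in> L2 wm" for f n by (rule trunc_nice[OF L2_wm_measurable[OF that]])
  have fe: "(\<lambda>x. f x - trunc n f x) \<in> L2 wm" if "f \<in> L2 wm" for f n using trunc_L2(2)[OF that] by simp
  have Se: "sqnorm wm (\<lambda>x. S f x - T (trunc n f) x) \<le> 2 * c * e f n" if "f \<in> L2 wm" for f n
    unfolding e_def by (rule S(3)[OF that tn[OF that]])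
  have SL: "S f \<in> L2 wm" "sqnorm wm (S f) \<le> 6 * c * sqnorm wm f" if f: "f \<in> L2 wm" for f
  proof -
    let ?h = "trunc 0 f"
    have 1: "(\<lambda>x. (S f x - T ?h x) + T ?h x) \<in> L2 wm"
      "sqnorm wm (\<lambda>x. (S f x - T ?h x) + T ?h x) \<le> 2 * sqnorm wm (\<lambda>x. S f x - T ?h x) + 2 * sqnorm wm (T ?h)"
      by (intro L2_add S(2) f tn T_wm)+
    then show "S f \<in> L2 wm" by simp
    have "sqnorm wm (S f) \<le> 2 * sqnorm wm (\<lambda>x. S f x - T ?h x) + 2 * sqnorm wm (T ?h)" using 1 by simp
    also have "\<dots> \<le> 2 * (2 * c * sqnorm wm f) + 2 * (c * sqnorm wm f)"
    proof (intro add_mono mult_left_mono)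
      show "sqnorm wm (\<lambda>x. S f x - T ?h x) \<le> 2 * c * sqnorm wm f"
        by (rule order_trans[OF S(3)[OF f tn[OF f]]]) (use trunc_L2(4)[OF f, of 0] c0 in \<open>simp add: mult_left_mono\<close>)
      show "sqnorm wm (T ?h) \<le> c * sqnorm wm f"
        by (rule order_trans[OF T_wm(2)[OF tn[OF f]]]) (use trunc_L2(3)[OF f, of 0] c0 in \<open>simp add: mult_left_mono\<close>)
    qed auto
    finally show "sqnorm wm (S f) \<le> 6 * c * sqnorm wm f" by simp
  qed
  have add: "AE x in wm. S (\<lambda>y. f y + g y) x = S f x + S g x" if f: "f \<in> L2 wm" and g: "g \<in> L2 wm" for f g
  proof -
    let ?D = "\<lambda>x. S (\<lambda>y. f y + g y) x - (S f x + S g x)"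
    have fg: "(\<lambda>y. f y + g y) \<in> L2 wm" by (rule L2_add(1)[OF f g])
    have DL: "?D \<in> L2 wm" by (intro L2_diff L2_add SL f g)
    have "sqnorm wm ?D \<le> 16 * c * (e f n + e g n)" for n
    proof -
      let ?hf = "trunc n f" and ?hg = "trunc n g"
      let ?h = "\<lambda>x. ?hf x + ?hg x"
      have nh: "nice ?h" by (intro nice_add tn f g)
      let ?a = "\<lambda>x. S (\<lambda>y. f y + g y) x - T ?h x"
      let ?b = "\<lambda>x. (S f x - T ?hf x) + (S g x - T ?hg x)"
      have "AE x in wm. T ?h x = T ?hf x + T ?hg x"
        unfolding AE_wm by (intro T_add nice_L2 tn f g)
      then have "sqnorm wm ?D = sqnorm wm (\<lambda>x. ?a x - ?b x)"
        using S(1)[OF fg] S(1)[OF f] S(1)[OF g] T_measurable[OF nh] T_measurable[OF tn[OF f]] T_measurable[OF tn[OF g]]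
        by (intro sqnorm_cong_AE) (auto elim!: eventually_mono)
      also have "\<dots> \<le> 2 * sqnorm wm ?a + 2 * sqnorm wm ?b" by (rule L2_diff(2); intro L2_add(1) S(2) f g fg nh tn)
      finally have D: "sqnorm wm ?D \<le> 2 * sqnorm wm ?a + 2 * sqnorm wm ?b" .
      have a: "sqnorm wm ?a \<le> 2 * c * sqnorm wm (\<lambda>x. (f x + g x) - ?h x)" by (rule S(3)[OF fg nh])
      have "sqnorm wm (\<lambda>x. (f x + g x) - ?h x) = sqnorm wm (\<lambda>x. (f x - ?hf x) + (g x - ?hg x))"
        by (rule arg_cong[where f = "sqnorm wm"]) (simp add: fun_eq_iff)
      also have "\<dots> \<le> 2 * e f n + 2 * e g n" unfolding e_def by (rule L2_add(2)[OF fe[OF f] fe[OF g]])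
      finally have "2 * c * sqnorm wm (\<lambda>x. (f x + g x) - ?h x) \<le> 2 * c * (2 * e f n + 2 * e g n)"
        using c0 by (intro mult_left_mono) auto
      moreover have "sqnorm wm ?b \<le> 2 * sqnorm wm (\<lambda>x. S f x - T ?hf x) + 2 * sqnorm wm (\<lambda>x. S g x - T ?hg x)"
        by (rule L2_add(2)[OF S(2)[OF f tn[OF f]] S(2)[OF g tn[OF g]]])
      moreover have "2 * c * (2 * e f n + 2 * e g n) = 4 * (c * e f n) + 4 * (c * e g n)"
        "16 * c * (e f n + e g n) = 16 * (c * e f n) + 16 * (c * e g n)" by (simp_all add: algebra_simps)
      moreover have "0 \<le> c * e f n" "0 \<le> c * e g n" using c0 by (auto simp: e_def sqnorm_nonneg)
      ultimately show ?thesis using D a Se[OF f, of n] Se[OF g, of n] by linarith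
    qed
    moreover have "(\<lambda>n. 16 * c * (e f n + e g n)) \<longlonglongrightarrow> 16 * c * (0 + 0)"
      by (intro tendsto_mult tendsto_add tendsto_const e f g)
    ultimately have "AE x in wm. ?D x = 0" by (intro sqnorm_limit_0_AE[OF DL]) auto
    then show ?thesis by eventually_elim simp
  qed
  have scale: "AE x in wm. S (\<lambda>y. k * f y) x = k * S f x" if f: "f \<in> L2 wm" for f k
  proof -
    let ?D = "\<lambda>x. S (\<lambda>y. k * f y) x - k * S f x"
    have kf: "(\<lambda>y. k * f y) \<in> L2 wm" by (rule L2_scale(1)[OF f])
    have DL: "?D \<in> L2 wm" by (intro L2_diff L2_scale SL f)
    have "sqnorm wm ?D \<le> 8 * c * (cmod k)\<^sup>2 * e f n" for n
    proof -
      let ?hf = "trunc n f"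
      let ?h = "\<lambda>x. k * ?hf x"
      have nh: "nice ?h" by (intro nice_scale tn f)
      let ?a = "\<lambda>x. S (\<lambda>y. k * f y) x - T ?h x"
      let ?b = "\<lambda>x. k * (S f x - T ?hf x)"
      have "AE x in wm. T ?h x = k * T ?hf x"
        unfolding AE_wm by (intro T_scale nice_L2 tn f)
      then have "sqnorm wm ?D = sqnorm wm (\<lambda>x. ?a x - ?b x)"
        using S(1)[OF kf] S(1)[OF f] T_measurable[OF nh] T_measurable[OF tn[OF f]]
        by (intro sqnorm_cong_AE) (auto elim!: eventually_mono simp: algebra_simps)
      also have "\<dots> \<le> 2 * sqnorm wm ?a + 2 * sqnorm wm ?b" by (intro L2_diff L2_scale S(2) f kf nh tn)
      also have "sqnorm wm ?a \<le> 2 * c * sqnorm wm (\<lambda>x. k * f x - ?h x)" by (rule S(3)[OF kf nh])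
      also have "sqnorm wm (\<lambda>x. k * f x - ?h x) = sqnorm wm (\<lambda>x. k * (f x - ?hf x))"
        by (simp add: right_diff_distrib)
      also have "\<dots> = (cmod k)\<^sup>2 * e f n" unfolding e_def by (rule L2_scale(2)[OF fe[OF f]])
      also have "sqnorm wm ?b = (cmod k)\<^sup>2 * sqnorm wm (\<lambda>x. S f x - T ?hf x)" by (intro L2_scale(2) S(2) f tn)
      also have "\<dots> \<le> (cmod k)\<^sup>2 * (2 * c * e f n)" by (intro mult_left_mono Se f) simp
      finally show ?thesis using c0 by (simp add: algebra_simps)
    qed
    moreover have "(\<lambda>n. 8 * c * (cmod k)\<^sup>2 * e f n) \<longlonglongrightarrow> 8 * c * (cmod k)\<^sup>2 * 0"
      by (intro tendsto_mult tendsto_const e f)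
    ultimately have "AE x in wm. ?D x = 0" by (intro sqnorm_limit_0_AE[OF DL]) auto
    then show ?thesis by eventually_elim simp
  qed
  have "L2_norm wm (S f) \<le> sqrt (6 * c) * L2_norm wm f" if "f \<in> L2 wm" for f
    using SL(2)[OF that] unfolding L2_norm_sqnorm real_sqrt_mult[symmetric] by (rule real_sqrt_le_mono)
  then have "bounded_operator_L2 wm S"
    unfolding bounded_operator_L2_def using SL(1) add scale by blast
  then show ?thesis unfolding bounded_extension_L2_def using S(4) by blast
qed

text \<open>On the truncations of \<open>f\<close> the extension agrees with \<open>T\<close>; on the remainders, which tend to zero, its own boundedness is
  enough. The factor 2 stems from the inequality \<open>|a + b|\<^sup>2 \<le> 2|a|\<^sup>2 + 2|b|\<^sup>2\<close>, used in place of the triangle inequality.\<close>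

lemma extension_bound:
  assumes S: "bounded_extension_L2 w T S" and f: "f \<in> L2 wm"
  shows "sqnorm wm (S f) \<le> 2 * c * sqnorm wm f"
proof -
  have SL: "S f \<in> L2 wm" if "f \<in> L2 wm" for f using S that by (auto simp: bounded_extension_L2_def bounded_operator_L2_def)
  have Sadd: "AE x in wm. S (\<lambda>y. f y + g y) x = S f x + S g x" if "f \<in> L2 wm" "g \<in> L2 wm" for f g
    using S that by (auto simp: bounded_extension_L2_def bounded_operator_L2_def)
  obtain b where b: "\<And>f. f \<in> L2 wm \<Longrightarrow> L2_norm wm (S f) \<le> b * L2_norm wm f"
    using S unfolding bounded_extension_L2_def bounded_operator_L2_def by blast
  have b2: "sqnorm wm (S f) \<le> b\<^sup>2 * sqnorm wm f" if "f \<in> L2 wm" for f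
  proof -
    have "(sqrt (sqnorm wm (S f)))\<^sup>2 \<le> (b * sqrt (sqnorm wm f))\<^sup>2"
      using b[OF that] by (intro power_mono) (auto simp: L2_norm_sqnorm sqnorm_nonneg)
    then show ?thesis by (simp add: power_mult_distrib sqnorm_nonneg)
  qed
  have ST: "AE x in lebesgue. S g x = T g x" if "nice g" for g
    using S nice_L2[OF that] nice_L2_wm[OF that] by (auto simp: bounded_extension_L2_def)
  have "sqnorm wm (S f) \<le> 2 * (c * sqnorm wm f) + 2 * (b\<^sup>2 * sqnorm wm (\<lambda>x. f x - trunc n f x))" for n
  proof -
    let ?h = "trunc n f" and ?r = "\<lambda>x. f x - trunc n f x"
    have h: "nice ?h" by (rule trunc_nice[OF L2_wm_measurable[OF f]])
    have rL: "?r \<in> L2 wm" using trunc_L2(2)[OF f] by simp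
    have "AE x in wm. S (\<lambda>y. ?h y + ?r y) x = S ?h x + S ?r x" by (intro Sadd nice_L2_wm h rL)
    moreover have "AE x in wm. S ?h x = T ?h x" unfolding AE_wm by (rule ST[OF h])
    ultimately have "AE x in wm. S f x = T ?h x + S ?r x" by eventually_elim simp
    then have "sqnorm wm (S f) = sqnorm wm (\<lambda>x. T ?h x + S ?r x)"
      using SL[OF f] SL[OF rL] T_measurable[OF h] by (intro sqnorm_cong_AE) (auto simp: L2_def)
    also have "\<dots> \<le> 2 * sqnorm wm (T ?h) + 2 * sqnorm wm (S ?r)" by (intro L2_add T_wm h SL rL)
    also have "sqnorm wm (T ?h) \<le> c * sqnorm wm f"
      by (rule order_trans[OF T_wm(2)[OF h]]) (use trunc_L2(3)[OF f, of n] c0 in \<open>simp add: mult_left_mono\<close>)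
    also have "sqnorm wm (S ?r) \<le> b\<^sup>2 * sqnorm wm ?r" by (rule b2[OF rL])
    finally show ?thesis by simp
  qed
  moreover have "(\<lambda>n. 2 * (c * sqnorm wm f) + 2 * (b\<^sup>2 * sqnorm wm (\<lambda>x. f x - trunc n f x))) \<longlonglongrightarrow> 2 * (c * sqnorm wm f) + 2 * (b\<^sup>2 * 0)"
    using trunc_L2(5)[OF f] by (intro tendsto_add tendsto_mult tendsto_const) auto
  ultimately have "sqnorm wm (S f) \<le> 2 * (c * sqnorm wm f) + 2 * (b\<^sup>2 * 0)" by (intro LIMSEQ_le_const) auto
  then show ?thesis by simp
qed

end

lemma calderon_zygmund_operator_locale:
  fixes T :: "(real^'d \<Rightarrow> complex) \<Rightarrow> real^'d \<Rightarrow> complex"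
  assumes "calderon_zygmund_operator T"
  shows "\<exists>K Cz \<delta> B. calderon_zygmund T K Cz \<delta> B"
proof -
  obtain K where K: "calderon_zygmund_kernel K"
    and rep: "\<And>f. f \<in> borel_measurable lebesgue \<Longrightarrow> bounded (range f) \<Longrightarrow> compact (closure {y. f y \<noteq> 0}) \<Longrightarrow>
          (AE x in lebesgue. x \<notin> closure {y. f y \<noteq> 0} \<longrightarrow> T f x = (LINT y|lebesgue. K x y * f y))"
    using assms by (auto simp: calderon_zygmund_operator_def)
  obtain C \<delta> where \<delta>: "0 < \<delta>" and size: "\<And>x y. x \<noteq> y \<Longrightarrow> cmod (K x y) \<le> C / norm (x - y) ^ CARD('d)"
    and smooth: "\<And>x x' y. norm (x - y) > 2 * norm (x - x') \<Longrightarrow>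
          cmod (K x y - K x' y) + cmod (K y x - K y x')
            \<le> C * norm (x - x') powr \<delta> / norm (x - y) powr (real CARD('d) + \<delta>)"
    using K unfolding calderon_zygmund_kernel_def by blast
  have op: "bounded_operator_L2 lebesgue T" using assms by (simp add: calderon_zygmund_operator_def)
  then obtain b where b: "\<And>f. f \<in> L2 lebesgue \<Longrightarrow> L2_norm lebesgue (T f) \<le> b * L2_norm lebesgue f"
    unfolding bounded_operator_L2_def by blast
  have "calderon_zygmund T K \<bar>C\<bar> \<delta> (b\<^sup>2)"
  proof
    show "T f \<in> L2 lebesgue" if "f \<in> L2 lebesgue" for f using op that by (simp add: bounded_operator_L2_def)
    show "AE x in lebesgue. T (\<lambda>y. f y + g y) x = T f x + T g x" if "f \<in> L2 lebesgue" "g \<in> L2 lebesgue" for f g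
      using op that by (simp add: bounded_operator_L2_def)
    show "AE x in lebesgue. T (\<lambda>y. k * f y) x = k * T f x" if "f \<in> L2 lebesgue" for f k
      using op that by (simp add: bounded_operator_L2_def)
    show "(LINT x|lebesgue. (cmod (T f x))\<^sup>2) \<le> b\<^sup>2 * (LINT x|lebesgue. (cmod (f x))\<^sup>2)" if "f \<in> L2 lebesgue" for f
    proof -
      have "(sqrt (sqnorm lebesgue (T f)))\<^sup>2 \<le> (b * sqrt (sqnorm lebesgue f))\<^sup>2"
        using b[OF that] by (intro power_mono) (auto simp: L2_norm_sqnorm sqnorm_nonneg)
      then have "sqnorm lebesgue (T f) \<le> b\<^sup>2 * sqnorm lebesgue f" by (simp add: power_mult_distrib sqnorm_nonneg)
      then show ?thesis by (simp add: sqnorm_def)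
    qed
    show "AE x in lebesgue. x \<notin> closure {y. f y \<noteq> 0} \<longrightarrow> T f x = (LINT y|lebesgue. K x y * f y)" if "nice f" for f
      using that by (intro rep) (auto simp: nice_def compact_closure)
    show "cmod (K x y) \<le> \<bar>C\<bar> / norm (x - y) ^ CARD('d)" if "x \<noteq> y" for x y
      by (rule order_trans[OF size[OF that]]) (intro divide_right_mono; simp)
    show "cmod (K x y - K x' y) + cmod (K y x - K y x') \<le> \<bar>C\<bar> * norm (x - x') powr \<delta> / norm (x - y) powr (real CARD('d) + \<delta>)"
      if "2 * norm (x - x') < norm (x - y)" for x x' y
      by (rule order_trans[OF smooth[OF that]]) (intro divide_right_mono mult_right_mono; simp)
  qed (use \<delta> in auto)
  then show ?thesis by blast
qed

theorem theorem1p1: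
  fixes T :: "(real^'d \<Rightarrow> complex) \<Rightarrow> real^'d \<Rightarrow> complex"
  assumes "calderon_zygmund_operator T"
  shows "\<exists>C::real. \<forall>w. A2_weight w \<longrightarrow>
    (\<exists>S. bounded_extension_L2 w T S) \<and>
    (\<forall>S. bounded_extension_L2 w T S \<longrightarrow>
      (\<forall>f \<in> L2 (weight_measure w).
        L2_norm (weight_measure w) (S f)
          \<le> C * enn2real (A2_constant w) * L2_norm (weight_measure w) f))"
proof -
  obtain K Cz \<delta> B where "calderon_zygmund T K Cz \<delta> B" using calderon_zygmund_operator_locale[OF assms] by blast
  then interpret calderon_zygmund T K Cz \<delta> B .
  obtain C where C: "C \<ge> 0" "\<And>w f. A2_weight w \<Longrightarrow> nice f \<Longrightarrow>
      (\<integral>\<^sup>+x. ennreal ((cmod (T f x))\<^sup>2) \<partial>weight_measure w)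
        \<le> ennreal (C * (enn2real (A2_constant w))\<^sup>2 * sqnorm (weight_measure w) f)"
    by (rule nice_weighted_bound) blast
  show ?thesis
  proof (intro exI[of _ "sqrt (2 * C)"] allI impI conjI ballI)
    fix w :: "real^'d \<Rightarrow> real" assume w: "A2_weight w"
    interpret weighted_calderon_zygmund T K Cz \<delta> B w "C * (enn2real (A2_constant w))\<^sup>2"
      by unfold_locales (use w C in auto)
    show "\<exists>S. bounded_extension_L2 w T S" by (rule extension_exists)
    fix S f assume S: "bounded_extension_L2 w T S" and f: "f \<in> L2 wm"
    have "L2_norm wm (S f) \<le> sqrt (2 * (C * (enn2real (A2_constant w))\<^sup>2) * sqnorm wm f)"
      unfolding L2_norm_sqnorm by (rule real_sqrt_le_mono[OF extension_bound[OF S f]])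
    also have "\<dots> = sqrt (2 * C) * enn2real (A2_constant w) * L2_norm wm f"
      by (simp add: L2_norm_sqnorm real_sqrt_mult mult_ac)
    finally show "L2_norm wm (S f) \<le> sqrt (2 * C) * enn2real (A2_constant w) * L2_norm wm f" .
  qed
qed

end
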